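(* Let $\mathcal{A}$ be a central essential arrangement in $V=\mathbb{C}^\ell$. Then $\big(\bigwedge^p\Omega^1(\mathcal{A})\big)^{\vee\vee}\cong\Omega^p(\mathcal{A})$ for $0\le p\le\ell$.
   Context: $\mathcal{A}$ is a finite set of distinct linear hyperplanes in $V=\mathbb{C}^\ell$ with common intersection $\{0\}$; $R=\operatorname{Sym}(V^* )$; each $H\in\mathcal{A}$ is the kernel of a linear form $\alpha_H$, and $f=\prod_{H\in\mathcal{A}}\alpha_H$. $\Omega^p_V$ is the free $R$-module of polynomial $p$-forms on $V$. The module of logarithmic $p$-forms is $$\Omega^p(\mathcal{A})=\Big\{\omega\in\tfrac1f\Omega^p_V\ \Big|\ \forall H\in\mathcal{A}:\ \tfrac{d\alpha_H}{\alpha_H}\wedge\omega\in\tfrac1f\Omega^{p+1}_V\Big\}.$$ $-^\vee=\operatorname{Hom}_R(-,R)$, and exterior powers are over $R$. *)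

theory Defs
  imports
    "HOL-Library.Poly_Mapping"
    "HOL-Computational_Algebra.Polynomial_Factorial"
    "HOL-Algebra.AbelCoset"
    "Jordan_Normal_Form.VS_Connect"
begin

section \<open>Modules over a commutative ring\<close>

text \<open>
  Modules are records in the sense of \<^locale>\<open>Module.module\<close>. The fields
  \<open>mult\<close> and \<open>one\<close>, which these records inherit from rings, carry no meaning for a
  module and are left undefined, as in \<^const>\<open>module_vec\<close>.
\<close>

definition module_isomorphic ::
  "('a, 'c0) ring_scheme \<Rightarrow> ('a, 'b, 'c1) module_scheme \<Rightarrow> ('a, 'd, 'c2) module_scheme \<Rightarrow> bool"
  where "module_isomorphic R M N \<longleftrightarrow>
    (\<exists>h \<in> LinearCombinations.module_hom R M N. bij_betw h (carrier M) (carrier N))"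

definition self_module :: "('a, 'c) ring_scheme \<Rightarrow> ('a, 'a) module"
  where "self_module R = \<lparr>carrier = carrier R, mult = undefined, one = undefined,
    zero = \<zero>\<^bsub>R\<^esub>, add = add R, smult = mult R\<rparr>"

text \<open>
  Homomorphisms are made extensional, so that they are determined by their values on
  the carrier of \<open>M\<close>.
\<close>

definition hom_module ::
  "('a, 'c0) ring_scheme \<Rightarrow> ('a, 'b, 'c1) module_scheme \<Rightarrow> ('a, 'd, 'c2) module_scheme
    \<Rightarrow> ('a, 'b \<Rightarrow> 'd) module"
  where "hom_module R M N = \<lparr>carrier = LinearCombinations.module_hom R M N \<inter> extensional (carrier M),
    mult = undefined, one = undefined,
    zero = (\<lambda>x\<in>carrier M. \<zero>\<^bsub>N\<^esub>),
    add = (\<lambda>\<phi> \<psi>. \<lambda>x\<in>carrier M. \<phi> x \<oplus>\<^bsub>N\<^esub> \<psi> x),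
    smult = (\<lambda>r \<phi>. \<lambda>x\<in>carrier M. r \<odot>\<^bsub>N\<^esub> \<phi> x)\<rparr>"

definition dual_module ::
  "('a, 'c0) ring_scheme \<Rightarrow> ('a, 'b, 'c1) module_scheme \<Rightarrow> ('a, 'b \<Rightarrow> 'a) module"
  where "dual_module R M = hom_module R M (self_module R)"

definition free_module :: "('a, 'c) ring_scheme \<Rightarrow> 's set \<Rightarrow> ('a, 's \<Rightarrow> 'a) module"
  where "free_module R S = \<lparr>
    carrier = {c \<in> S \<rightarrow>\<^sub>E carrier R. finite {s \<in> S. c s \<noteq> \<zero>\<^bsub>R\<^esub>}},
    mult = undefined, one = undefined,
    zero = (\<lambda>s\<in>S. \<zero>\<^bsub>R\<^esub>),
    add = (\<lambda>c d. \<lambda>s\<in>S. c s \<oplus>\<^bsub>R\<^esub> d s),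
    smult = (\<lambda>r c. \<lambda>s\<in>S. r \<otimes>\<^bsub>R\<^esub> c s)\<rparr>"

definition free_gen :: "('a, 'c) ring_scheme \<Rightarrow> 's set \<Rightarrow> 's \<Rightarrow> 's \<Rightarrow> 'a"
  where "free_gen R S s = (\<lambda>t\<in>S. if t = s then \<one>\<^bsub>R\<^esub> else \<zero>\<^bsub>R\<^esub>)"

definition quotient_module ::
  "('a, 'b, 'c) module_scheme \<Rightarrow> 'b set \<Rightarrow> ('a, 'b set) module"
  where "quotient_module M N = \<lparr>carrier = a_rcosets\<^bsub>M\<^esub> N,
    mult = undefined, one = undefined,
    zero = N, add = set_add M,
    smult = (\<lambda>r C. \<Union>x\<in>C. N +>\<^bsub>M\<^esub> (r \<odot>\<^bsub>M\<^esub> x))\<rparr>"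

text \<open>
  The exterior power is presented by generators and relations: the generator of a tuple
  \<open>xs\<close> is the symbol \<open>xs ! 0 \<and> \<dots> \<and> xs ! (p - 1)\<close>, and the relations say that this symbol
  is additive and homogeneous in each slot and vanishes if two slots agree.
\<close>

definition tuples :: "('a, 'b, 'c) module_scheme \<Rightarrow> nat \<Rightarrow> 'b list set"
  where "tuples M p = {xs. length xs = p \<and> set xs \<subseteq> carrier M}"

definition ext_relations ::
  "('a, 'c0) ring_scheme \<Rightarrow> ('a, 'b, 'c1) module_scheme \<Rightarrow> nat \<Rightarrow> ('b list \<Rightarrow> 'a) set"
  where "ext_relations R M p =
    (let T = tuples M p; F = free_module R T; e = free_gen R T in
      {e (xs[i := x \<oplus>\<^bsub>M\<^esub> y]) \<ominus>\<^bsub>F\<^esub> (e (xs[i := x]) \<oplus>\<^bsub>F\<^esub> e (xs[i := y])) | xs i x y.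
         xs \<in> T \<and> i < p \<and> x \<in> carrier M \<and> y \<in> carrier M} \<union>
      {e (xs[i := r \<odot>\<^bsub>M\<^esub> x]) \<ominus>\<^bsub>F\<^esub> (r \<odot>\<^bsub>F\<^esub> e (xs[i := x])) | xs i r x.
         xs \<in> T \<and> i < p \<and> r \<in> carrier R \<and> x \<in> carrier M} \<union>
      {e xs | xs i j. xs \<in> T \<and> i < j \<and> j < p \<and> xs ! i = xs ! j})"

definition exterior_power ::
  "('a, 'c0) ring_scheme \<Rightarrow> ('a, 'b, 'c1) module_scheme \<Rightarrow> nat \<Rightarrow> ('a, ('b list \<Rightarrow> 'a) set) module"
  where "exterior_power R M p =
    (let F = free_module R (tuples M p)
     in quotient_module F (LinearCombinations.module.span R F (ext_relations R M p)))"


section \<open>Polynomials in \<open>n\<close> variables\<close>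

text \<open>
  \<open>Sym(V\<^sup>*)\<close> for \<open>V = \<complex>\<^sup>n\<close> is the polynomial ring in the coordinates
  \<open>x\<^sub>0, \<dots>, x\<^bsub>n-1\<^esub>\<close>. It is a subring of the type below, which has the variables \<open>x\<^sub>i\<close> for
  all \<open>i\<close>; a monomial is its exponent vector.
\<close>

type_synonym cpoly = "(nat \<Rightarrow>\<^sub>0 nat) \<Rightarrow>\<^sub>0 complex"

definition mpolys :: "nat \<Rightarrow> cpoly set"
  where "mpolys n = {p. \<forall>m \<in> Poly_Mapping.keys p. Poly_Mapping.keys m \<subseteq> {..<n}}"

definition mpoly_ring :: "nat \<Rightarrow> cpoly ring"
  where "mpoly_ring n = \<lparr>carrier = mpolys n, mult = (*), one = 1, zero = 0, add = (+)\<rparr>"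

definition partial_deriv :: "nat \<Rightarrow> cpoly \<Rightarrow> cpoly"
  where "partial_deriv i p = (\<Sum>m \<in> Poly_Mapping.keys p.
    Poly_Mapping.single (m - Poly_Mapping.single i 1)
      (of_nat (Poly_Mapping.lookup m i) * Poly_Mapping.lookup p m))"

definition linear_form :: "complex vec \<Rightarrow> cpoly"
  where "linear_form a = (\<Sum>i<dim_vec a. Poly_Mapping.single (Poly_Mapping.single i 1) (a $ i))"


section \<open>Differential forms with rational coefficients\<close>

text \<open>
  The function \<open>\<omega>\<close> stands for the form \<open>\<Sum>\<^sub>I \<omega>(I) dx\<^sub>I\<close>, where
  \<open>dx\<^sub>I = dx\<^bsub>i\<^sub>1\<^esub> \<and> \<dots> \<and> dx\<^bsub>i\<^sub>p\<^esub>\<close> for \<open>I = {i\<^sub>1 < \<dots> < i\<^sub>p}\<close>.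
\<close>

type_synonym rform = "nat set \<Rightarrow> cpoly fract"

definition poly_forms :: "nat \<Rightarrow> nat \<Rightarrow> rform set"
  where "poly_forms n p = {\<omega>. \<forall>I.
    if I \<subseteq> {..<n} \<and> card I = p then \<omega> I \<in> to_fract ` mpolys n else \<omega> I = 0}"

definition poly_forms_over :: "cpoly \<Rightarrow> nat \<Rightarrow> nat \<Rightarrow> rform set"
  where "poly_forms_over f n p = {\<lambda>I. \<omega> I / to_fract f | \<omega>. \<omega> \<in> poly_forms n p}"

text \<open>
  For disjoint \<open>I\<close> and \<open>J\<close>, \<open>dx\<^sub>I \<and> dx\<^sub>J = shuffle_sign I J \<cdot> dx\<^bsub>I \<union> J\<^esub>\<close>.
\<close>

definition shuffle_sign :: "nat set \<Rightarrow> nat set \<Rightarrow> 'a::comm_ring_1"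
  where "shuffle_sign I J = (- 1) ^ card {(i, j). i \<in> I \<and> j \<in> J \<and> j < i}"

definition wedge :: "rform \<Rightarrow> rform \<Rightarrow> rform"
  where "wedge \<omega> \<eta> = (\<lambda>K. \<Sum>I\<in>Pow K. shuffle_sign I (K - I) * \<omega> I * \<eta> (K - I))"

definition differential :: "nat \<Rightarrow> cpoly \<Rightarrow> rform"
  where "differential n g = (\<lambda>I. \<Sum>i<n. if I = {i} then to_fract (partial_deriv i g) else 0)"

definition dlog :: "nat \<Rightarrow> cpoly \<Rightarrow> rform"
  where "dlog n g = (\<lambda>I. differential n g I / to_fract g)"


section \<open>Hyperplane arrangements and logarithmic forms\<close>

text \<open>
  \<open>\<alpha> H\<close> is the coefficient vector of a linear form with kernel \<open>H\<close>. The intersection of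
  the hyperplanes is taken within \<open>\<complex>\<^sup>n\<close>, which matters for \<open>\<A> = {}\<close>.
\<close>

locale central_essential_arrangement =
  fixes n :: nat and \<A> :: "complex vec set set" and \<alpha> :: "complex vec set \<Rightarrow> complex vec"
  assumes finite_arrangement: "finite \<A>"
    and form_carrier: "H \<in> \<A> \<Longrightarrow> \<alpha> H \<in> carrier_vec n"
    and form_nonzero: "H \<in> \<A> \<Longrightarrow> \<alpha> H \<noteq> 0\<^sub>v n"
    and form_kernel: "H \<in> \<A> \<Longrightarrow> H = {v \<in> carrier_vec n. \<alpha> H \<bullet> v = 0}"
    and essential: "carrier_vec n \<inter> \<Inter>\<A> = {0\<^sub>v n}"

definition defining_poly ::
  "complex vec set set \<Rightarrow> (complex vec set \<Rightarrow> complex vec) \<Rightarrow> cpoly"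
  where "defining_poly \<A> \<alpha> = (\<Prod>H\<in>\<A>. linear_form (\<alpha> H))"

definition log_forms ::
  "nat \<Rightarrow> complex vec set set \<Rightarrow> (complex vec set \<Rightarrow> complex vec) \<Rightarrow> nat \<Rightarrow> rform set"
  where "log_forms n \<A> \<alpha> p = {\<omega> \<in> poly_forms_over (defining_poly \<A> \<alpha>) n p.
    \<forall>H\<in>\<A>. wedge (dlog n (linear_form (\<alpha> H))) \<omega> \<in> poly_forms_over (defining_poly \<A> \<alpha>) n (p + 1)}"

definition log_module ::
  "nat \<Rightarrow> complex vec set set \<Rightarrow> (complex vec set \<Rightarrow> complex vec) \<Rightarrow> nat \<Rightarrow> (cpoly, rform) module"
  where "log_module n \<A> \<alpha> p = \<lparr>carrier = log_forms n \<A> \<alpha> p,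
    mult = undefined, one = undefined,
    zero = (\<lambda>I. 0),
    add = (\<lambda>\<omega> \<eta> I. \<omega> I + \<eta> I),
    smult = (\<lambda>r \<omega> I. to_fract r * \<omega> I)\<rparr>"

end

theory Submission
  imports Defs
begin

text \<open>
  Let \<open>R\<close> be the polynomial ring, \<open>K\<close> its fraction field, \<open>f\<close> the product of the linear forms
  \<open>\<alpha>\<^sub>H\<close> and \<open>\<Omega>\<^sup>1\<close> the module of logarithmic one-forms. The proof identifies both sides with
  one and the same lattice of \<open>p\<close>-forms over \<open>K\<close>.

  A functional on \<open>\<And>\<^sup>p \<Omega>\<^sup>1\<close> is an alternating map \<open>\<mu>\<close> on \<open>\<Omega>\<^sup>1\<close>. Since \<open>dx\<^sub>i \<in> \<Omega>\<^sup>1\<close> and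
  \<open>f \<Omega>\<^sup>1\<close> lies in the span of the \<open>dx\<^sub>i\<close>, such a map is determined by the polynomials
  \<open>c\<^sub>I = \<mu>(dx\<^sub>I)\<close>: it is \<open>\<mu>(\<omega>\<^sub>1, \<dots>, \<omega>\<^sub>p) = \<Sum>\<^sub>I (\<omega>\<^sub>1 \<and> \<dots> \<and> \<omega>\<^sub>p)\<^sub>I c\<^sub>I\<close>
  (lemma \<open>alternating_map_eq_pairing\<close>). Hence the dual of \<open>\<And>\<^sup>p \<Omega>\<^sup>1\<close> is the lattice \<open>D\<close> of all
  \<open>c\<close> over \<open>R\<close> that pair every product \<open>\<omega>\<^sub>1 \<and> \<dots> \<and> \<omega>\<^sub>p\<close> into \<open>R\<close>. It contains
  \<open>f\<^sup>p\<close> times each basis vector, so a functional on \<open>D\<close> is the pairing with a unique \<open>p\<close>-form over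
  \<open>K\<close>, and the double dual is the lattice of \<open>p\<close>-forms that pair \<open>D\<close> into \<open>R\<close>. It remains to see
  that these are exactly the logarithmic \<open>p\<close>-forms (lemmas \<open>log_form_pairing_regular\<close> and
  \<open>log_formI_pairing\<close>).

  This can be checked one hyperplane at a time. The \<open>\<alpha>\<^sub>H\<close> are pairwise non-associate primes, so
  an element of \<open>K\<close> whose denominator divides a power of \<open>f\<close> is a polynomial as soon as, for each
  \<open>H\<close>, some multiple of it by a polynomial prime to \<open>\<alpha>\<^sub>H\<close> is one (\<open>regular_local_global\<close>). Near \<open>H\<close>
  the arrangement is a single smooth divisor: with \<open>s = f / \<alpha>\<^sub>H\<close>, which is prime to \<open>\<alpha>\<^sub>H\<close>,
  every logarithmic form \<open>\<omega>\<close> satisfies \<open>s \<omega> = d\<alpha>\<^sub>H / \<alpha>\<^sub>H \<and> \<beta> + \<gamma>\<close> with polynomial \<open>\<beta>\<close>, \<open>\<gamma>\<close>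
  (\<open>log_form_decomposition\<close>). So \<open>s \<omega>\<close> is a combination of products of logarithmic one-forms,
  which gives one inclusion; conversely, products of \<open>p\<close> logarithmic one-forms have such a
  decomposition after multiplication by \<open>s\<^sup>p\<close>, and this supplies enough elements of \<open>D\<close> for the
  other inclusion.
\<close>

section \<open>Functionals on free modules, quotients and exterior powers\<close>

lemma free_module_simps:
  "carrier (free_module R S) = {c \<in> S \<rightarrow>\<^sub>E carrier R. finite {s \<in> S. c s \<noteq> \<zero>\<^bsub>R\<^esub>}}"
  "\<zero>\<^bsub>free_module R S\<^esub> = (\<lambda>s\<in>S. \<zero>\<^bsub>R\<^esub>)"
  "c \<oplus>\<^bsub>free_module R S\<^esub> d = (\<lambda>s\<in>S. c s \<oplus>\<^bsub>R\<^esub> d s)"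
  "r \<odot>\<^bsub>free_module R S\<^esub> c = (\<lambda>s\<in>S. r \<otimes>\<^bsub>R\<^esub> c s)"
  by (simp_all add: free_module_def)

context cring
begin

lemma free_module_apply_closed: "c \<in> carrier (free_module R S) \<Longrightarrow> s \<in> S \<Longrightarrow> c s \<in> carrier R"
  by (auto simp: free_module_simps)

lemma free_module_eqI:
  assumes "c \<in> carrier (free_module R S)" and "d \<in> carrier (free_module R S)"
    and "\<And>s. s \<in> S \<Longrightarrow> c s = d s"
  shows "c = d"
  using assms by (auto simp: free_module_simps intro: PiE_ext)

lemma free_module_add_closed:
  assumes "c \<in> carrier (free_module R S)" and "d \<in> carrier (free_module R S)"
  shows "c \<oplus>\<^bsub>free_module R S\<^esub> d \<in> carrier (free_module R S)"
proof -
  have "finite ({s \<in> S. c s \<noteq> \<zero>} \<union> {s \<in> S. d s \<noteq> \<zero>})"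
    using assms by (simp add: free_module_simps)
  then have "finite {s \<in> S. c s \<oplus> d s \<noteq> \<zero>}"
    by (rule rev_finite_subset) auto
  then show ?thesis
    using assms by (auto simp: free_module_simps PiE_iff cong: conj_cong)
qed

lemma free_module_smult_closed:
  assumes "r \<in> carrier R" and "c \<in> carrier (free_module R S)"
  shows "r \<odot>\<^bsub>free_module R S\<^esub> c \<in> carrier (free_module R S)"
proof -
  have "finite {s \<in> S. c s \<noteq> \<zero>}"
    using assms by (simp add: free_module_simps)
  then have "finite {s \<in> S. r \<otimes> c s \<noteq> \<zero>}"
    by (rule rev_finite_subset) (use assms in auto)
  then show ?thesis
    using assms by (auto simp: free_module_simps PiE_iff cong: conj_cong)
qed

lemma free_module_abelian_group: "abelian_group (free_module R S)"
proof (rule abelian_groupI)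
  let ?F = "free_module R S"
  have apply_closed: "c s \<in> carrier R" if "c \<in> carrier ?F" "s \<in> S" for c s
    using that by (rule free_module_apply_closed)
  show "\<zero>\<^bsub>?F\<^esub> \<in> carrier ?F"
    by (auto simp: free_module_simps)
  fix c assume c: "c \<in> carrier ?F"
  then have "finite {s \<in> S. c s \<noteq> \<zero>}"
    by (simp add: free_module_simps)
  then have "finite {s \<in> S. \<ominus> c s \<noteq> \<zero>}"
    by (rule rev_finite_subset) auto
  then have "(\<lambda>s\<in>S. \<ominus> c s) \<in> carrier ?F"
    using apply_closed [OF c] by (auto simp: free_module_simps cong: conj_cong)
  moreover have "(\<lambda>s\<in>S. \<ominus> c s) \<oplus>\<^bsub>?F\<^esub> c = \<zero>\<^bsub>?F\<^esub>"
    using apply_closed [OF c] by (auto simp: free_module_simps l_neg)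
  ultimately show "\<exists>d\<in>carrier ?F. d \<oplus>\<^bsub>?F\<^esub> c = \<zero>\<^bsub>?F\<^esub>"
    by blast
  show "\<zero>\<^bsub>?F\<^esub> \<oplus>\<^bsub>?F\<^esub> c = c"
  proof (rule free_module_eqI [OF free_module_add_closed c])
    show "\<zero>\<^bsub>?F\<^esub> \<in> carrier ?F"
      by (auto simp: free_module_simps)
  qed (use c apply_closed [OF c] in \<open>simp_all add: free_module_simps(2,3)\<close>)
  fix d assume d: "d \<in> carrier ?F"
  show "c \<oplus>\<^bsub>?F\<^esub> d \<in> carrier ?F"
    using c d by (rule free_module_add_closed)
  show "c \<oplus>\<^bsub>?F\<^esub> d = d \<oplus>\<^bsub>?F\<^esub> c"
    unfolding free_module_simps(3) using apply_closed [OF c] apply_closed [OF d]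
    by (intro restrict_ext a_comm)
  fix e assume e: "e \<in> carrier ?F"
  show "c \<oplus>\<^bsub>?F\<^esub> d \<oplus>\<^bsub>?F\<^esub> e = c \<oplus>\<^bsub>?F\<^esub> (d \<oplus>\<^bsub>?F\<^esub> e)"
    unfolding free_module_simps(3)
    using apply_closed [OF c] apply_closed [OF d] apply_closed [OF e]
    by (intro restrict_ext) (simp add: a_assoc)
qed

lemma free_module_module: "Module.module R (free_module R S)"
proof (intro Module.moduleI is_cring free_module_abelian_group free_module_smult_closed)
  let ?F = "free_module R S"
  have apply_closed: "c s \<in> carrier R" if "c \<in> carrier ?F" "s \<in> S" for c s
    using that by (rule free_module_apply_closed)
  fix c assume c: "c \<in> carrier ?F"
  show "\<one> \<odot>\<^bsub>?F\<^esub> c = c"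
    using c apply_closed [OF c]
    by (intro free_module_eqI [OF free_module_smult_closed c]) (simp_all add: free_module_simps(4))
  fix a assume a: "a \<in> carrier R"
  show "a \<odot>\<^bsub>?F\<^esub> (c \<oplus>\<^bsub>?F\<^esub> d) = a \<odot>\<^bsub>?F\<^esub> c \<oplus>\<^bsub>?F\<^esub> a \<odot>\<^bsub>?F\<^esub> d" if "d \<in> carrier ?F" for d
    unfolding free_module_simps(3,4) using a apply_closed [OF c] apply_closed [OF that]
    by (intro restrict_ext) (simp add: r_distr)
  fix b assume b: "b \<in> carrier R"
  show "(a \<oplus> b) \<odot>\<^bsub>?F\<^esub> c = a \<odot>\<^bsub>?F\<^esub> c \<oplus>\<^bsub>?F\<^esub> b \<odot>\<^bsub>?F\<^esub> c"
    unfolding free_module_simps(3,4) using a b apply_closed [OF c]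
    by (intro restrict_ext) (simp add: l_distr)
  show "(a \<otimes> b) \<odot>\<^bsub>?F\<^esub> c = a \<odot>\<^bsub>?F\<^esub> (b \<odot>\<^bsub>?F\<^esub> c)"
    unfolding free_module_simps(4) using a b apply_closed [OF c]
    by (intro restrict_ext) (simp add: m_assoc)
qed

lemma free_gen_closed: "s \<in> S \<Longrightarrow> free_gen R S s \<in> carrier (free_module R S)"
proof -
  have "finite {t \<in> S. (if t = s then \<one> else \<zero>) \<noteq> \<zero>}"
    by (rule finite_subset [of _ "{s}"]) auto
  then show ?thesis
    by (auto simp: free_module_simps free_gen_def cong: conj_cong)
qed

text \<open>
  The linear map on the free module with prescribed values on the generators. The sum runs over
  the support, which is finite for elements of the free module.
\<close>

definition linear_extension :: "'s set \<Rightarrow> ('s \<Rightarrow> 'a) \<Rightarrow> ('s \<Rightarrow> 'a) \<Rightarrow> 'a"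
  where "linear_extension S \<mu> c = (\<Oplus>s\<in>{s \<in> S. c s \<noteq> \<zero>}. c s \<otimes> \<mu> s)"

lemma linear_extension_superset:
  assumes "\<mu> \<in> S \<rightarrow> carrier R" and "c \<in> carrier (free_module R S)"
    and "finite T" and "T \<subseteq> S" and "{s \<in> S. c s \<noteq> \<zero>} \<subseteq> T"
  shows "linear_extension S \<mu> c = (\<Oplus>s\<in>T. c s \<otimes> \<mu> s)"
  unfolding linear_extension_def
proof (rule add.finprod_mono_neutral_cong_left)
  show "c i \<otimes> \<mu> i = \<zero>" if "i \<in> T - {s \<in> S. c s \<noteq> \<zero>}" for i
    using that assms by (auto simp: Pi_iff)
  show "(\<lambda>s. c s \<otimes> \<mu> s) \<in> T \<rightarrow> carrier R"
    using assms free_module_apply_closed [OF assms(2)] by (auto simp: Pi_iff)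
qed (use assms in auto)

lemma linear_extension_hom:
  assumes \<mu>: "\<mu> \<in> S \<rightarrow> carrier R"
  shows "linear_extension S \<mu> \<in> LinearCombinations.module_hom R (free_module R S) (self_module R)"
proof -
  let ?F = "free_module R S"
  have closed: "c s \<otimes> \<mu> s \<in> carrier R" if "c \<in> carrier ?F" "s \<in> S" for c s
    using that \<mu> free_module_apply_closed [OF that] by (auto simp: Pi_iff)
  have fin: "finite {s \<in> S. c s \<noteq> \<zero>}" if "c \<in> carrier ?F" for c
    using that by (simp add: free_module_simps)
  have "linear_extension S \<mu> (c \<oplus>\<^bsub>?F\<^esub> d) = linear_extension S \<mu> c \<oplus> linear_extension S \<mu> d"
    if c: "c \<in> carrier ?F" and d: "d \<in> carrier ?F" for c d
  proof -
    let ?T = "{s \<in> S. c s \<noteq> \<zero>} \<union> {s \<in> S. d s \<noteq> \<zero>}"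
    have "linear_extension S \<mu> (c \<oplus>\<^bsub>?F\<^esub> d) = (\<Oplus>s\<in>?T. (c \<oplus>\<^bsub>?F\<^esub> d) s \<otimes> \<mu> s)"
      using \<mu> c d fin [OF c] fin [OF d]
      by (intro linear_extension_superset free_module_add_closed) (auto simp: free_module_simps(3))
    also have "\<dots> = (\<Oplus>s\<in>?T. c s \<otimes> \<mu> s \<oplus> d s \<otimes> \<mu> s)"
    proof (intro finsum_cong')
      fix s assume s: "s \<in> ?T"
      then have "\<mu> s \<in> carrier R" "c s \<in> carrier R" "d s \<in> carrier R"
        using \<mu> c d by (auto simp: free_module_apply_closed)
      then show "(c \<oplus>\<^bsub>?F\<^esub> d) s \<otimes> \<mu> s = c s \<otimes> \<mu> s \<oplus> d s \<otimes> \<mu> s"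
        using s by (auto simp: free_module_simps(3) l_distr)
    qed (use closed [OF c] closed [OF d] in auto)
    also have "\<dots> = (\<Oplus>s\<in>?T. c s \<otimes> \<mu> s) \<oplus> (\<Oplus>s\<in>?T. d s \<otimes> \<mu> s)"
      using closed [OF c] closed [OF d] by (intro finsum_addf) auto
    also have "(\<Oplus>s\<in>?T. c s \<otimes> \<mu> s) = linear_extension S \<mu> c"
      using \<mu> c d fin [OF c] fin [OF d] by (intro linear_extension_superset [symmetric]) auto
    also have "(\<Oplus>s\<in>?T. d s \<otimes> \<mu> s) = linear_extension S \<mu> d"
      using \<mu> c d fin [OF c] fin [OF d] by (intro linear_extension_superset [symmetric]) auto
    finally show ?thesis .
  qed
  moreover have "linear_extension S \<mu> (r \<odot>\<^bsub>?F\<^esub> c) = r \<otimes> linear_extension S \<mu> c"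
    if r: "r \<in> carrier R" and c: "c \<in> carrier ?F" for r c
  proof -
    let ?T = "{s \<in> S. c s \<noteq> \<zero>}"
    have "linear_extension S \<mu> (r \<odot>\<^bsub>?F\<^esub> c) = (\<Oplus>s\<in>?T. (r \<odot>\<^bsub>?F\<^esub> c) s \<otimes> \<mu> s)"
      using \<mu> r c fin [OF c]
      by (intro linear_extension_superset free_module_smult_closed) (auto simp: free_module_simps(4))
    also have "\<dots> = (\<Oplus>s\<in>?T. r \<otimes> (c s \<otimes> \<mu> s))"
    proof (intro finsum_cong')
      fix s assume s: "s \<in> ?T"
      then have "\<mu> s \<in> carrier R" "c s \<in> carrier R"
        using \<mu> c by (auto simp: free_module_apply_closed)
      then show "(r \<odot>\<^bsub>?F\<^esub> c) s \<otimes> \<mu> s = r \<otimes> (c s \<otimes> \<mu> s)"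
        using s r by (auto simp: free_module_simps(4) m_assoc)
    qed (use closed [OF c] r in auto)
    also have "\<dots> = r \<otimes> linear_extension S \<mu> c"
      unfolding linear_extension_def using closed [OF c] r fin [OF c] by (intro finsum_rdistr [symmetric]) auto
    finally show ?thesis .
  qed
  moreover have "linear_extension S \<mu> c \<in> carrier R" if "c \<in> carrier ?F" for c
    unfolding linear_extension_def using closed [OF that] by (intro finsum_closed) auto
  ultimately show ?thesis
    by (auto simp: LinearCombinations.module_hom_def self_module_def Pi_iff)
qed

lemma linear_extension_free_gen:
  assumes "\<mu> \<in> S \<rightarrow> carrier R" and "s \<in> S"
  shows "linear_extension S \<mu> (free_gen R S s) = \<mu> s"
proof -
  have "linear_extension S \<mu> (free_gen R S s) = (\<Oplus>t\<in>{s}. free_gen R S s t \<otimes> \<mu> t)"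
    using assms by (intro linear_extension_superset free_gen_closed) (auto simp: free_gen_def)
  also have "\<dots> = \<mu> s"
    using assms by (auto simp: free_gen_def Pi_iff)
  finally show ?thesis .
qed

text \<open>
  Induction on the support: an element splits off the multiple of one generator.
\<close>

lemma free_module_hom_eqI:
  assumes f: "f \<in> LinearCombinations.module_hom R (free_module R S) (self_module R)"
    and g: "g \<in> LinearCombinations.module_hom R (free_module R S) (self_module R)"
    and eq: "\<And>s. s \<in> S \<Longrightarrow> f (free_gen R S s) = g (free_gen R S s)"
    and "c \<in> carrier (free_module R S)"
  shows "f c = g c"
proof -
  let ?F = "free_module R S"
  interpret F: Module.module R ?F
    by (rule free_module_module)
  have "f c = g c" if "finite T" "T = {s \<in> S. c s \<noteq> \<zero>}" "c \<in> carrier ?F" for T c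
    using that
  proof (induction T arbitrary: c rule: finite_induct)
    case empty
    then have "c = \<zero> \<odot>\<^bsub>?F\<^esub> c"
      by (intro free_module_eqI [of _ S] F.smult_closed) (auto simp: free_module_simps PiE_iff)
    then have "f c = \<zero> \<otimes> f c" "g c = \<zero> \<otimes> g c"
      using LinearCombinations.module_hom_smult [OF f, of \<zero> c] LinearCombinations.module_hom_smult [OF g, of \<zero> c] empty(2)
      by (simp_all add: self_module_def)
    moreover have "f c \<in> carrier R" "g c \<in> carrier R"
      using f g empty(2) by (auto simp: LinearCombinations.module_hom_def self_module_def Pi_iff)
    ultimately show ?case
      by simp
  next
    case (insert x T)
    let ?e = "free_gen R S x"
    define d where "d = (\<lambda>s\<in>S. if s = x then \<zero> else c s)"
    have x: "x \<in> S"
      using insert.prems(1) by blast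
    have "{s \<in> S. d s \<noteq> \<zero>} = {s \<in> S. c s \<noteq> \<zero>} - {x}"
      by (auto simp: d_def)
    then have T: "T = {s \<in> S. d s \<noteq> \<zero>}"
      using insert.hyps(2) unfolding insert.prems(1) [symmetric] by simp
    have d: "d \<in> carrier ?F"
      using insert.hyps(1) insert.prems(2) unfolding T
      by (auto simp: free_module_simps d_def PiE_iff)
    have e: "?e \<in> carrier ?F"
      using x by (rule free_gen_closed)
    have cx: "c x \<in> carrier R"
      using insert.prems(2) x by (rule free_module_apply_closed)
    have c: "c = (c x \<odot>\<^bsub>?F\<^esub> ?e) \<oplus>\<^bsub>?F\<^esub> d"
    proof (rule free_module_eqI [OF insert.prems(2)])
      show "c x \<odot>\<^bsub>?F\<^esub> ?e \<oplus>\<^bsub>?F\<^esub> d \<in> carrier ?F"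
        using cx e d by simp
      show "c s = (c x \<odot>\<^bsub>?F\<^esub> ?e \<oplus>\<^bsub>?F\<^esub> d) s" if "s \<in> S" for s
        using that cx free_module_apply_closed [OF insert.prems(2) that]
        by (auto simp: free_module_simps free_gen_def d_def)
    qed
    have hc: "h c = c x \<otimes> h ?e \<oplus> h d"
      if "h \<in> LinearCombinations.module_hom R ?F (self_module R)" for h
      using LinearCombinations.module_hom_add [OF that, of "c x \<odot>\<^bsub>?F\<^esub> ?e" d] LinearCombinations.module_hom_smult [OF that cx e] cx e d c
      by (simp add: self_module_def)
    then show ?case
      using hc [OF f] hc [OF g] eq [OF x] insert.IH [OF T d] by simp
  qed
  then show ?thesis
    using assms(4) by (simp add: free_module_simps)
qed

end

lemma dual_module_carrierI:
  assumes "\<And>x. x \<in> carrier P \<Longrightarrow> \<phi> x \<in> carrier R"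
    and "\<And>x y. x \<in> carrier P \<Longrightarrow> y \<in> carrier P \<Longrightarrow> \<phi> (x \<oplus>\<^bsub>P\<^esub> y) = \<phi> x \<oplus>\<^bsub>R\<^esub> \<phi> y"
    and "\<And>r x. r \<in> carrier R \<Longrightarrow> x \<in> carrier P \<Longrightarrow> \<phi> (r \<odot>\<^bsub>P\<^esub> x) = r \<otimes>\<^bsub>R\<^esub> \<phi> x"
    and "\<phi> \<in> extensional (carrier P)"
  shows "\<phi> \<in> carrier (dual_module R P)"
  using assms by (simp add: dual_module_def hom_module_def self_module_def LinearCombinations.module_hom_def)

lemma dual_moduleD:
  assumes "\<phi> \<in> carrier (dual_module R P)"
  shows "x \<in> carrier P \<Longrightarrow> \<phi> x \<in> carrier R"
    and "x \<in> carrier P \<Longrightarrow> y \<in> carrier P \<Longrightarrow> \<phi> (x \<oplus>\<^bsub>P\<^esub> y) = \<phi> x \<oplus>\<^bsub>R\<^esub> \<phi> y"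
    and "r \<in> carrier R \<Longrightarrow> x \<in> carrier P \<Longrightarrow> \<phi> (r \<odot>\<^bsub>P\<^esub> x) = r \<otimes>\<^bsub>R\<^esub> \<phi> x"
    and "\<phi> \<in> extensional (carrier P)"
    and "\<phi> \<in> LinearCombinations.module_hom R P (self_module R)"
  using assms by (auto simp: dual_module_def hom_module_def self_module_def LinearCombinations.module_hom_def)

lemma dual_module_ops:
  "\<phi> \<oplus>\<^bsub>dual_module R P\<^esub> \<psi> = (\<lambda>x\<in>carrier P. \<phi> x \<oplus>\<^bsub>R\<^esub> \<psi> x)"
  "r \<odot>\<^bsub>dual_module R P\<^esub> \<phi> = (\<lambda>x\<in>carrier P. r \<otimes>\<^bsub>R\<^esub> \<phi> x)"
  by (simp_all add: dual_module_def hom_module_def self_module_def)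

context cring
begin

lemma dual_module_closed:
  assumes add: "\<And>x y. x \<in> carrier P \<Longrightarrow> y \<in> carrier P \<Longrightarrow> x \<oplus>\<^bsub>P\<^esub> y \<in> carrier P"
    and smult: "\<And>r x. r \<in> carrier R \<Longrightarrow> x \<in> carrier P \<Longrightarrow> r \<odot>\<^bsub>P\<^esub> x \<in> carrier P"
    and \<phi>: "\<phi> \<in> carrier (dual_module R P)"
  shows "\<psi> \<in> carrier (dual_module R P) \<Longrightarrow> \<phi> \<oplus>\<^bsub>dual_module R P\<^esub> \<psi> \<in> carrier (dual_module R P)"
    and "s \<in> carrier R \<Longrightarrow> s \<odot>\<^bsub>dual_module R P\<^esub> \<phi> \<in> carrier (dual_module R P)"
proof -
  note [simp] = dual_moduleD(1-3) [OF \<phi>] add smult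
  show "\<phi> \<oplus>\<^bsub>dual_module R P\<^esub> \<psi> \<in> carrier (dual_module R P)" if "\<psi> \<in> carrier (dual_module R P)"
  proof (rule dual_module_carrierI)
    note [simp] = dual_moduleD(1-3) [OF that]
    fix x assume x: "x \<in> carrier P"
    show "(\<phi> \<oplus>\<^bsub>dual_module R P\<^esub> \<psi>) x \<in> carrier R"
      using x by (simp add: dual_module_ops)
    show "(\<phi> \<oplus>\<^bsub>dual_module R P\<^esub> \<psi>) (x \<oplus>\<^bsub>P\<^esub> y)
        = (\<phi> \<oplus>\<^bsub>dual_module R P\<^esub> \<psi>) x \<oplus> (\<phi> \<oplus>\<^bsub>dual_module R P\<^esub> \<psi>) y" if "y \<in> carrier P" for y
      using x that by (simp add: dual_module_ops a_ac)
    show "(\<phi> \<oplus>\<^bsub>dual_module R P\<^esub> \<psi>) (r \<odot>\<^bsub>P\<^esub> x) = r \<otimes> (\<phi> \<oplus>\<^bsub>dual_module R P\<^esub> \<psi>) x" if "r \<in> carrier R" for r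
      using x that by (simp add: dual_module_ops r_distr)
  qed (simp add: dual_module_ops)
  show "s \<odot>\<^bsub>dual_module R P\<^esub> \<phi> \<in> carrier (dual_module R P)" if s: "s \<in> carrier R"
  proof (rule dual_module_carrierI)
    fix x assume x: "x \<in> carrier P"
    show "(s \<odot>\<^bsub>dual_module R P\<^esub> \<phi>) x \<in> carrier R"
      using x s by (simp add: dual_module_ops)
    show "(s \<odot>\<^bsub>dual_module R P\<^esub> \<phi>) (x \<oplus>\<^bsub>P\<^esub> y)
        = (s \<odot>\<^bsub>dual_module R P\<^esub> \<phi>) x \<oplus> (s \<odot>\<^bsub>dual_module R P\<^esub> \<phi>) y" if "y \<in> carrier P" for y
      using x s that by (simp add: dual_module_ops r_distr)
    show "(s \<odot>\<^bsub>dual_module R P\<^esub> \<phi>) (r \<odot>\<^bsub>P\<^esub> x) = r \<otimes> (s \<odot>\<^bsub>dual_module R P\<^esub> \<phi>) x" if "r \<in> carrier R" for r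
      using x s that by (simp add: dual_module_ops m_lcomm)
  qed (simp add: dual_module_ops)
qed

end

context Module.module
begin

abbreviation (input) functionals
  where "functionals \<equiv> LinearCombinations.module_hom R M (self_module R)"

lemma functional_closed: "f \<in> functionals \<Longrightarrow> x \<in> carrier M \<Longrightarrow> f x \<in> carrier R"
  by (auto simp: LinearCombinations.module_hom_def self_module_def Pi_iff)

lemma functional_add:
  "f \<in> functionals \<Longrightarrow> x \<in> carrier M \<Longrightarrow> y \<in> carrier M \<Longrightarrow> f (x \<oplus>\<^bsub>M\<^esub> y) = f x \<oplus>\<^bsub>R\<^esub> f y"
  by (auto simp: LinearCombinations.module_hom_def self_module_def)

lemma functional_smult:
  "f \<in> functionals \<Longrightarrow> r \<in> carrier R \<Longrightarrow> x \<in> carrier M \<Longrightarrow> f (r \<odot>\<^bsub>M\<^esub> x) = r \<otimes>\<^bsub>R\<^esub> f x"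
  by (auto simp: LinearCombinations.module_hom_def self_module_def)

lemma functional_zero: "f \<in> functionals \<Longrightarrow> f \<zero>\<^bsub>M\<^esub> = \<zero>\<^bsub>R\<^esub>"
  using functional_smult [of f "\<zero>\<^bsub>R\<^esub>" "\<zero>\<^bsub>M\<^esub>"] functional_closed [of f "\<zero>\<^bsub>M\<^esub>"] by simp

text \<open>
  The relations of the exterior power are differences; this translates their vanishing under a
  functional into equations between values.
\<close>

lemma functional_eq_iff:
  assumes f: "f \<in> functionals" and x: "x \<in> carrier M" and y: "y \<in> carrier M"
  shows "f (x \<ominus>\<^bsub>M\<^esub> y) = \<zero>\<^bsub>R\<^esub> \<longleftrightarrow> f x = f y"
proof -
  have "x = (x \<ominus>\<^bsub>M\<^esub> y) \<oplus>\<^bsub>M\<^esub> y"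
    using x y by (simp add: a_minus_def M.a_assoc M.l_neg)
  then have "f x = f (x \<ominus>\<^bsub>M\<^esub> y) \<oplus>\<^bsub>R\<^esub> f y"
    using functional_add [OF f, of "x \<ominus>\<^bsub>M\<^esub> y" y] x y by simp
  then show ?thesis
    using functional_closed [OF f] x y by (metis M.minus_closed R.add.r_cancel_one)
qed

lemma submodule_kernel:
  assumes f: "f \<in> functionals"
  shows "LinearCombinations.submodule R {x \<in> carrier M. f x = \<zero>\<^bsub>R\<^esub>} M"
  by (rule LinearCombinations.submodule.intro)
    (use module_axioms functional_zero [OF f] in \<open>auto simp: functional_add [OF f] functional_smult [OF f]\<close>)

lemma abelian_subgroup_submodule:
  assumes "LinearCombinations.submodule R N M"
  shows "abelian_subgroup N M"
proof (rule abelian_subgroupI3)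
  interpret N: LinearCombinations.submodule R N M
    by fact
  have "\<ominus>\<^bsub>M\<^esub> x \<in> N" if "x \<in> N" for x
    using N.smult_closed [of "\<ominus>\<^bsub>R\<^esub> \<one>\<^bsub>R\<^esub>" x] that N.subset
    by (metis R.add.inv_closed R.one_closed smult_l_minus smult_one subsetD)
  then show "additive_subgroup N M"
    using N.subset N.m_closed N.zero_closed
    by (intro additive_subgroup.intro subgroup.intro) (auto simp: a_inv_def)
qed (rule M.abelian_group_axioms)

lemma coset_eq_iff:
  assumes "LinearCombinations.submodule R N M" and "x \<in> carrier M" and "y \<in> carrier M"
  shows "N +>\<^bsub>M\<^esub> x = N +>\<^bsub>M\<^esub> y \<longleftrightarrow> x \<ominus>\<^bsub>M\<^esub> y \<in> N"
proof -
  interpret N: abelian_subgroup N M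
    using assms(1) by (rule abelian_subgroup_submodule)
  have "N +>\<^bsub>M\<^esub> x = N +>\<^bsub>M\<^esub> y \<longleftrightarrow> x \<in> N +>\<^bsub>M\<^esub> y"
    using assms(2,3) N.a_repr_independence' [of x y] N.a_rcos_self [of x] by auto
  then show ?thesis
    using assms(2,3) by (simp add: N.a_rcos_module a_minus_def)
qed

lemma quotient_map_hom:
  assumes N: "LinearCombinations.submodule R N M"
  shows "(\<lambda>x. N +>\<^bsub>M\<^esub> x) \<in> LinearCombinations.module_hom R M (quotient_module M N)"
proof -
  interpret N: LinearCombinations.submodule R N M
    by fact
  interpret G: abelian_subgroup N M
    using N by (rule abelian_subgroup_submodule)
  have "(\<Union>x\<in>N +>\<^bsub>M\<^esub> m. N +>\<^bsub>M\<^esub> (r \<odot>\<^bsub>M\<^esub> x)) = N +>\<^bsub>M\<^esub> (r \<odot>\<^bsub>M\<^esub> m)"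
    if r: "r \<in> carrier R" and m: "m \<in> carrier M" for r m
  proof -
    have "N +>\<^bsub>M\<^esub> (r \<odot>\<^bsub>M\<^esub> x) = N +>\<^bsub>M\<^esub> (r \<odot>\<^bsub>M\<^esub> m)" if x: "x \<in> N +>\<^bsub>M\<^esub> m" for x
    proof -
      have xM: "x \<in> carrier M"
        using G.a_elemrcos_carrier [OF m x] .
      have "x \<ominus>\<^bsub>M\<^esub> m \<in> N"
        using x xM m by (simp add: G.a_rcos_module a_minus_def)
      then have "r \<odot>\<^bsub>M\<^esub> (x \<ominus>\<^bsub>M\<^esub> m) \<in> N"
        using r by simp
      also have "r \<odot>\<^bsub>M\<^esub> (x \<ominus>\<^bsub>M\<^esub> m) = r \<odot>\<^bsub>M\<^esub> x \<ominus>\<^bsub>M\<^esub> r \<odot>\<^bsub>M\<^esub> m"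
        using r xM m by (simp add: a_minus_def smult_r_distr smult_r_minus)
      finally show ?thesis
        using coset_eq_iff [OF N] r xM m by simp
    qed
    then show ?thesis
      by (intro UN_constant_eq [OF G.a_rcos_self [OF m]] ballI)
  qed
  then show ?thesis
    by (auto simp: LinearCombinations.module_hom_def quotient_module_def G.a_rcos_sum
        intro: M.a_rcosetsI N.subset)
qed

lemma quotient_carrier: "C \<in> carrier (quotient_module M N) \<longleftrightarrow> (\<exists>x\<in>carrier M. C = N +>\<^bsub>M\<^esub> x)"
  by (auto simp: quotient_module_def A_RCOSETS_def')

text \<open>
  Any representative of a coset may be chosen to define the induced map, since the functional
  is constant on cosets.
\<close>

lemma functional_factors_through_quotient:
  assumes N: "LinearCombinations.submodule R N M" and f: "f \<in> functionals"
    and zero: "\<And>x. x \<in> N \<Longrightarrow> f x = \<zero>\<^bsub>R\<^esub>"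
  obtains \<phi> where "\<phi> \<in> carrier (dual_module R (quotient_module M N))"
    and "\<And>x. x \<in> carrier M \<Longrightarrow> \<phi> (N +>\<^bsub>M\<^esub> x) = f x"
proof -
  let ?Q = "quotient_module M N"
  define \<phi> where "\<phi> = (\<lambda>C\<in>carrier ?Q. f (SOME x. x \<in> carrier M \<and> C = N +>\<^bsub>M\<^esub> x))"
  have \<phi>: "\<phi> (N +>\<^bsub>M\<^esub> x) = f x" if x: "x \<in> carrier M" for x
  proof -
    define y where "y = (SOME y. y \<in> carrier M \<and> N +>\<^bsub>M\<^esub> x = N +>\<^bsub>M\<^esub> y)"
    have y: "y \<in> carrier M \<and> N +>\<^bsub>M\<^esub> x = N +>\<^bsub>M\<^esub> y"
      unfolding y_def by (rule someI [of _ x]) (use x in simp)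
    then have "f x = f y"
      using coset_eq_iff [OF N x, of y] zero functional_eq_iff [OF f x, of y] by blast
    then show ?thesis
      using x by (auto simp: \<phi>_def quotient_carrier simp flip: y_def)
  qed
  have add: "(N +>\<^bsub>M\<^esub> x) \<oplus>\<^bsub>?Q\<^esub> (N +>\<^bsub>M\<^esub> y) = N +>\<^bsub>M\<^esub> (x \<oplus>\<^bsub>M\<^esub> y)"
    if "x \<in> carrier M" "y \<in> carrier M" for x y
    using LinearCombinations.module_hom_add [OF quotient_map_hom [OF N] that] by simp
  have smult: "r \<odot>\<^bsub>?Q\<^esub> (N +>\<^bsub>M\<^esub> x) = N +>\<^bsub>M\<^esub> (r \<odot>\<^bsub>M\<^esub> x)"
    if "r \<in> carrier R" "x \<in> carrier M" for r x
    using LinearCombinations.module_hom_smult [OF quotient_map_hom [OF N] that] by simp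
  have "\<phi> \<in> LinearCombinations.module_hom R ?Q (self_module R)"
    unfolding LinearCombinations.module_hom_def
  proof (intro CollectI conjI allI impI Pi_I)
    show "\<phi> C \<in> carrier (self_module R)" if "C \<in> carrier ?Q" for C
      using that \<phi> functional_closed [OF f] by (auto simp: quotient_carrier self_module_def)
    show "\<phi> (C \<oplus>\<^bsub>?Q\<^esub> D) = \<phi> C \<oplus>\<^bsub>self_module R\<^esub> \<phi> D" if "C \<in> carrier ?Q \<and> D \<in> carrier ?Q" for C D
      using that functional_add [OF f] by (auto simp: quotient_carrier self_module_def add \<phi>)
    show "\<phi> (r \<odot>\<^bsub>?Q\<^esub> C) = r \<odot>\<^bsub>self_module R\<^esub> \<phi> C" if "r \<in> carrier R \<and> C \<in> carrier ?Q" for r C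
      using that functional_smult [OF f] by (auto simp: quotient_carrier self_module_def smult \<phi>)
  qed
  then have "\<phi> \<in> carrier (dual_module R ?Q)"
    by (simp add: dual_module_def hom_module_def \<phi>_def)
  then show thesis
    using \<phi> by (rule that)
qed

end

text \<open>
  Multilinearity is expressed by list updates, as in the relations of the exterior power.
\<close>

definition alternating_map ::
  "('a, 'c0) ring_scheme \<Rightarrow> ('a, 'b, 'c1) module_scheme \<Rightarrow> nat \<Rightarrow> ('b list \<Rightarrow> 'a) \<Rightarrow> bool"
  where "alternating_map R M p \<mu> \<longleftrightarrow> \<mu> \<in> tuples M p \<rightarrow> carrier R \<and>
    (\<forall>xs\<in>tuples M p. \<forall>i<p. \<forall>x\<in>carrier M. \<forall>y\<in>carrier M.
      \<mu> (xs[i := x \<oplus>\<^bsub>M\<^esub> y]) = \<mu> (xs[i := x]) \<oplus>\<^bsub>R\<^esub> \<mu> (xs[i := y])) \<and>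
    (\<forall>xs\<in>tuples M p. \<forall>i<p. \<forall>r\<in>carrier R. \<forall>x\<in>carrier M.
      \<mu> (xs[i := r \<odot>\<^bsub>M\<^esub> x]) = r \<otimes>\<^bsub>R\<^esub> \<mu> (xs[i := x])) \<and>
    (\<forall>xs\<in>tuples M p. \<forall>j<p. \<forall>i<j. xs ! i = xs ! j \<longrightarrow> \<mu> xs = \<zero>\<^bsub>R\<^esub>)"

definition wedge_class ::
  "('a, 'c0) ring_scheme \<Rightarrow> ('a, 'b, 'c1) module_scheme \<Rightarrow> nat \<Rightarrow> 'b list \<Rightarrow> ('b list \<Rightarrow> 'a) set"
  where "wedge_class R M p xs = LinearCombinations.module.span R (free_module R (tuples M p)) (ext_relations R M p)
    +>\<^bsub>free_module R (tuples M p)\<^esub> free_gen R (tuples M p) xs"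

lemma tuples_update: "xs \<in> tuples M p \<Longrightarrow> x \<in> carrier M \<Longrightarrow> xs[i := x] \<in> tuples M p"
  using set_update_subset_insert [of xs i x] by (auto simp: tuples_def)

context Module.module
begin

context
  fixes p :: nat
begin

private abbreviation (input) T where "T \<equiv> tuples M p"
private abbreviation (input) F where "F \<equiv> free_module R T"
private abbreviation (input) e where "e \<equiv> free_gen R T"
private abbreviation (input) rel where "rel \<equiv> ext_relations R M p"
private abbreviation (input) N where "N \<equiv> LinearCombinations.module.span R F rel"

lemma ext_relations_closed: "rel \<subseteq> carrier F"
proof -
  interpret F: Module.module R F
    by (rule R.free_module_module)
  show ?thesis
    by (auto simp: ext_relations_def Let_def intro!: F.M.minus_closed F.M.add.m_closed
        F.smult_closed R.free_gen_closed tuples_update)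
qed

text \<open>
  The three families of relations correspond one by one to additivity, homogeneity and the
  vanishing on tuples with a repeated entry.
\<close>

lemma vanishes_on_ext_relations_iff:
  assumes f: "f \<in> LinearCombinations.module_hom R F (self_module R)"
  shows "(\<forall>c\<in>rel. f c = \<zero>\<^bsub>R\<^esub>) \<longleftrightarrow> alternating_map R M p (\<lambda>xs. f (e xs))"
proof -
  interpret F: Module.module R F
    by (rule R.free_module_module)
  have gen: "e xs \<in> carrier F" if "xs \<in> T" for xs
    using that by (rule R.free_gen_closed)
  have add: "f (e (xs[i := x \<oplus>\<^bsub>M\<^esub> y]) \<ominus>\<^bsub>F\<^esub> (e (xs[i := x]) \<oplus>\<^bsub>F\<^esub> e (xs[i := y]))) = \<zero>\<^bsub>R\<^esub> \<longleftrightarrow>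
      f (e (xs[i := x \<oplus>\<^bsub>M\<^esub> y])) = f (e (xs[i := x])) \<oplus>\<^bsub>R\<^esub> f (e (xs[i := y]))"
    if "xs \<in> T" "x \<in> carrier M" "y \<in> carrier M" for xs i x y
    using that by (simp add: F.functional_eq_iff [OF f] F.functional_add [OF f] gen tuples_update)
  have smult: "f (e (xs[i := r \<odot>\<^bsub>M\<^esub> x]) \<ominus>\<^bsub>F\<^esub> (r \<odot>\<^bsub>F\<^esub> e (xs[i := x]))) = \<zero>\<^bsub>R\<^esub> \<longleftrightarrow>
      f (e (xs[i := r \<odot>\<^bsub>M\<^esub> x])) = r \<otimes>\<^bsub>R\<^esub> f (e (xs[i := x]))"
    if "xs \<in> T" "x \<in> carrier M" "r \<in> carrier R" for xs i x r
    using that by (simp add: F.functional_eq_iff [OF f] F.functional_smult [OF f] gen tuples_update)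
  have "(\<lambda>xs. f (e xs)) \<in> T \<rightarrow> carrier R"
    using gen F.functional_closed [OF f] by auto
  then have "alternating_map R M p (\<lambda>xs. f (e xs)) \<longleftrightarrow>
      (\<forall>xs\<in>T. \<forall>i<p. \<forall>x\<in>carrier M. \<forall>y\<in>carrier M.
        f (e (xs[i := x \<oplus>\<^bsub>M\<^esub> y]) \<ominus>\<^bsub>F\<^esub> (e (xs[i := x]) \<oplus>\<^bsub>F\<^esub> e (xs[i := y]))) = \<zero>\<^bsub>R\<^esub>) \<and>
      (\<forall>xs\<in>T. \<forall>i<p. \<forall>r\<in>carrier R. \<forall>x\<in>carrier M.
        f (e (xs[i := r \<odot>\<^bsub>M\<^esub> x]) \<ominus>\<^bsub>F\<^esub> (r \<odot>\<^bsub>F\<^esub> e (xs[i := x]))) = \<zero>\<^bsub>R\<^esub>) \<and>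
      (\<forall>xs\<in>T. \<forall>j<p. \<forall>i<j. xs ! i = xs ! j \<longrightarrow> f (e xs) = \<zero>\<^bsub>R\<^esub>)"
    unfolding alternating_map_def by (simp add: add smult)
  also have "\<dots> \<longleftrightarrow> (\<forall>c\<in>rel. f c = \<zero>\<^bsub>R\<^esub>)"
    unfolding ext_relations_def Let_def by blast
  finally show ?thesis ..
qed

lemma submodule_ext_span: "LinearCombinations.submodule R N F"
proof -
  interpret F: Module.module R F
    by (rule R.free_module_module)
  show ?thesis
    by (rule F.span_is_submodule [OF ext_relations_closed])
qed

lemma exterior_power_eq: "exterior_power R M p = quotient_module F N"
  by (simp add: exterior_power_def Let_def)

lemma exterior_power_functional_lift:
  assumes "\<phi> \<in> LinearCombinations.module_hom R (exterior_power R M p) (self_module R)"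
  shows "(\<lambda>c. \<phi> (N +>\<^bsub>F\<^esub> c)) \<in> LinearCombinations.module_hom R F (self_module R)"
proof -
  interpret F: Module.module R F
    by (rule R.free_module_module)
  show ?thesis
    using assms F.quotient_map_hom [OF submodule_ext_span]
    by (auto simp: exterior_power_eq LinearCombinations.module_hom_def Pi_iff)
qed

lemma wedge_class_closed:
  assumes "xs \<in> T"
  shows "wedge_class R M p xs \<in> carrier (exterior_power R M p)"
proof -
  interpret F: Module.module R F
    by (rule R.free_module_module)
  have "e xs \<in> carrier F"
    using assms by (rule R.free_gen_closed)
  then show ?thesis
    by (simp only: exterior_power_eq F.quotient_carrier wedge_class_def) (rule bexI, rule refl)
qed

text \<open>
  Universal property: the linear extension of an alternating map to the free module kills the
  relations, hence descends to the exterior power. Together with \<open>alternating_map_wedge_class\<close>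
  and \<open>exterior_power_functional_eqI\<close> it identifies functionals on the exterior power with
  alternating maps.
\<close>

lemma exterior_power_universal:
  assumes \<mu>: "alternating_map R M p \<mu>"
  shows "\<exists>\<phi>\<in>carrier (dual_module R (exterior_power R M p)). \<forall>xs\<in>T. \<phi> (wedge_class R M p xs) = \<mu> xs"
proof -
  interpret F: Module.module R F
    by (rule R.free_module_module)
  have \<mu>R: "\<mu> \<in> T \<rightarrow> carrier R"
    using \<mu> by (simp add: alternating_map_def)
  define f where "f = R.linear_extension T \<mu>"
  have f: "f \<in> LinearCombinations.module_hom R F (self_module R)"
    unfolding f_def using \<mu>R by (rule R.linear_extension_hom)
  have gen: "f (e xs) = \<mu> xs" if "xs \<in> T" for xs
    unfolding f_def using \<mu>R that by (rule R.linear_extension_free_gen)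
  then have "alternating_map R M p (\<lambda>xs. f (e xs))"
    using \<mu> by (simp add: alternating_map_def tuples_update Pi_iff)
  then have "rel \<subseteq> {c \<in> carrier F. f c = \<zero>\<^bsub>R\<^esub>}"
    using vanishes_on_ext_relations_iff [OF f] ext_relations_closed by blast
  then have "N \<subseteq> {c \<in> carrier F. f c = \<zero>\<^bsub>R\<^esub>}"
    by (intro F.span_is_subset F.submodule_kernel f)
  then obtain \<phi> where \<phi>: "\<phi> \<in> carrier (dual_module R (quotient_module F N))"
    and val: "\<And>c. c \<in> carrier F \<Longrightarrow> \<phi> (N +>\<^bsub>F\<^esub> c) = f c"
    using F.functional_factors_through_quotient [OF submodule_ext_span f] by blast
  have "\<phi> (wedge_class R M p xs) = \<mu> xs" if "xs \<in> T" for xs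
    using val [OF R.free_gen_closed [OF that]] gen [OF that] by (simp only: wedge_class_def)
  then show ?thesis
    unfolding exterior_power_eq using \<phi> by (intro bexI [of _ \<phi>] ballI)
qed

lemma alternating_map_wedge_class:
  assumes \<phi>: "\<phi> \<in> LinearCombinations.module_hom R (exterior_power R M p) (self_module R)"
  shows "alternating_map R M p (\<lambda>xs. \<phi> (wedge_class R M p xs))"
proof -
  interpret F: Module.module R F
    by (rule R.free_module_module)
  interpret N: abelian_subgroup N F
    by (rule F.abelian_subgroup_submodule [OF submodule_ext_span])
  define f where "f = (\<lambda>c. \<phi> (N +>\<^bsub>F\<^esub> c))"
  have f: "f \<in> LinearCombinations.module_hom R F (self_module R)"
    unfolding f_def using \<phi> by (rule exterior_power_functional_lift)
  have "f c = \<zero>\<^bsub>R\<^esub>" if c: "c \<in> rel" for c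
  proof -
    have "c \<in> carrier F" "c \<in> N"
      using c ext_relations_closed F.in_own_span [OF ext_relations_closed] by auto
    then have "N +>\<^bsub>F\<^esub> c = N +>\<^bsub>F\<^esub> \<zero>\<^bsub>F\<^esub>"
      by (simp only: N.a_rcos_const N.zero_closed)
    then have "f c = f \<zero>\<^bsub>F\<^esub>"
      by (simp add: f_def)
    then show ?thesis
      using F.functional_zero [OF f] by simp
  qed
  then show ?thesis
    using vanishes_on_ext_relations_iff [OF f] by (simp add: f_def wedge_class_def)
qed

lemma exterior_power_functional_eqI:
  assumes \<phi>: "\<phi> \<in> carrier (dual_module R (exterior_power R M p))"
    and \<psi>: "\<psi> \<in> carrier (dual_module R (exterior_power R M p))"
    and eq: "\<And>xs. xs \<in> T \<Longrightarrow> \<phi> (wedge_class R M p xs) = \<psi> (wedge_class R M p xs)"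
  shows "\<phi> = \<psi>"
proof -
  interpret F: Module.module R F
    by (rule R.free_module_module)
  have hom: "\<phi> \<in> LinearCombinations.module_hom R (exterior_power R M p) (self_module R)"
      "\<psi> \<in> LinearCombinations.module_hom R (exterior_power R M p) (self_module R)"
    and ext: "\<phi> \<in> extensional (carrier (exterior_power R M p))"
      "\<psi> \<in> extensional (carrier (exterior_power R M p))"
    using \<phi> \<psi> by (simp_all add: dual_module_def hom_module_def)
  define f g where "f c = \<phi> (N +>\<^bsub>F\<^esub> c)" and "g c = \<psi> (N +>\<^bsub>F\<^esub> c)" for c
  have f: "f \<in> LinearCombinations.module_hom R F (self_module R)"
    and g: "g \<in> LinearCombinations.module_hom R F (self_module R)"
    unfolding f_def g_def using hom by (simp_all only: exterior_power_functional_lift)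
  have gen: "f (e xs) = g (e xs)" if "xs \<in> T" for xs
    using eq [OF that] by (simp only: f_def g_def wedge_class_def)
  have "\<phi> C = \<psi> C" if C: "C \<in> carrier (exterior_power R M p)" for C
  proof -
    have "\<exists>c\<in>carrier F. C = N +>\<^bsub>F\<^esub> c"
      using C by (simp only: exterior_power_eq F.quotient_carrier)
    then obtain c where "c \<in> carrier F" and C_eq: "C = N +>\<^bsub>F\<^esub> c" ..
    then have "f c = g c"
      using R.free_module_hom_eqI [OF f g gen] by blast
    then show ?thesis
      by (simp only: f_def g_def C_eq)
  qed
  then show ?thesis
    by (rule extensionalityI [OF ext])
qed

end

end

context Module.module
begin

lemma quotient_module_closed:
  assumes N: "LinearCombinations.submodule R N M"
  shows "C \<in> carrier (quotient_module M N) \<Longrightarrow> D \<in> carrier (quotient_module M N)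
      \<Longrightarrow> C \<oplus>\<^bsub>quotient_module M N\<^esub> D \<in> carrier (quotient_module M N)"
    and "r \<in> carrier R \<Longrightarrow> C \<in> carrier (quotient_module M N)
      \<Longrightarrow> r \<odot>\<^bsub>quotient_module M N\<^esub> C \<in> carrier (quotient_module M N)"
proof -
  let ?Q = "quotient_module M N"
  have add: "(N +>\<^bsub>M\<^esub> x) \<oplus>\<^bsub>?Q\<^esub> (N +>\<^bsub>M\<^esub> y) = N +>\<^bsub>M\<^esub> (x \<oplus>\<^bsub>M\<^esub> y)"
    if "x \<in> carrier M" "y \<in> carrier M" for x y
    using LinearCombinations.module_hom_add [OF quotient_map_hom [OF N] that] by simp
  have smult: "r \<odot>\<^bsub>?Q\<^esub> (N +>\<^bsub>M\<^esub> x) = N +>\<^bsub>M\<^esub> (r \<odot>\<^bsub>M\<^esub> x)"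
    if "r \<in> carrier R" "x \<in> carrier M" for r x
    using LinearCombinations.module_hom_smult [OF quotient_map_hom [OF N] that] by simp
  show "C \<oplus>\<^bsub>?Q\<^esub> D \<in> carrier ?Q" if C: "C \<in> carrier ?Q" and D: "D \<in> carrier ?Q"
  proof -
    obtain x where x: "x \<in> carrier M" "C = N +>\<^bsub>M\<^esub> x"
      using C unfolding quotient_carrier by blast
    obtain y where y: "y \<in> carrier M" "D = N +>\<^bsub>M\<^esub> y"
      using D unfolding quotient_carrier by blast
    show ?thesis
      unfolding quotient_carrier x(2) y(2) add [OF x(1) y(1)]
      using M.add.m_closed [OF x(1) y(1)] by blast
  qed
  show "r \<odot>\<^bsub>?Q\<^esub> C \<in> carrier ?Q" if r: "r \<in> carrier R" and C: "C \<in> carrier ?Q"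
  proof -
    obtain x where x: "x \<in> carrier M" "C = N +>\<^bsub>M\<^esub> x"
      using C unfolding quotient_carrier by blast
    show ?thesis
      unfolding quotient_carrier x(2) smult [OF r x(1)]
      using smult_closed [OF r x(1)] by blast
  qed
qed

lemma exterior_power_dual_closed:
  assumes "\<phi> \<in> carrier (dual_module R (exterior_power R M p))"
  shows "\<psi> \<in> carrier (dual_module R (exterior_power R M p))
      \<Longrightarrow> \<phi> \<oplus>\<^bsub>dual_module R (exterior_power R M p)\<^esub> \<psi> \<in> carrier (dual_module R (exterior_power R M p))"
    and "r \<in> carrier R
      \<Longrightarrow> r \<odot>\<^bsub>dual_module R (exterior_power R M p)\<^esub> \<phi> \<in> carrier (dual_module R (exterior_power R M p))"
proof -
  interpret F: Module.module R "free_module R (tuples M p)"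
    by (rule R.free_module_module)
  note closed = F.quotient_module_closed [OF submodule_ext_span, folded exterior_power_eq]
  show "\<psi> \<in> carrier (dual_module R (exterior_power R M p))
      \<Longrightarrow> \<phi> \<oplus>\<^bsub>dual_module R (exterior_power R M p)\<^esub> \<psi> \<in> carrier (dual_module R (exterior_power R M p))"
    by (rule R.dual_module_closed(1) [OF closed assms])
  show "r \<in> carrier R
      \<Longrightarrow> r \<odot>\<^bsub>dual_module R (exterior_power R M p)\<^esub> \<phi> \<in> carrier (dual_module R (exterior_power R M p))"
    by (rule R.dual_module_closed(2) [OF closed assms])
qed

end

section \<open>Wedge products with one-forms in coordinates\<close>

lemma shuffle_sign_singleton:
  "shuffle_sign {i} J = (- 1) ^ card {j \<in> J. j < i}"
proof -
  have "{(i', j). i' \<in> {i} \<and> j \<in> J \<and> j < i'} = Pair i ` {j \<in> J. j < i}"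
    by auto
  then show ?thesis
    by (simp add: shuffle_sign_def card_image inj_on_def)
qed

lemma shuffle_sign_insert:
  assumes "k \<notin> S"
  shows "(shuffle_sign {i} (insert k S) :: 'a::comm_ring_1)
    = (if k < i then - shuffle_sign {i} S else shuffle_sign {i} S)"
proof -
  have "{j \<in> insert k S. j < i} = (if k < i then insert k {j \<in> S. j < i} else {j \<in> S. j < i})"
    by auto
  moreover have "finite {j \<in> S. j < i}"
    by (rule finite_subset [of _ "{..<i}"]) auto
  ultimately show ?thesis
    using assms by (simp add: shuffle_sign_singleton)
qed

lemma shuffle_sign_square:
  "shuffle_sign I J * shuffle_sign I J = (1 :: 'a::comm_ring_1)"
  by (simp add: shuffle_sign_def flip: power_mult_distrib)

text \<open>
  The exterior product \<open>v \<and> X\<close> for a one-form \<open>v\<close>, given by its coefficients, so that the sum over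
  subsets in \<^const>\<open>wedge\<close> becomes a sum over single indices.
\<close>

definition wedge1 :: "(nat \<Rightarrow> 'a::comm_ring_1) \<Rightarrow> (nat set \<Rightarrow> 'a) \<Rightarrow> nat set \<Rightarrow> 'a"
  where "wedge1 v X = (\<lambda>K. \<Sum>k\<in>K. shuffle_sign {k} (K - {k}) * v k * X (K - {k}))"

lemma wedge1_add_left: "wedge1 (\<lambda>k. v k + w k) X K = wedge1 v X K + wedge1 w X K"
  by (simp add: wedge1_def algebra_simps sum.distrib)

lemma wedge1_scale_left: "wedge1 (\<lambda>k. a * v k) X K = a * wedge1 v X K"
  by (simp add: wedge1_def algebra_simps sum_distrib_left)

lemma wedge1_add_right: "wedge1 v (\<lambda>K. X K + Y K) K = wedge1 v X K + wedge1 v Y K"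
  by (simp add: wedge1_def algebra_simps sum.distrib)

lemma wedge1_scale_right: "wedge1 v (\<lambda>K. a * X K) K = a * wedge1 v X K"
  by (simp add: wedge1_def algebra_simps sum_distrib_left)

lemma wedge1_sum_right:
  "wedge1 v (\<lambda>K. \<Sum>j\<in>S. c j * X j K) K = (\<Sum>j\<in>S. c j * wedge1 v (X j) K)"
  by (simp add: wedge1_def sum_distrib_left sum.swap [of _ S K] algebra_simps)

lemma wedge1_zero_right: "wedge1 v (\<lambda>K. 0) K = 0"
  by (simp add: wedge1_def)

text \<open>
  The terms for \<open>(k, l)\<close> and \<open>(l, k)\<close> cancel. The induction counts every pair once, so that the
  result holds in characteristic two as well.
\<close>

lemma antisymmetric_double_sum:
  fixes g :: "'i \<Rightarrow> 'i \<Rightarrow> 'a::comm_ring_1"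
  assumes "finite K" and "\<And>k l. k \<in> K \<Longrightarrow> l \<in> K \<Longrightarrow> k \<noteq> l \<Longrightarrow> g k l = - g l k"
  shows "(\<Sum>k\<in>K. \<Sum>l\<in>K - {k}. g k l) = 0"
  using assms
proof (induction K rule: finite_induct)
  case (insert x K)
  have "(\<Sum>l\<in>insert x K - {k}. g k l) = g k x + (\<Sum>l\<in>K - {k}. g k l)" if "k \<in> K" for k
  proof -
    have "insert x K - {k} = insert x (K - {k})"
      using that insert.hyps by auto
    then show ?thesis
      using insert.hyps by simp
  qed
  moreover have "g k x = - g x k" if "k \<in> K" for k
    using that insert.hyps insert.prems by (metis insertCI)
  moreover have "insert x K - {x} = K"
    using insert.hyps by auto
  moreover have "(\<Sum>k\<in>K. \<Sum>l\<in>K - {k}. g k l) = 0"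
    using insert.IH insert.prems by blast
  ultimately show ?case
    using insert.hyps by (simp add: sum.distrib sum_negf sum_subtractf)
qed simp

text \<open>
  Removing \<open>k\<close> and then \<open>l\<close> leaves the same index set as removing them in the other order, but
  the two shuffle signs differ by \<open>-1\<close>.
\<close>

lemma wedge1_self: "wedge1 v (wedge1 v X) K = 0"
proof (cases "finite K")
  case True
  define g where "g k l = shuffle_sign {k} (K - {k}) * v k
    * (shuffle_sign {l} (K - {k} - {l}) * v l * X (K - {k} - {l}))" for k l
  have "g k l = - g l k" if kl: "k \<in> K" "l \<in> K" "k \<noteq> l" for k l
  proof -
    define S where "S = K - {k} - {l}"
    have S: "K - {k} = insert l S" "K - {l} = insert k S" "K - {l} - {k} = S" "k \<notin> S" "l \<notin> S"
      using kl by (auto simp: S_def)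
    have S': "S - {k} = S" "S - {l} = S"
      using S(4,5) by auto
    have "g k l = shuffle_sign {k} (insert l S) * v k * (shuffle_sign {l} S * v l * X S)"
      unfolding g_def S_def [symmetric] S(1) by (simp add: S')
    moreover have "g l k = shuffle_sign {l} (insert k S) * v l * (shuffle_sign {k} S * v k * X S)"
      unfolding g_def S(3) unfolding S(2) by (simp add: S')
    ultimately show ?thesis
      using kl S by (simp add: shuffle_sign_insert algebra_simps)
  qed
  then have "(\<Sum>k\<in>K. \<Sum>l\<in>K - {k}. g k l) = 0"
    by (intro antisymmetric_double_sum True)
  then show ?thesis
    by (simp add: wedge1_def g_def sum_distrib_left)
qed (simp add: wedge1_def)

text \<open>
  Polarization of \<open>wedge1_self\<close>.
\<close>

lemma wedge1_anticommute: "wedge1 v (wedge1 w X) K = - wedge1 w (wedge1 v X) K"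
proof -
  have "0 = wedge1 (\<lambda>k. v k + w k) (wedge1 (\<lambda>k. v k + w k) X) K"
    by (simp add: wedge1_self)
  also have "wedge1 (\<lambda>k. v k + w k) X = (\<lambda>K. wedge1 v X K + wedge1 w X K)"
    by (simp add: fun_eq_iff wedge1_add_left)
  finally show ?thesis
    by (simp add: wedge1_add_left wedge1_add_right wedge1_self add_eq_0_iff2)
qed

text \<open>
  Contraction with the coordinate vector field \<open>\<partial>/\<partial>x\<^sub>i\<close>.
\<close>

definition contract1 :: "nat \<Rightarrow> (nat set \<Rightarrow> 'a::comm_ring_1) \<Rightarrow> nat set \<Rightarrow> 'a"
  where "contract1 i X = (\<lambda>J. if i \<in> J then 0 else shuffle_sign {i} J * X (insert i J))"

text \<open>
  Contraction with a vector field is an antiderivation. If \<open>a i\<close> is invertible, this formula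
  writes \<open>X\<close> as a multiple of \<open>a\<close> plus a contraction of \<open>a \<and> X\<close>; it is the source of the local
  decomposition of logarithmic forms.
\<close>

lemma wedge1_contract1:
  fixes a :: "nat \<Rightarrow> 'a::comm_ring_1"
  assumes "finite K"
  shows "wedge1 a (contract1 i X) K + contract1 i (wedge1 a X) K = a i * X K"
proof (cases "i \<in> K")
  case True
  have "wedge1 a (contract1 i X) K
      = (\<Sum>k\<in>K. if k = i then a i * (shuffle_sign {i} (K - {i}) * shuffle_sign {i} (K - {i})) * X K else 0)"
    unfolding wedge1_def using True
    by (intro sum.cong) (auto simp: contract1_def insert_absorb algebra_simps)
  also have "\<dots> = a i * X K"
    using True assms by (simp add: shuffle_sign_square)
  finally show ?thesis
    using True by (simp add: contract1_def)
next
  case False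
  have term_eq: "shuffle_sign {k} (K - {k}) * a k * contract1 i X (K - {k})
      = - (shuffle_sign {i} K * (shuffle_sign {k} (insert i K - {k}) * a k * X (insert i K - {k})))"
    if k: "k \<in> K" for k
  proof -
    define S where "S = K - {k}"
    have S: "K = insert k S" "insert i K - {k} = insert i S" "k \<notin> S" "i \<notin> S" "k \<noteq> i"
      using k False by (auto simp: S_def)
    show ?thesis
      unfolding S(2) S_def [symmetric] unfolding S(1) using S(3-5)
      by (simp add: contract1_def shuffle_sign_insert algebra_simps)
  qed
  have "contract1 i (wedge1 a X) K
      = shuffle_sign {i} K * (shuffle_sign {i} K * a i * X K
        + (\<Sum>k\<in>K. shuffle_sign {k} (insert i K - {k}) * a k * X (insert i K - {k})))"
    using False assms by (simp add: contract1_def wedge1_def)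
  also have "\<dots> = (shuffle_sign {i} K * shuffle_sign {i} K) * (a i * X K)
        + (\<Sum>k\<in>K. shuffle_sign {i} K * (shuffle_sign {k} (insert i K - {k}) * a k * X (insert i K - {k})))"
    by (simp add: algebra_simps sum_distrib_left)
  finally show ?thesis
    using term_eq by (simp add: wedge1_def sum_negf shuffle_sign_square)
qed

definition index_sets :: "nat \<Rightarrow> nat \<Rightarrow> nat set set"
  where "index_sets n q = {I. I \<subseteq> {..<n} \<and> card I = q}"

lemma finite_index_sets [simp]: "finite (index_sets n q)"
  by (rule finite_subset [of _ "Pow {..<n}"]) (auto simp: index_sets_def)

lemma index_sets_finite: "I \<in> index_sets n q \<Longrightarrow> finite I"
  by (auto simp: index_sets_def intro: finite_subset)

lemma wedge1_support:
  assumes "\<And>k. n \<le> k \<Longrightarrow> v k = 0" and "\<And>K. K \<notin> index_sets n q \<Longrightarrow> X K = 0"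
    and "K \<notin> index_sets n (Suc q)"
  shows "wedge1 v X K = 0"
  unfolding wedge1_def
proof (intro sum.neutral ballI)
  fix k assume k: "k \<in> K"
  show "shuffle_sign {k} (K - {k}) * v k * X (K - {k}) = 0"
  proof (cases "k < n \<and> K - {k} \<in> index_sets n q")
    case True
    then have "K \<subseteq> {..<n}"
      by (auto simp: index_sets_def)
    then have "finite K"
      by (rule finite_subset) simp
    then have "card K = Suc q"
      using True k card_Suc_Diff1 [of K k] by (simp add: index_sets_def)
    then show ?thesis
      using \<open>K \<subseteq> {..<n}\<close> assms(3) by (simp add: index_sets_def)
  qed (use assms(1,2) in auto)
qed

definition dx :: "nat set \<Rightarrow> nat set \<Rightarrow> 'a::comm_ring_1"
  where "dx J = (\<lambda>K. if K = J then 1 else 0)"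

lemma form_eq_sum_dx:
  assumes "finite S" and "\<And>K. K \<notin> S \<Longrightarrow> X K = 0"
  shows "X = (\<lambda>K. \<Sum>J\<in>S. X J * dx J K)"
proof
  fix K
  have "(\<Sum>J\<in>S. X J * dx J K) = (\<Sum>J\<in>S. if K = J then X J else 0)"
    by (intro sum.cong) (auto simp: dx_def)
  then show "X K = (\<Sum>J\<in>S. X J * dx J K)"
    using assms by simp
qed

lemma wedge1_dx:
  assumes "i \<notin> J" and "finite J"
  shows "wedge1 (\<lambda>k. dx {i} {k}) (dx J) = (\<lambda>K. shuffle_sign {i} J * dx (insert i J) K)"
proof
  fix K
  have "wedge1 (\<lambda>k. dx {i} {k}) (dx J) K
      = (\<Sum>k\<in>K. if k = i then shuffle_sign {i} (K - {i}) * dx J (K - {i}) else 0)"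
    unfolding wedge1_def by (intro sum.cong) (auto simp: dx_def)
  also have "\<dots> = (if finite K \<and> i \<in> K then shuffle_sign {i} (K - {i}) * dx J (K - {i}) else 0)"
    by (cases "finite K") simp_all
  also have "\<dots> = shuffle_sign {i} J * dx (insert i J) K"
    using assms by (auto simp: dx_def)
  finally show "wedge1 (\<lambda>k. dx {i} {k}) (dx J) K = shuffle_sign {i} J * dx (insert i J) K" .
qed

definition wedges :: "(nat \<Rightarrow> 'a::comm_ring_1) list \<Rightarrow> nat set \<Rightarrow> 'a"
  where "wedges vs = foldr wedge1 vs (dx {})"

lemma wedges_Nil [simp]: "wedges [] = dx {}"
  and wedges_Cons [simp]: "wedges (v # vs) = wedge1 v (wedges vs)"
  by (simp_all add: wedges_def)

lemma wedges_support:
  assumes "\<forall>v\<in>set vs. \<forall>k\<ge>n. v k = 0" and "K \<notin> index_sets n (length vs)"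
  shows "wedges vs K = 0"
  using assms
proof (induction vs arbitrary: K)
  case Nil
  then show ?case
    by (auto simp: dx_def index_sets_def)
next
  case (Cons v vs)
  show ?case
    unfolding wedges_Cons
  proof (rule wedge1_support)
    show "v k = 0" if "n \<le> k" for k
      using Cons.prems(1) that by simp
    show "wedges vs K = 0" if "K \<notin> index_sets n (length vs)" for K
      using Cons.IH Cons.prems(1) that by simp
    show "K \<notin> index_sets n (Suc (length vs))"
      using Cons.prems(2) by simp
  qed
qed

text \<open>
  Each factor is moved past larger indices only, so no sign arises.
\<close>

lemma wedges_dx:
  "sorted_wrt (<) is \<Longrightarrow> wedges (map (\<lambda>i k. dx {i} {k}) is) = (dx (set is) :: _ \<Rightarrow> 'a::comm_ring_1)"
proof (induction "is")
  case (Cons i "is")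
  then have "\<forall>j\<in>set is. i < j"
    by simp
  then have "{j \<in> set is. j < i} = {}"
    by fastforce
  then have "shuffle_sign {i} (set is) = (1 :: 'a)"
    by (simp only: shuffle_sign_singleton card.empty power_0)
  moreover have "i \<notin> set is" and "wedges (map (\<lambda>i k. dx {i} {k}) is) = (dx (set is) :: _ \<Rightarrow> 'a)"
    using Cons by auto
  ultimately show ?case
    by (simp add: wedge1_dx)
qed simp

lemma wedges_add:
  "wedges (us @ (\<lambda>k. v k + w k) # vs) K = wedges (us @ v # vs) K + wedges (us @ w # vs) K"
proof (induction us arbitrary: K)
  case (Cons u us)
  then have "wedges (us @ (\<lambda>k. v k + w k) # vs)
      = (\<lambda>K. wedges (us @ v # vs) K + wedges (us @ w # vs) K)"
    by blast
  then show ?case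
    by (simp add: wedge1_add_right)
qed (simp add: wedge1_add_left)

lemma wedges_scale: "wedges (us @ (\<lambda>k. a * v k) # vs) K = a * wedges (us @ v # vs) K"
proof (induction us arbitrary: K)
  case (Cons u us)
  then have "wedges (us @ (\<lambda>k. a * v k) # vs) = (\<lambda>K. a * wedges (us @ v # vs) K)"
    by blast
  then show ?case
    by (simp add: wedge1_scale_right)
qed (simp add: wedge1_scale_left)

text \<open>
  The first of the two equal factors can be moved to the right, at the cost of signs, until it
  stands next to the second.
\<close>

lemma wedges_repeat: "wedges (us @ v # ws @ v # zs) K = 0"
proof -
  have first: "wedges (v # ws @ v # zs) K = 0" for K
  proof (induction ws arbitrary: K)
    case (Cons w ws)
    then have "wedge1 v (wedges (ws @ v # zs)) = (\<lambda>K. 0)"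
      by auto
    then show ?case
      by (simp add: wedge1_anticommute [of v w] wedge1_zero_right)
  qed (simp add: wedge1_self)
  show ?thesis
  proof (induction us arbitrary: K)
    case (Cons u us)
    then have "wedges (us @ v # ws @ v # zs) = (\<lambda>K. 0)"
      by blast
    then show ?case
      by (simp add: wedge1_zero_right)
  qed (use first in simp)
qed

lemma wedge1_sum_left:
  "wedge1 (\<lambda>k. \<Sum>i\<in>S. c i * v i k) X K = (\<Sum>i\<in>S. c i * wedge1 (v i) X K)"
  by (simp add: wedge1_def sum_distrib_left sum_distrib_right sum.swap [of _ S K] algebra_simps)

lemma wedge1_dx_member: "i \<in> J \<Longrightarrow> wedge1 (\<lambda>k. dx {i} {k}) (dx J) K = 0"
  unfolding wedge1_def by (intro sum.neutral) (auto simp: dx_def)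

lemma wedge1_eq_sum_dx:
  assumes "finite S" and "\<And>K. K \<notin> S \<Longrightarrow> X K = 0"
  shows "wedge1 v X K = (\<Sum>J\<in>S. X J * wedge1 v (dx J) K)"
  by (subst form_eq_sum_dx [OF assms]) (simp_all add: wedge1_sum_right)

lemma shuffle_sign_empty: "shuffle_sign I {} = 1"
  by (simp add: shuffle_sign_def)

lemma wedges_singleton: "wedges [v] K = (if \<exists>k. K = {k} then v (the_elem K) else 0)"
proof (cases "\<exists>k. K = {k}")
  case True
  then show ?thesis
    by (auto simp: wedge1_def dx_def shuffle_sign_empty)
next
  case False
  then have "K - {k} \<noteq> {}" if "k \<in> K" for k
    using that by auto
  then have "wedges [v] K = 0"
    unfolding wedges_Cons wedges_Nil wedge1_def by (intro sum.neutral) (simp add: dx_def)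
  then show ?thesis
    using False by simp
qed

lemma wedge1_infinite: "infinite K \<Longrightarrow> wedge1 v X K = 0"
  by (simp add: wedge1_def)

lemma wedge1_eq_sum_insert:
  fixes v :: "nat \<Rightarrow> 'a::comm_ring_1"
  assumes "\<And>k. n \<le> k \<Longrightarrow> v k = 0" and "finite J"
  shows "wedge1 v (dx J) K
    = (\<Sum>i<n. v i * (if i \<in> J then 0 else shuffle_sign {i} J * dx (insert i J) K))"
proof -
  have "v = (\<lambda>k. \<Sum>i<n. v i * dx {i} {k})"
  proof
    fix k
    have "(\<Sum>i<n. v i * dx {i} {k}) = (\<Sum>i<n. if i = k then v k else 0)"
      by (intro sum.cong) (auto simp: dx_def)
    then show "v k = (\<Sum>i<n. v i * dx {i} {k})"
      using assms(1) [of k] by simp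
  qed
  then have "wedge1 v (dx J) K = (\<Sum>i<n. v i * wedge1 (\<lambda>k. dx {i} {k}) (dx J) K)"
    using wedge1_sum_left [where S = "{..<n}" and c = v and v = "\<lambda>i k. dx {i} {k}" and X = "dx J" and K = K] by simp
  moreover have "wedge1 (\<lambda>k. dx {i} {k}) (dx J) K
      = (if i \<in> J then 0 else shuffle_sign {i} J * dx (insert i J) K :: 'a)" for i
    by (cases "i \<in> J") (simp_all add: wedge1_dx_member wedge1_dx assms(2))
  ultimately show ?thesis
    by simp
qed

section \<open>Linear forms as prime elements of the polynomial ring\<close>

lemma poly_mapping_add_induct [case_names single add]:
  fixes p :: "'a \<Rightarrow>\<^sub>0 'b::comm_monoid_add"
  assumes "\<And>m c. P (Poly_Mapping.single m c)" and "\<And>f g. P f \<Longrightarrow> P g \<Longrightarrow> P (f + g)"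
  shows "P p"
proof (induction p rule: update_induct)
  case const
  then show ?case
    using assms(1) [of undefined 0] by simp
next
  case (update f a b)
  have "Poly_Mapping.update a b f = f + Poly_Mapping.single a b"
    using update(1) by (intro poly_mapping_eqI)
      (auto simp: lookup_update lookup_add lookup_single in_keys_iff when_def)
  then show ?case
    using update assms by simp
qed

definition var :: "nat \<Rightarrow> cpoly"
  where "var i = Poly_Mapping.single (Poly_Mapping.single i 1) 1"

definition const :: "complex \<Rightarrow> cpoly"
  where "const c = Poly_Mapping.single 0 c"

lemma const_0 [simp]: "const 0 = 0"
  and const_1 [simp]: "const 1 = 1"
  and const_mult: "const (a * b) = const a * const b"
  by (simp_all add: const_def mult_single)

definition substitute_monom :: "(nat \<Rightarrow> cpoly) \<Rightarrow> (nat \<Rightarrow>\<^sub>0 nat) \<Rightarrow> cpoly"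
  where "substitute_monom g m = (\<Prod>i\<in>Poly_Mapping.keys m. g i ^ Poly_Mapping.lookup m i)"

text \<open>
  The algebra endomorphism \<open>x\<^sub>i \<mapsto> g i\<close>. It is used twice: to eliminate a variable by means of a
  linear form, and to set the variables from \<open>n\<close> on to zero.
\<close>

definition substitute :: "(nat \<Rightarrow> cpoly) \<Rightarrow> cpoly \<Rightarrow> cpoly"
  where "substitute g p
    = (\<Sum>m\<in>Poly_Mapping.keys p. const (Poly_Mapping.lookup p m) * substitute_monom g m)"

lemma substitute_monom_superset:
  assumes "finite S" and "Poly_Mapping.keys m \<subseteq> S"
  shows "substitute_monom g m = (\<Prod>i\<in>S. g i ^ Poly_Mapping.lookup m i)"
  unfolding substitute_monom_def using assms
  by (intro prod.mono_neutral_left) (auto simp: in_keys_iff)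

lemma substitute_monom_add:
  "substitute_monom g (m + m') = substitute_monom g m * substitute_monom g m'"
proof -
  let ?S = "Poly_Mapping.keys m \<union> Poly_Mapping.keys m'"
  have "substitute_monom g (m + m') = (\<Prod>i\<in>?S. g i ^ Poly_Mapping.lookup (m + m') i)"
    by (intro substitute_monom_superset keys_add) simp
  moreover have "substitute_monom g m = (\<Prod>i\<in>?S. g i ^ Poly_Mapping.lookup m i)"
    and "substitute_monom g m' = (\<Prod>i\<in>?S. g i ^ Poly_Mapping.lookup m' i)"
    by (intro substitute_monom_superset; simp)+
  ultimately show ?thesis
    by (simp add: lookup_add power_add prod.distrib)
qed

lemma substitute_monom_single: "substitute_monom g (Poly_Mapping.single i k) = g i ^ k"
  by (simp add: substitute_monom_def)

lemma substitute_single: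
  "substitute g (Poly_Mapping.single m c) = const c * substitute_monom g m"
  by (simp add: substitute_def)

lemma substitute_0 [simp]: "substitute g 0 = 0"
  by (simp add: substitute_def)

lemma substitute_add: "substitute g (p + q) = substitute g p + substitute g q"
  unfolding substitute_def
  by (rule setsum_keys_plus_distrib) (simp_all add: const_def single_add algebra_simps)

lemma substitute_sum: "substitute g (\<Sum>j\<in>S. p j) = (\<Sum>j\<in>S. substitute g (p j))"
  by (induction S rule: infinite_finite_induct) (simp_all add: substitute_add)

lemma substitute_mult: "substitute g (p * q) = substitute g p * substitute g q"
proof (induction p rule: poly_mapping_add_induct)
  case (single m c)
  show ?case
  proof (induction q rule: poly_mapping_add_induct)
    case (single m' c')
    show ?case
      by (simp add: mult_single substitute_single substitute_monom_add const_mult)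
  qed (simp add: substitute_add algebra_simps)
qed (simp add: substitute_add algebra_simps)

lemma dvd_diff_mult:
  fixes d :: "'a::comm_ring_1"
  assumes "d dvd a - a'" and "d dvd b - b'"
  shows "d dvd a * b - a' * b'"
proof -
  have "a * b - a' * b' = (a - a') * b + a' * (b - b')"
    by (simp add: algebra_simps)
  then show ?thesis
    using assms by simp
qed

text \<open>
  A substitution that is the identity on variables modulo \<open>d\<close> is the identity modulo \<open>d\<close>. For
  \<open>d = 0\<close> this says that substituting the variables for themselves changes nothing.
\<close>

lemma dvd_substitute_diff:
  assumes "\<And>i. d dvd g i - var i"
  shows "d dvd substitute g p - p"
proof -
  have power: "d dvd g i ^ k - Poly_Mapping.single (Poly_Mapping.single i k) 1" for i k
  proof (induction k)
    case (Suc k)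
    have "Poly_Mapping.single (Poly_Mapping.single i (Suc k)) 1
        = var i * Poly_Mapping.single (Poly_Mapping.single i k) (1 :: complex)"
      by (simp add: var_def mult_single flip: single_add)
    then show ?case
      using dvd_diff_mult [OF assms Suc] by simp
  qed simp
  have monom: "d dvd substitute_monom g m - Poly_Mapping.single m 1" for m
  proof (induction m rule: poly_mapping_add_induct)
    case (add m m')
    have "Poly_Mapping.single (m + m') 1 = Poly_Mapping.single m 1 * Poly_Mapping.single m' (1 :: complex)"
      by (simp add: mult_single)
    then show ?case
      using dvd_diff_mult [OF add] by (simp add: substitute_monom_add)
  qed (use power in \<open>simp add: substitute_monom_single\<close>)
  show ?thesis
  proof (induction p rule: poly_mapping_add_induct)
    case (single m c)
    have "const c * Poly_Mapping.single m 1 = Poly_Mapping.single m c"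
      by (simp add: const_def mult_single)
    then show ?case
      using dvd_diff_mult [OF _ monom, of "const c" "const c" m] by (simp add: substitute_single)
  next
    case (add p q)
    have "substitute g (p + q) - (p + q) = (substitute g p - p) + (substitute g q - q)"
      by (simp add: substitute_add)
    then show ?case
      using add by (metis dvd_add)
  qed
qed

lemma mpolys_0 [simp]: "0 \<in> mpolys n"
  and mpolys_1 [simp]: "1 \<in> mpolys n"
  and mpolys_const [simp]: "const c \<in> mpolys n"
  by (auto simp: mpolys_def const_def)

lemma mpolys_add [intro]: "p \<in> mpolys n \<Longrightarrow> q \<in> mpolys n \<Longrightarrow> p + q \<in> mpolys n"
  using keys_add [of p q] by (auto simp: mpolys_def)

lemma mpolys_mult [intro]:
  assumes "p \<in> mpolys n" and "q \<in> mpolys n"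
  shows "p * q \<in> mpolys n"
  unfolding mpolys_def
proof (intro CollectI ballI)
  fix m assume "m \<in> Poly_Mapping.keys (p * q)"
  then obtain a b where "m = a + b" "a \<in> Poly_Mapping.keys p" "b \<in> Poly_Mapping.keys q"
    using keys_mult [of p q] by blast
  then show "Poly_Mapping.keys m \<subseteq> {..<n}"
    using assms keys_add [of a b] by (fastforce simp: mpolys_def)
qed

lemma mpolys_uminus [intro]: "p \<in> mpolys n \<Longrightarrow> - p \<in> mpolys n"
  by (simp add: mpolys_def)

lemma mpolys_var: "i < n \<Longrightarrow> var i \<in> mpolys n"
  by (auto simp: mpolys_def var_def)

lemma mpolys_sum: "(\<And>j. j \<in> S \<Longrightarrow> p j \<in> mpolys n) \<Longrightarrow> (\<Sum>j\<in>S. p j) \<in> mpolys n"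
  by (induction S rule: infinite_finite_induct) auto

lemma mpolys_prod: "(\<And>j. j \<in> S \<Longrightarrow> p j \<in> mpolys n) \<Longrightarrow> (\<Prod>j\<in>S. p j) \<in> mpolys n"
  by (induction S rule: infinite_finite_induct) auto

lemma mpolys_power: "p \<in> mpolys n \<Longrightarrow> p ^ k \<in> mpolys n"
  by (induction k) auto

lemma substitute_in_mpolys: "(\<And>i. g i \<in> mpolys n) \<Longrightarrow> substitute g p \<in> mpolys n"
  unfolding substitute_def substitute_monom_def
  by (intro mpolys_sum mpolys_mult mpolys_prod mpolys_power mpolys_const)

lemma substitute_fixes_mpolys:
  assumes "p \<in> mpolys n" and "\<And>i. i < n \<Longrightarrow> g i = var i"
  shows "substitute g p = p"
proof -
  have "substitute g p = substitute var p"
    unfolding substitute_def substitute_monom_def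
    using assms by (intro sum.cong prod.cong arg_cong2 [of _ _ _ _ "(*)"] refl)
      (auto simp: mpolys_def subset_iff)
  then show ?thesis
    using dvd_substitute_diff [of 0 var p] by simp
qed

text \<open>
  Setting the variables from \<open>n\<close> on to zero is a homomorphism that fixes \<open>b\<close> and \<open>b * c\<close>, hence
  also \<open>c\<close>. So divisibility may be tested in the ambient ring.
\<close>

lemma mpolys_cancel:
  assumes "b \<in> mpolys n" and "b \<noteq> 0" and "b * c \<in> mpolys n"
  shows "c \<in> mpolys n"
proof -
  define g where "g i = (if i < n then var i else 0)" for i
  have "b * c = substitute g (b * c)"
    using assms(3) by (simp add: substitute_fixes_mpolys g_def)
  also have "\<dots> = b * substitute g c"
    using assms(1) by (simp add: substitute_mult substitute_fixes_mpolys g_def)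
  finally have "c = substitute g c"
    using assms(2) by simp
  then show ?thesis
    using substitute_in_mpolys [of g n c] by (simp add: g_def mpolys_var)
qed

lemma linear_form_altdef: "linear_form a = (\<Sum>i<dim_vec a. const (a $ i) * var i)"
  by (simp add: linear_form_def const_def var_def mult_single)

lemma linear_form_in_mpolys: "a \<in> carrier_vec n \<Longrightarrow> linear_form a \<in> mpolys n"
  unfolding linear_form_altdef by (intro mpolys_sum mpolys_mult mpolys_const mpolys_var) auto

lemma single_exponent_eq_iff:
  "Poly_Mapping.single i (Suc 0) = Poly_Mapping.single j (Suc 0) \<longleftrightarrow> i = j"
  by (metis keys_single insert_iff empty_iff nat.distinct(2))

lemma lookup_linear_form:
  assumes "i < dim_vec a"
  shows "Poly_Mapping.lookup (linear_form a) (Poly_Mapping.single i 1) = a $ i"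
proof -
  have "Poly_Mapping.lookup (linear_form a) (Poly_Mapping.single i 1)
      = (\<Sum>j<dim_vec a. if j = i then a $ i else 0)"
    unfolding linear_form_def lookup_sum
    by (intro sum.cong) (auto simp: lookup_single when_def single_exponent_eq_iff)
  then show ?thesis
    using assms by simp
qed

lemma partial_deriv_linear_form:
  assumes "i < dim_vec a"
  shows "partial_deriv i (linear_form a) = const (a $ i)"
proof -
  let ?x = "\<lambda>j. Poly_Mapping.single j (1::nat)"
  have keys: "Poly_Mapping.keys (linear_form a) \<subseteq> ?x ` {..<dim_vec a}"
    unfolding linear_form_def using keys_sum [of "\<lambda>j. Poly_Mapping.single (?x j) (a $ j)" "{..<dim_vec a}"]
    by (auto split: if_splits)
  have inj: "inj_on ?x {..<dim_vec a}"
    by (auto simp: inj_on_def single_exponent_eq_iff)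
  have "partial_deriv i (linear_form a) = (\<Sum>m\<in>?x ` {..<dim_vec a}.
      Poly_Mapping.single (m - ?x i) (of_nat (Poly_Mapping.lookup m i) * Poly_Mapping.lookup (linear_form a) m))"
    unfolding partial_deriv_def using keys
    by (intro sum.mono_neutral_left) (auto simp: in_keys_iff)
  also have "\<dots> = (\<Sum>j<dim_vec a.
      Poly_Mapping.single (?x j - ?x i) (of_nat (Poly_Mapping.lookup (?x j) i) * a $ j))"
    by (subst sum.reindex [OF inj]) (intro sum.cong, use lookup_linear_form in auto)
  also have "\<dots> = (\<Sum>j<dim_vec a. if j = i then const (a $ i) else 0)"
    by (intro sum.cong) (auto simp: lookup_single when_def const_def)
  finally show ?thesis
    using assms by simp
qed

text \<open>
  The substitution that solves the linear form for \<open>x\<^sub>i\<close>, assuming \<open>a\<^sub>i \<noteq> 0\<close>.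
\<close>

definition eliminate :: "complex vec \<Rightarrow> nat \<Rightarrow> nat \<Rightarrow> cpoly"
  where "eliminate a i j = (if j = i then var i - const (1 / a $ i) * linear_form a else var j)"

lemma substitute_eliminate_linear_form:
  assumes "i < dim_vec b"
  shows "substitute (eliminate a i) (linear_form b)
    = linear_form b - const (b $ i / a $ i) * linear_form a"
proof -
  have "substitute (eliminate a i) (linear_form b)
      = (\<Sum>j<dim_vec b. const (b $ j) * eliminate a i j)"
    by (simp add: linear_form_def substitute_sum substitute_single substitute_monom_single)
  also have "\<dots> = (\<Sum>j<dim_vec b. const (b $ j) * var j
      - (if j = i then const (b $ i / a $ i) * linear_form a else 0))"
    by (intro sum.cong) (auto simp: eliminate_def algebra_simps simp flip: const_mult mult.assoc)
  also have "\<dots> = linear_form b - const (b $ i / a $ i) * linear_form a"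
    using assms by (simp add: sum_subtractf linear_form_altdef)
  finally show ?thesis .
qed

text \<open>
  The elimination kills the linear form and is the identity modulo it, so its kernel is the ideal
  generated by the form.
\<close>

lemma linear_form_dvd_iff:
  assumes "i < dim_vec a" and "a $ i \<noteq> 0"
  shows "linear_form a dvd p \<longleftrightarrow> substitute (eliminate a i) p = 0"
proof
  assume "linear_form a dvd p"
  then obtain q where "p = linear_form a * q" ..
  then show "substitute (eliminate a i) p = 0"
    using assms by (simp add: substitute_mult substitute_eliminate_linear_form)
next
  assume "substitute (eliminate a i) p = 0"
  moreover have "linear_form a dvd substitute (eliminate a i) p - p"
    by (intro dvd_substitute_diff) (simp add: eliminate_def)
  ultimately show "linear_form a dvd p"
    by simp
qed

text \<open>
  The ideal of a nonzero linear form is the kernel of a homomorphism into an integral domain.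
\<close>

lemma linear_form_dvd_mult:
  assumes "a \<in> carrier_vec n" and "a \<noteq> 0\<^sub>v n" and "linear_form a dvd p * q"
  shows "linear_form a dvd p \<or> linear_form a dvd q"
proof -
  obtain i where "i < dim_vec a" "a $ i \<noteq> 0"
    using assms by (auto simp: vec_eq_iff)
  then show ?thesis
    using assms(3) by (simp add: linear_form_dvd_iff substitute_mult)
qed

text \<open>
  Eliminating \<open>x\<^sub>i\<close> from the second form subtracts a scalar multiple of the first; the result
  vanishes, and coefficients can be compared.
\<close>

lemma linear_form_dvd_linear_form:
  assumes "a \<in> carrier_vec n" and "a \<noteq> 0\<^sub>v n" and "b \<in> carrier_vec n"
    and "linear_form a dvd linear_form b"
  obtains c where "b = c \<cdot>\<^sub>v a"
proof -
  obtain i where i: "i < n" "a $ i \<noteq> 0"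
    using assms by (auto simp: vec_eq_iff)
  then have "linear_form b = const (b $ i / a $ i) * linear_form a"
    using assms linear_form_dvd_iff [of i a] substitute_eliminate_linear_form [of i b a] by simp
  also have "\<dots> = linear_form ((b $ i / a $ i) \<cdot>\<^sub>v a)"
    by (simp add: linear_form_altdef sum_distrib_left mult.assoc flip: const_mult mult.assoc)
  finally have eq: "linear_form b = linear_form ((b $ i / a $ i) \<cdot>\<^sub>v a)" .
  have "b $ j = ((b $ i / a $ i) \<cdot>\<^sub>v a) $ j" if "j < n" for j
    using that assms lookup_linear_form [of j b]
      lookup_linear_form [of j "(b $ i / a $ i) \<cdot>\<^sub>v a"] eq by simp
  then have "b = (b $ i / a $ i) \<cdot>\<^sub>v a"
    using assms by (intro eq_vecI) auto
  then show thesis ..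
qed

lemma linear_form_nonzero:
  assumes "a \<in> carrier_vec n" and "a \<noteq> 0\<^sub>v n"
  shows "linear_form a \<noteq> 0"
proof -
  obtain i where "i < dim_vec a" "a $ i \<noteq> 0"
    using assms by (auto simp: vec_eq_iff)
  then show ?thesis
    using lookup_linear_form [of i a] by auto
qed

section \<open>Logarithmic forms near a hyperplane\<close>

definition regular :: "nat \<Rightarrow> cpoly fract set"
  where "regular n = to_fract ` mpolys n"

lemma to_fract_in_regular [intro]: "p \<in> mpolys n \<Longrightarrow> to_fract p \<in> regular n"
  by (simp add: regular_def)

lemma regular_0 [simp]: "0 \<in> regular n"
  and regular_1 [simp]: "1 \<in> regular n"
  using to_fract_in_regular [of 0 n] to_fract_in_regular [of 1 n] by simp_all

lemma regular_add [intro]: "x \<in> regular n \<Longrightarrow> y \<in> regular n \<Longrightarrow> x + y \<in> regular n"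
  by (auto simp: regular_def simp flip: to_fract_add)

lemma regular_mult [intro]: "x \<in> regular n \<Longrightarrow> y \<in> regular n \<Longrightarrow> x * y \<in> regular n"
  by (auto simp: regular_def simp flip: to_fract_mult)

lemma regular_uminus [intro]: "x \<in> regular n \<Longrightarrow> - x \<in> regular n"
  by (auto simp: regular_def simp flip: to_fract_uminus)

lemma regular_diff [intro]: "x \<in> regular n \<Longrightarrow> y \<in> regular n \<Longrightarrow> x - y \<in> regular n"
  using regular_add [of x n "- y"] by auto

lemma regular_power: "x \<in> regular n \<Longrightarrow> x ^ k \<in> regular n"
  by (induction k) auto

lemma regular_sum: "(\<And>j. j \<in> S \<Longrightarrow> x j \<in> regular n) \<Longrightarrow> (\<Sum>j\<in>S. x j) \<in> regular n"
  by (induction S rule: infinite_finite_induct) auto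

lemma regular_shuffle_sign [simp]: "shuffle_sign I J \<in> regular n"
  unfolding shuffle_sign_def by (intro regular_power regular_uminus regular_1)

lemma regular_dx [simp]: "dx J K \<in> regular n"
  by (simp add: dx_def)

lemma to_fract_power: "to_fract (p ^ k) = to_fract p ^ k"
  by (induction k) simp_all

text \<open>
  The scalars \<open>a\<close> and \<open>b\<close> clear the denominators of the two factors separately.
\<close>

lemma regular_wedge1:
  assumes "\<And>k. a * v k \<in> regular n" and "\<And>K. b * X K \<in> regular n"
  shows "a * b * wedge1 v X K \<in> regular n"
proof -
  have "a * b * wedge1 v X K
      = (\<Sum>k\<in>K. shuffle_sign {k} (K - {k}) * ((a * v k) * (b * X (K - {k}))))"
    by (simp add: wedge1_def sum_distrib_left algebra_simps)
  then show ?thesis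
    by (simp only:) (intro regular_sum regular_mult assms regular_shuffle_sign)
qed

lemma regular_wedges:
  assumes "\<forall>v\<in>set vs. \<forall>k. a * v k \<in> regular n"
  shows "a ^ length vs * wedges vs K \<in> regular n"
  using assms
proof (induction vs arbitrary: K)
  case (Cons v vs)
  then show ?case
    using regular_wedge1 [of a v n "a ^ length vs" "wedges vs" K] by simp
qed simp

lemma regular_contract1: "(\<And>K. X K \<in> regular n) \<Longrightarrow> contract1 i X J \<in> regular n"
  by (auto simp: contract1_def)

text \<open>
  If \<open>x = u / \<alpha>\<close> and \<open>t x\<close> is a polynomial, then \<open>\<alpha>\<close> divides \<open>t u\<close>, hence \<open>u\<close>, because it is
  prime.
\<close>

lemma regular_local_step:
  assumes a: "a \<in> carrier_vec n" "a \<noteq> 0\<^sub>v n"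
    and x: "to_fract (linear_form a) * x \<in> regular n"
    and t: "\<not> linear_form a dvd t" "to_fract t * x \<in> regular n"
  shows "x \<in> regular n"
proof -
  obtain u where u: "u \<in> mpolys n" "to_fract (linear_form a) * x = to_fract u"
    using x by (auto simp: regular_def)
  obtain w where w: "to_fract t * x = to_fract w"
    using t(2) by (auto simp: regular_def)
  have "to_fract (t * u) = to_fract (linear_form a * w)"
    by (simp flip: u(2) w)
  then have "linear_form a dvd t * u"
    by (simp only: to_fract_eq_iff) simp
  then have "linear_form a dvd u"
    using linear_form_dvd_mult [OF a] t(1) by blast
  then obtain c where c: "u = linear_form a * c" ..
  have nz: "linear_form a \<noteq> 0"
    using a by (rule linear_form_nonzero)
  then have "c \<in> mpolys n"
    using mpolys_cancel [OF linear_form_in_mpolys [OF a(1)]] u(1) c by simp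
  moreover have "x = to_fract c"
    using u(2) c nz by simp
  ultimately show ?thesis
    by auto
qed

lemma poly_forms_over_iff:
  assumes "f \<noteq> 0"
  shows "\<omega> \<in> poly_forms_over f n p \<longleftrightarrow>
    (\<forall>I. I \<notin> index_sets n p \<longrightarrow> \<omega> I = 0) \<and> (\<forall>I. to_fract f * \<omega> I \<in> regular n)"
proof
  assume "\<omega> \<in> poly_forms_over f n p"
  then obtain \<eta> where "\<eta> \<in> poly_forms n p" "\<omega> = (\<lambda>I. \<eta> I / to_fract f)"
    by (auto simp: poly_forms_over_def)
  moreover have "\<eta> I \<in> regular n" for I
    using \<open>\<eta> \<in> poly_forms n p\<close> by (cases "I \<in> index_sets n p") (auto simp: poly_forms_def regular_def index_sets_def)
  ultimately show "(\<forall>I. I \<notin> index_sets n p \<longrightarrow> \<omega> I = 0) \<and> (\<forall>I. to_fract f * \<omega> I \<in> regular n)"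
    using assms by (auto simp: poly_forms_def index_sets_def)
next
  assume *: "(\<forall>I. I \<notin> index_sets n p \<longrightarrow> \<omega> I = 0) \<and> (\<forall>I. to_fract f * \<omega> I \<in> regular n)"
  then have "(\<lambda>I. to_fract f * \<omega> I) \<in> poly_forms n p"
    by (auto simp: poly_forms_def index_sets_def regular_def)
  moreover have "\<omega> = (\<lambda>I. to_fract f * \<omega> I / to_fract f)"
    using assms by simp
  ultimately show "\<omega> \<in> poly_forms_over f n p"
    unfolding poly_forms_over_def by (intro CollectI exI conjI)
qed

lemma wedge_one_form:
  assumes "\<And>I. (\<nexists>k. I = {k}) \<Longrightarrow> \<eta> I = 0"
  shows "wedge \<eta> \<omega> = wedge1 (\<lambda>k. \<eta> {k}) \<omega>"
proof
  fix K
  have "wedge \<eta> \<omega> K = (\<Sum>I\<in>(\<lambda>k. {k}) ` K. shuffle_sign I (K - I) * \<eta> I * \<omega> (K - I))"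
  proof (cases "finite K")
    case True
    have "\<eta> I = 0" if "I \<in> Pow K - (\<lambda>k. {k}) ` K" for I
      using that by (intro assms) auto
    then show ?thesis
      unfolding wedge_def using True by (intro sum.mono_neutral_right) auto
  next
    case False
    then show ?thesis
      by (simp add: wedge_def finite_image_iff)
  qed
  then show "wedge \<eta> \<omega> K = wedge1 (\<lambda>k. \<eta> {k}) \<omega> K"
    by (simp add: sum.reindex wedge1_def)
qed

context central_essential_arrangement
begin

abbreviation (input) lf where "lf H \<equiv> linear_form (\<alpha> H)"
abbreviation (input) f where "f \<equiv> defining_poly \<A> \<alpha>"

definition cofactor :: "complex vec set \<Rightarrow> cpoly"
  where "cofactor H = (\<Prod>H'\<in>\<A> - {H}. lf H')"

definition grad :: "complex vec set \<Rightarrow> nat \<Rightarrow> cpoly fract"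
  where "grad H k = (if k < n then to_fract (const (\<alpha> H $ k)) else 0)"

definition dlog_coeff :: "complex vec set \<Rightarrow> nat \<Rightarrow> cpoly fract"
  where "dlog_coeff H k = grad H k / to_fract (lf H)"

lemma lf_in_mpolys: "H \<in> \<A> \<Longrightarrow> lf H \<in> mpolys n"
  by (simp add: form_carrier linear_form_in_mpolys)

lemma lf_nonzero: "H \<in> \<A> \<Longrightarrow> lf H \<noteq> 0"
  using form_carrier form_nonzero by (rule linear_form_nonzero)

lemma lf_mult_cofactor: "H \<in> \<A> \<Longrightarrow> lf H * cofactor H = f"
  unfolding defining_poly_def cofactor_def using finite_arrangement by (simp add: prod.remove)

lemma f_nonzero: "f \<noteq> 0"
  unfolding defining_poly_def using finite_arrangement lf_nonzero by simp

lemma f_in_mpolys: "f \<in> mpolys n"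
  unfolding defining_poly_def using lf_in_mpolys by (rule mpolys_prod)

lemma cofactor_in_mpolys: "cofactor H \<in> mpolys n"
  unfolding cofactor_def using lf_in_mpolys by (auto intro: mpolys_prod)

lemma lf_dvd_mult: "H \<in> \<A> \<Longrightarrow> lf H dvd p * q \<Longrightarrow> lf H dvd p \<or> lf H dvd q"
  using form_carrier form_nonzero by (rule linear_form_dvd_mult)

lemma lf_not_dvd_1:
  assumes H: "H \<in> \<A>"
  shows "\<not> lf H dvd 1"
proof -
  obtain i where i: "i < dim_vec (\<alpha> H)" "\<alpha> H $ i \<noteq> 0"
    using form_carrier [OF H] form_nonzero [OF H] by (auto simp: vec_eq_iff)
  have "substitute (eliminate (\<alpha> H) i) 1 = 1"
    by (rule substitute_fixes_mpolys [of _ 0]) simp_all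
  then show ?thesis
    using linear_form_dvd_iff [OF i] by simp
qed

text \<open>
  Proportional linear forms have the same kernel.
\<close>

lemma lf_not_dvd_lf:
  assumes H: "H \<in> \<A>" and H': "H' \<in> \<A>" and "H \<noteq> H'"
  shows "\<not> lf H dvd lf H'"
proof
  assume "lf H dvd lf H'"
  then obtain c where c: "\<alpha> H' = c \<cdot>\<^sub>v \<alpha> H"
    using linear_form_dvd_linear_form [OF form_carrier [OF H] form_nonzero [OF H] form_carrier [OF H']]
    by blast
  then have "c \<noteq> 0"
    using form_nonzero [OF H'] form_carrier [OF H] by auto
  have "\<alpha> H' \<bullet> v = 0 \<longleftrightarrow> \<alpha> H \<bullet> v = 0" if "v \<in> carrier_vec n" for v
    using that c \<open>c \<noteq> 0\<close> form_carrier [OF H] by simp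
  then have "H = H'"
    using form_kernel [OF H] form_kernel [OF H'] by blast
  then show False
    using assms(3) by simp
qed

lemma lf_not_dvd_cofactor:
  assumes H: "H \<in> \<A>"
  shows "\<not> lf H dvd cofactor H"
proof -
  have "\<not> lf H dvd (\<Prod>H'\<in>B. lf H')" if "finite B" "B \<subseteq> \<A> - {H}" for B
    using that
  proof (induction B rule: finite_induct)
    case (insert H' B)
    then show ?case
      using lf_dvd_mult [OF H, of "lf H'" "\<Prod>H'\<in>B. lf H'"] lf_not_dvd_lf [OF H, of H'] by auto
  qed (simp add: lf_not_dvd_1 H)
  then show ?thesis
    unfolding cofactor_def using finite_arrangement by simp
qed

lemma lf_not_dvd_power: "H \<in> \<A> \<Longrightarrow> \<not> lf H dvd p \<Longrightarrow> \<not> lf H dvd p ^ k"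
  by (induction k) (auto simp: lf_not_dvd_1 dest: lf_dvd_mult)

text \<open>
  The factors of the denominator are removed one at a time with \<open>regular_local_step\<close>; the local
  condition is inherited by multiples.
\<close>

lemma regular_local_global:
  assumes pole: "to_fract f ^ N * x \<in> regular n"
    and loc: "\<And>H. H \<in> \<A> \<Longrightarrow> \<exists>t. \<not> lf H dvd t \<and> to_fract t * x \<in> regular n"
  shows "x \<in> regular n"
proof -
  define L where "L y \<longleftrightarrow> (\<forall>H\<in>\<A>. \<exists>t. \<not> lf H dvd t \<and> to_fract t * y \<in> regular n)" for y
  have L_mult: "L (r * y)" if "L y" "r \<in> regular n" for r y
    unfolding L_def
  proof
    fix H assume "H \<in> \<A>"
    then obtain t where "\<not> lf H dvd t" "to_fract t * y \<in> regular n"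
      using \<open>L y\<close> by (auto simp: L_def)
    then show "\<exists>t. \<not> lf H dvd t \<and> to_fract t * (r * y) \<in> regular n"
      using regular_mult [OF \<open>r \<in> regular n\<close>] by (auto simp: mult.left_commute)
  qed
  have prod: "y \<in> regular n" if "finite B" "B \<subseteq> \<A>" "L y" "to_fract (\<Prod>H\<in>B. lf H) * y \<in> regular n" for B y
    using that
  proof (induction B rule: finite_induct)
    case (insert H B)
    let ?z = "to_fract (\<Prod>H\<in>B. lf H) * y"
    have "to_fract (\<Prod>H\<in>B. lf H) \<in> regular n"
      using insert.prems(1) lf_in_mpolys by (intro to_fract_in_regular mpolys_prod) auto
    then have "L ?z"
      using insert.prems(2) by (intro L_mult)
    then obtain t where t: "\<not> lf H dvd t" "to_fract t * ?z \<in> regular n"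
      using insert.prems(1) by (auto simp: L_def)
    have "to_fract (lf H) * ?z \<in> regular n"
      using insert.prems(3) insert.hyps by (simp add: mult.assoc)
    moreover have "H \<in> \<A>" "B \<subseteq> \<A>"
      using insert.prems(1) by simp_all
    ultimately have "?z \<in> regular n"
      by (intro regular_local_step [OF form_carrier form_nonzero _ t])
    then show ?case
      using insert.IH \<open>B \<subseteq> \<A>\<close> insert.prems(2) by blast
  qed simp
  have "y \<in> regular n" if "L y" "to_fract f ^ N * y \<in> regular n" for N y
    using that
  proof (induction N arbitrary: y)
    case (Suc N)
    have "L (to_fract f * y)"
      using Suc.prems(1) f_in_mpolys by (intro L_mult) auto
    moreover have "to_fract f ^ N * (to_fract f * y) \<in> regular n"
      using Suc.prems(2) by (simp add: mult.assoc mult.left_commute)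
    ultimately have "to_fract f * y \<in> regular n"
      by (rule Suc.IH)
    then show ?case
      using prod [of \<A> y] finite_arrangement Suc.prems(1) by (simp add: defining_poly_def)
  qed simp
  then show ?thesis
    using pole loc by (auto simp: L_def)
qed

lemma grad_regular [simp]: "grad H k \<in> regular n"
  by (auto simp: grad_def)

lemma dlog_coeff_support: "n \<le> k \<Longrightarrow> dlog_coeff H k = 0"
  by (simp add: dlog_coeff_def grad_def)

lemma lf_dlog_coeff: "H \<in> \<A> \<Longrightarrow> to_fract (lf H) * dlog_coeff H k = grad H k"
  by (simp add: dlog_coeff_def lf_nonzero)

lemma f_dlog_coeff: "H \<in> \<A> \<Longrightarrow> to_fract f * dlog_coeff H k = to_fract (cofactor H) * grad H k"
  by (simp add: lf_dlog_coeff mult.assoc mult.left_commute flip: lf_mult_cofactor)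

lemma f_dlog_coeff_regular: "H \<in> \<A> \<Longrightarrow> to_fract f * dlog_coeff H k \<in> regular n"
  by (simp add: f_dlog_coeff) (intro regular_mult to_fract_in_regular cofactor_in_mpolys grad_regular)

lemma wedge_dlog:
  assumes H: "H \<in> \<A>"
  shows "wedge (dlog n (lf H)) \<omega> = wedge1 (dlog_coeff H) \<omega>"
proof -
  have dim: "dim_vec (\<alpha> H) = n"
    using form_carrier [OF H] by simp
  have "dlog n (lf H) {k} = dlog_coeff H k" for k
    by (cases "k < n") (simp_all add: dlog_def differential_def dlog_coeff_def grad_def
        partial_deriv_linear_form dim)
  moreover have "dlog n (lf H) I = 0" if "\<nexists>k. I = {k}" for I
    using that by (auto simp: dlog_def differential_def)
  ultimately show ?thesis
    using wedge_one_form [of "dlog n (lf H)" \<omega>] by presburger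
qed

lemma log_forms_iff:
  "\<omega> \<in> log_forms n \<A> \<alpha> p \<longleftrightarrow>
    (\<forall>I. I \<notin> index_sets n p \<longrightarrow> \<omega> I = 0) \<and> (\<forall>I. to_fract f * \<omega> I \<in> regular n) \<and>
    (\<forall>H\<in>\<A>. \<forall>K. to_fract f * wedge1 (dlog_coeff H) \<omega> K \<in> regular n)"
proof -
  have "wedge1 (dlog_coeff H) \<omega> K = 0"
    if "\<forall>I. I \<notin> index_sets n p \<longrightarrow> \<omega> I = 0" "K \<notin> index_sets n (Suc p)" for H K
    using that by (intro wedge1_support [of n _ p]) (auto simp: dlog_coeff_support)
  then show ?thesis
    unfolding log_forms_def mem_Collect_eq poly_forms_over_iff [OF f_nonzero]
    by (simp add: wedge_dlog) blast
qed

text \<open>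
  Let \<open>a = d\<alpha>\<^sub>H\<close> with \<open>a\<^sub>i \<noteq> 0\<close> and \<open>\<eta> = f \<omega>\<close>, so that \<open>\<eta>\<close> and \<open>\<delta> = a / \<alpha>\<^sub>H \<and> \<eta>\<close> are
  polynomial. Contracting with \<open>\<partial>/\<partial>x\<^sub>i\<close> gives
  \<open>(a\<^sub>i / \<alpha>\<^sub>H) \<eta> = a / \<alpha>\<^sub>H \<and> \<iota>\<^sub>i \<eta> + \<iota>\<^sub>i \<delta>\<close>, and \<open>\<eta> / \<alpha>\<^sub>H\<close> is the product of \<open>\<omega>\<close> with
  the remaining linear forms. The support condition on \<open>\<beta>\<close> says that it is a \<open>(p - 1)\<close>-form, and
  that it is zero for \<open>p = 0\<close>.
\<close>

lemma log_form_decomposition: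
  assumes \<omega>: "\<omega> \<in> log_forms n \<A> \<alpha> p" and H: "H \<in> \<A>"
  shows "\<exists>\<beta> \<gamma>. (\<forall>J. \<beta> J \<in> regular n) \<and> (\<forall>J. \<gamma> J \<in> regular n) \<and>
    (\<forall>J. \<not> (J \<subseteq> {..<n} \<and> Suc (card J) = p) \<longrightarrow> \<beta> J = 0) \<and>
    (\<forall>K. to_fract (cofactor H) * \<omega> K = wedge1 (dlog_coeff H) \<beta> K + \<gamma> K)"
proof -
  obtain i where i: "i < n" "\<alpha> H $ i \<noteq> 0"
    using form_carrier [OF H] form_nonzero [OF H] by (auto simp: vec_eq_iff)
  \<comment> \<open>division by \<open>a\<^sub>i\<close>, a nonzero constant\<close>
  define c where "c = to_fract (const (1 / \<alpha> H $ i))"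
  have c: "c * grad H i = 1" "c \<in> regular n"
    using i by (auto simp: c_def grad_def simp flip: to_fract_mult const_mult)
  define \<eta> where "\<eta> K = to_fract f * \<omega> K" for K
  define \<delta> where "\<delta> K = to_fract f * wedge1 (dlog_coeff H) \<omega> K" for K
  have reg: "\<eta> K \<in> regular n" "\<delta> K \<in> regular n" for K
    using \<omega> H by (auto simp: log_forms_iff \<eta>_def \<delta>_def)
  have supp: "\<omega> K = 0" if "K \<notin> index_sets n p" for K
    using \<omega> that by (auto simp: log_forms_iff)
  have wedge_\<eta>: "wedge1 (dlog_coeff H) \<eta> = \<delta>"
    by (rule ext) (simp add: \<eta>_def [abs_def] \<delta>_def wedge1_scale_right)
  show ?thesis
  proof (rule exI [of _ "\<lambda>J. c * contract1 i \<eta> J"], rule exI [of _ "\<lambda>J. c * contract1 i \<delta> J"],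
      intro conjI allI impI)
    show "c * contract1 i \<eta> J \<in> regular n" "c * contract1 i \<delta> J \<in> regular n" for J
      using c(2) reg by (auto intro: regular_contract1)
    show "c * contract1 i \<eta> J = 0" if J: "\<not> (J \<subseteq> {..<n} \<and> Suc (card J) = p)" for J
    proof (cases "i \<in> J")
      case False
      have "insert i J \<notin> index_sets n p"
      proof
        assume "insert i J \<in> index_sets n p"
        moreover from this have "finite (insert i J)"
          by (rule index_sets_finite)
        ultimately show False
          using J False by (auto simp: index_sets_def)
      qed
      then show ?thesis
        by (simp add: contract1_def \<eta>_def supp)
    qed (simp add: contract1_def)
    show "to_fract (cofactor H) * \<omega> K = wedge1 (dlog_coeff H) (\<lambda>J. c * contract1 i \<eta> J) K + c * contract1 i \<delta> K" for K
    proof (cases "finite K")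
      case True
      have "to_fract (cofactor H) * \<omega> K = (c * grad H i) * (to_fract (cofactor H) * \<omega> K)"
        by (simp only: c(1) mult_1_left)
      also have "\<dots> = c * ((to_fract (cofactor H) * grad H i) * \<omega> K)"
        by (simp only: mult_ac)
      also have "\<dots> = c * (dlog_coeff H i * \<eta> K)"
        unfolding f_dlog_coeff [OF H, symmetric] \<eta>_def by (simp only: mult_ac)
      also have "\<dots> = c * (wedge1 (dlog_coeff H) (contract1 i \<eta>) K + contract1 i \<delta> K)"
        using wedge1_contract1 [OF True, of "dlog_coeff H" i \<eta>] by (simp add: wedge_\<eta>)
      finally show ?thesis
        by (simp only: wedge1_scale_right distrib_left)
    next
      case False
      then have "K \<notin> index_sets n p"
        using index_sets_finite by blast
      then have "\<omega> K = 0"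
        by (rule supp)
      moreover have "\<delta> (insert i K) = 0"
        unfolding \<delta>_def using False by (subst wedge1_infinite) simp_all
      then have "contract1 i \<delta> K = 0"
        by (simp only: contract1_def mult_zero_right if_cancel)
      ultimately show ?thesis
        by (simp only: wedge1_infinite [OF False] mult_zero_right add_0_left)
    qed
  qed
qed

end

section \<open>Logarithmic forms as a dual lattice\<close>

text \<open>
  The coefficients of a one-form, in the format that \<^const>\<open>wedge1\<close> expects.
\<close>

definition coeffs1 :: "rform \<Rightarrow> nat \<Rightarrow> cpoly fract"
  where "coeffs1 \<omega> = (\<lambda>k. \<omega> {k})"

definition pairing :: "nat \<Rightarrow> nat \<Rightarrow> rform \<Rightarrow> rform \<Rightarrow> cpoly fract"
  where "pairing n p \<omega> c = (\<Sum>I\<in>index_sets n p. \<omega> I * c I)"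

lemma pairing_add_left: "pairing n p (\<lambda>I. \<omega> I + \<eta> I) c = pairing n p \<omega> c + pairing n p \<eta> c"
  by (simp add: pairing_def algebra_simps sum.distrib)

lemma pairing_scale_left: "pairing n p (\<lambda>I. a * \<omega> I) c = a * pairing n p \<omega> c"
  by (simp add: pairing_def algebra_simps sum_distrib_left)

lemma pairing_add_right: "pairing n p \<omega> (\<lambda>I. c I + d I) = pairing n p \<omega> c + pairing n p \<omega> d"
  by (simp add: pairing_def algebra_simps sum.distrib)

lemma pairing_scale_right: "pairing n p \<omega> (\<lambda>I. a * c I) = a * pairing n p \<omega> c"
  by (simp add: pairing_def algebra_simps sum_distrib_left)

lemma pairing_dx:
  assumes "I \<in> index_sets n p"
  shows "pairing n p \<omega> (dx I) = \<omega> I"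
proof -
  have "pairing n p \<omega> (dx I) = (\<Sum>J\<in>index_sets n p. if J = I then \<omega> I else 0)"
    unfolding pairing_def by (intro sum.cong) (auto simp: dx_def)
  then show ?thesis
    using assms by simp
qed

text \<open>
  The \<open>K\<close>-coefficient of \<open>v \<and> \<omega>\<close> is itself a pairing with \<open>\<omega>\<close>.
\<close>

lemma pairing_wedge1:
  assumes "\<And>I. I \<notin> index_sets n p \<Longrightarrow> \<omega> I = 0"
  shows "pairing n p \<omega> (\<lambda>I. wedge1 v (dx I) K) = wedge1 v \<omega> K"
  unfolding pairing_def using wedge1_eq_sum_dx [OF finite_index_sets assms, where v = v and K = K] by simp

lemma regular_pairing:
  "(\<And>I. \<omega> I \<in> regular n) \<Longrightarrow> (\<And>I. c I \<in> regular n) \<Longrightarrow> pairing n p \<omega> c \<in> regular n"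
  unfolding pairing_def by (intro regular_sum regular_mult)

lemma coeffs1_wedges: "coeffs1 (wedges [v]) = v"
  by (rule ext) (simp only: coeffs1_def wedges_singleton, simp)

lemma coeffs1_dx: "coeffs1 (dx {i}) = (\<lambda>k. dx {i} {k})"
  by (simp add: coeffs1_def)

context central_essential_arrangement
begin

abbreviation (input) M where "M \<equiv> log_module n \<A> \<alpha> (Suc 0)"

definition wedge_tuple :: "rform list \<Rightarrow> rform"
  where "wedge_tuple xs = wedges (map coeffs1 xs)"

lemma log_1_form_coeffs_support:
  "\<omega> \<in> log_forms n \<A> \<alpha> (Suc 0) \<Longrightarrow> n \<le> k \<Longrightarrow> coeffs1 \<omega> k = 0"
  by (auto simp: log_forms_iff coeffs1_def index_sets_def)

lemma log_1_form_coeffs_regular: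
  "\<omega> \<in> log_forms n \<A> \<alpha> (Suc 0) \<Longrightarrow> to_fract f * coeffs1 \<omega> k \<in> regular n"
  by (auto simp: log_forms_iff coeffs1_def)

lemma tuples_log_module: "xs \<in> tuples M p \<longleftrightarrow> length xs = p \<and> set xs \<subseteq> log_forms n \<A> \<alpha> (Suc 0)"
  by (simp add: tuples_def log_module_def)

lemma wedge_tuple_support:
  assumes "xs \<in> tuples M p" and "K \<notin> index_sets n p"
  shows "wedge_tuple xs K = 0"
  unfolding wedge_tuple_def using assms log_1_form_coeffs_support
  by (intro wedges_support [of _ n]) (auto simp: tuples_log_module)

lemma wedge_tuple_pole:
  assumes "xs \<in> tuples M p"
  shows "to_fract f ^ p * wedge_tuple xs K \<in> regular n"
  using regular_wedges [of "map coeffs1 xs" "to_fract f" n K] assms log_1_form_coeffs_regular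
  by (auto simp: wedge_tuple_def tuples_log_module)

lemma dx_log_form:
  assumes "i < n"
  shows "dx {i} \<in> log_forms n \<A> \<alpha> (Suc 0)"
  unfolding log_forms_iff
proof (intro conjI allI impI ballI)
  show "dx {i} I = 0" if "I \<notin> index_sets n (Suc 0)" for I
    using that assms by (auto simp: dx_def index_sets_def)
  show "to_fract f * dx {i} I \<in> regular n" for I
    by (intro regular_mult to_fract_in_regular f_in_mpolys regular_dx)
  show "to_fract f * wedge1 (dlog_coeff H) (dx {i}) K \<in> regular n" if "H \<in> \<A>" for H K
    using regular_wedge1 [of "to_fract f" "dlog_coeff H" n 1 "dx {i}" K] f_dlog_coeff_regular [OF that]
    by simp
qed

text \<open>
  For a second hyperplane \<open>H'\<close> the product \<open>d\<alpha>\<^bsub>H'\<^esub> / \<alpha>\<^bsub>H'\<^esub> \<and> d\<alpha>\<^sub>H / \<alpha>\<^sub>H\<close> has at most a simple pole along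
  each of \<open>H\<close> and \<open>H'\<close>, and for \<open>H' = H\<close> it vanishes.
\<close>

lemma dlog_log_form:
  assumes H: "H \<in> \<A>"
  shows "wedges [dlog_coeff H] \<in> log_forms n \<A> \<alpha> (Suc 0)"
  unfolding log_forms_iff
proof (intro conjI allI impI ballI)
  show "wedges [dlog_coeff H] I = 0" if "I \<notin> index_sets n (Suc 0)" for I
    using that by (intro wedges_support [of _ n]) (auto simp: dlog_coeff_support)
  show "to_fract f * wedges [dlog_coeff H] I \<in> regular n" for I
    using regular_wedges [of "[dlog_coeff H]" "to_fract f" n I] f_dlog_coeff_regular [OF H] by simp
  show "to_fract f * wedge1 (dlog_coeff H') (wedges [dlog_coeff H]) K \<in> regular n" if H': "H' \<in> \<A>" for H' K
  proof (cases "H' = H")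
    case True
    then show ?thesis
      by (simp add: wedge1_self)
  next
    case False
    define g where "g = (\<Prod>H''\<in>\<A> - {H} - {H'}. lf H'')"
    have "cofactor H = lf H' * g"
      unfolding cofactor_def g_def using finite_arrangement H' False by (intro prod.remove) auto
    then have f: "f = lf H * lf H' * g"
      using lf_mult_cofactor [OF H] by (simp add: mult.assoc)
    have "to_fract (lf H') * to_fract (lf H) * wedge1 (dlog_coeff H') (wedges [dlog_coeff H]) K \<in> regular n"
    proof (rule regular_wedge1)
      show "to_fract (lf H') * dlog_coeff H' k \<in> regular n" for k
        by (simp add: lf_dlog_coeff H')
      show "to_fract (lf H) * wedges [dlog_coeff H] J \<in> regular n" for J
        using regular_wedges [of "[dlog_coeff H]" "to_fract (lf H)" n J] by (simp add: lf_dlog_coeff H)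
    qed
    moreover have "to_fract g \<in> regular n"
      unfolding g_def using lf_in_mpolys by (intro to_fract_in_regular mpolys_prod) auto
    ultimately have "to_fract g * (to_fract (lf H') * to_fract (lf H) * wedge1 (dlog_coeff H') (wedges [dlog_coeff H]) K)
        \<in> regular n"
      by (rule regular_mult [rotated])
    then show ?thesis
      by (simp only: f to_fract_mult mult_ac)
  qed
qed

text \<open>
  The lattice of coefficient families that come from functionals on the exterior power of the
  logarithmic one-forms.
\<close>

definition dual_coeffs :: "nat \<Rightarrow> rform set"
  where "dual_coeffs p = {c. (\<forall>I. c I \<in> regular n) \<and>
    (\<forall>xs\<in>tuples M p. pairing n p (wedge_tuple xs) c \<in> regular n)}"

lemma dual_coeffs_regular: "c \<in> dual_coeffs p \<Longrightarrow> c I \<in> regular n"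
  and dual_coeffs_pairing:
    "c \<in> dual_coeffs p \<Longrightarrow> xs \<in> tuples M p \<Longrightarrow> pairing n p (wedge_tuple xs) c \<in> regular n"
  by (simp_all add: dual_coeffs_def)

definition dx_tuple :: "nat set \<Rightarrow> rform list"
  where "dx_tuple J = map (\<lambda>i. dx {i}) (sorted_list_of_set J)"

lemma dx_tuple_in_tuples: "J \<in> index_sets n q \<Longrightarrow> dx_tuple J \<in> tuples M q"
  using index_sets_finite [of J n q]
  by (auto simp: tuples_log_module dx_tuple_def index_sets_def intro!: dx_log_form)

lemma map_coeffs1_dx_tuple: "map coeffs1 (dx_tuple J) = map (\<lambda>i k. dx {i} {k}) (sorted_list_of_set J)"
  by (simp add: dx_tuple_def coeffs1_dx)

lemma wedge_dx_tuple: "finite J \<Longrightarrow> wedge_tuple (dx_tuple J) = dx J"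
  unfolding wedge_tuple_def map_coeffs1_dx_tuple by (subst wedges_dx) simp_all

text \<open>
  Near \<open>H\<close>, the local decomposition makes \<open>\<omega>\<close> a combination of the products
  \<open>d\<alpha>\<^sub>H / \<alpha>\<^sub>H \<and> dx\<^sub>J\<close> and \<open>dx\<^sub>I\<close> of logarithmic one-forms, on which \<open>c\<close> takes polynomial values.
\<close>

lemma log_form_pairing_regular:
  assumes \<omega>: "\<omega> \<in> log_forms n \<A> \<alpha> p" and c: "c \<in> dual_coeffs p"
  shows "pairing n p \<omega> c \<in> regular n"
proof (rule regular_local_global)
  have creg: "c I \<in> regular n" for I
    using c by (rule dual_coeffs_regular)
  have "pairing n p (\<lambda>I. to_fract f * \<omega> I) c \<in> regular n"
    using \<omega> creg by (intro regular_pairing) (simp_all add: log_forms_iff)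
  then show "to_fract f ^ 1 * pairing n p \<omega> c \<in> regular n"
    by (simp add: pairing_scale_left)
  fix H assume H: "H \<in> \<A>"
  obtain \<beta> \<gamma> where \<beta>: "\<And>J. \<beta> J \<in> regular n" and \<gamma>: "\<And>J. \<gamma> J \<in> regular n"
    and supp: "\<And>J. \<not> (J \<subseteq> {..<n} \<and> Suc (card J) = p) \<Longrightarrow> \<beta> J = 0"
    and eq: "\<And>K. to_fract (cofactor H) * \<omega> K = wedge1 (dlog_coeff H) \<beta> K + \<gamma> K"
    using log_form_decomposition [OF \<omega> H] by blast
  let ?S = "{J. J \<subseteq> {..<n} \<and> Suc (card J) = p}"
  have "finite ?S"
    by (rule finite_subset [of _ "Pow {..<n}"]) auto
  then have expand: "wedge1 (dlog_coeff H) \<beta> K = (\<Sum>J\<in>?S. \<beta> J * wedge1 (dlog_coeff H) (dx J) K)" for K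
    using supp by (intro wedge1_eq_sum_dx) auto
  have term_regular: "pairing n p (wedge1 (dlog_coeff H) (dx J)) c \<in> regular n" if J: "J \<in> ?S" for J
  proof -
    have "J \<in> index_sets n (card J)"
      using J by (simp add: index_sets_def)
    then have "dx_tuple J \<in> tuples M (card J)"
      by (rule dx_tuple_in_tuples)
    then have "wedges [dlog_coeff H] # dx_tuple J \<in> tuples M p"
      using J dlog_log_form [OF H] by (simp add: tuples_log_module)
    moreover have "wedge_tuple (wedges [dlog_coeff H] # dx_tuple J) = wedge1 (dlog_coeff H) (dx J)"
      using J wedge_dx_tuple [of J] finite_subset [of J "{..<n}"] unfolding wedge_tuple_def list.map coeffs1_wedges by simp
    ultimately show ?thesis
      using dual_coeffs_pairing [OF c] by metis
  qed
  have "to_fract (cofactor H) * pairing n p \<omega> c = pairing n p (\<lambda>K. wedge1 (dlog_coeff H) \<beta> K + \<gamma> K) c"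
    by (simp only: eq flip: pairing_scale_left)
  also have "\<dots> = pairing n p (wedge1 (dlog_coeff H) \<beta>) c + pairing n p \<gamma> c"
    by (rule pairing_add_left)
  also have "pairing n p (wedge1 (dlog_coeff H) \<beta>) c
      = (\<Sum>J\<in>?S. \<beta> J * pairing n p (wedge1 (dlog_coeff H) (dx J)) c)"
    unfolding pairing_def expand sum_distrib_right sum_distrib_left
    by (subst sum.swap) (simp only: mult.assoc)
  also have "\<dots> + pairing n p \<gamma> c \<in> regular n"
    by (intro regular_add regular_sum regular_mult \<beta> term_regular regular_pairing [OF \<gamma> creg])
  finally have "to_fract (cofactor H) * pairing n p \<omega> c \<in> regular n" .
  then show "\<exists>t. \<not> lf H dvd t \<and> to_fract t * pairing n p \<omega> c \<in> regular n"
    using lf_not_dvd_cofactor [OF H] by blast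
qed

text \<open>
  In the product of \<open>d\<alpha>\<^sub>H / \<alpha>\<^sub>H b + u\<close> and \<open>d\<alpha>\<^sub>H / \<alpha>\<^sub>H \<and> \<beta> + \<gamma>\<close> the term with two factors
  \<open>d\<alpha>\<^sub>H / \<alpha>\<^sub>H\<close> vanishes, so the order of the pole along \<open>H\<close> does not grow with the number of
  factors.
\<close>

lemma wedge_tuple_decomposition:
  assumes xs: "set xs \<subseteq> log_forms n \<A> \<alpha> (Suc 0)" and H: "H \<in> \<A>"
  shows "\<exists>\<beta> \<gamma>. (\<forall>J. \<beta> J \<in> regular n) \<and> (\<forall>J. \<gamma> J \<in> regular n) \<and>
    (\<lambda>K. to_fract (cofactor H) ^ length xs * wedge_tuple xs K)
      = (\<lambda>K. wedge1 (dlog_coeff H) \<beta> K + \<gamma> K)"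
  using xs
proof (induction xs)
  case Nil
  show ?case
    by (rule exI [of _ "\<lambda>K. 0"], rule exI [of _ "dx {}"]) (simp add: wedge_tuple_def wedge1_zero_right)
next
  case (Cons \<omega> xs)
  let ?v = "dlog_coeff H" and ?s = "to_fract (cofactor H)"
  obtain \<beta> \<gamma> where reg: "\<And>J. \<beta> J \<in> regular n" "\<And>J. \<gamma> J \<in> regular n"
    and eq: "(\<lambda>K. ?s ^ length xs * wedge_tuple xs K) = (\<lambda>K. wedge1 ?v \<beta> K + \<gamma> K)"
    using Cons by auto
  have \<omega>_log: "\<omega> \<in> log_forms n \<A> \<alpha> (Suc 0)"
    using Cons.prems by simp
  obtain b g where b: "\<And>J. b J \<in> regular n" and g: "\<And>J. g J \<in> regular n"
    and \<omega>: "\<And>K. ?s * \<omega> K = wedge1 ?v b K + g K"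
    using log_form_decomposition [OF \<omega>_log H] by blast
  define u where "u k = g {k}" for k
  have coeffs: "(\<lambda>k. ?s * coeffs1 \<omega> k) = (\<lambda>k. b {} * ?v k + u k)"
    by (rule ext) (simp add: coeffs1_def \<omega> u_def wedge1_def shuffle_sign_empty)
  have u: "u k \<in> regular n" for k
    by (simp add: u_def g)
  have "?s ^ length (\<omega> # xs) * wedge_tuple (\<omega> # xs) K
      = wedge1 ?v (\<lambda>K. b {} * \<gamma> K - wedge1 u \<beta> K) K + wedge1 u \<gamma> K" for K
  proof -
    have "?s ^ length (\<omega> # xs) * wedge_tuple (\<omega> # xs) K
        = ?s * (?s ^ length xs * wedge1 (coeffs1 \<omega>) (wedge_tuple xs) K)"
      by (simp add: wedge_tuple_def mult.assoc)
    also have "\<dots> = wedge1 (\<lambda>k. ?s * coeffs1 \<omega> k) (\<lambda>K. ?s ^ length xs * wedge_tuple xs K) K"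
      by (simp only: wedge1_scale_left wedge1_scale_right)
    also have "\<dots> = wedge1 (\<lambda>k. b {} * ?v k + u k) (\<lambda>K. wedge1 ?v \<beta> K + \<gamma> K) K"
      by (simp only: coeffs eq)
    also have "\<dots> = b {} * wedge1 ?v (wedge1 ?v \<beta>) K + b {} * wedge1 ?v \<gamma> K
        + (wedge1 u (wedge1 ?v \<beta>) K + wedge1 u \<gamma> K)"
      by (simp only: wedge1_add_left [of "\<lambda>k. b {} * ?v k" u] wedge1_scale_left wedge1_add_right distrib_left)
    also have "\<dots> = (b {} * wedge1 ?v \<gamma> K + - wedge1 ?v (wedge1 u \<beta>) K) + wedge1 u \<gamma> K"
      by (simp only: wedge1_self wedge1_anticommute [of u ?v] mult_zero_right add_0_left add.assoc)
    also have "b {} * wedge1 ?v \<gamma> K + - wedge1 ?v (wedge1 u \<beta>) K = wedge1 ?v (\<lambda>K. b {} * \<gamma> K - wedge1 u \<beta> K) K"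
      by (simp add: wedge1_def sum_distrib_left sum_subtractf algebra_simps)
    finally show ?thesis .
  qed
  moreover have "wedge1 u X K \<in> regular n" if "\<And>J. X J \<in> regular n" for X K
    using regular_wedge1 [of 1 u n 1 X K] u that by simp
  ultimately show ?case
    using reg b
    by (intro exI [of _ "\<lambda>K. b {} * \<gamma> K - wedge1 u \<beta> K"] exI [of _ "wedge1 u \<gamma>"])
      (auto intro!: regular_diff regular_mult)
qed

lemma scaled_dx_in_dual_coeffs:
  assumes I: "I \<in> index_sets n p"
  shows "(\<lambda>J. to_fract f ^ p * dx I J) \<in> dual_coeffs p"
  unfolding dual_coeffs_def
proof (intro CollectI conjI allI ballI)
  show "to_fract f ^ p * dx I J \<in> regular n" for J
    by (intro regular_mult regular_power to_fract_in_regular f_in_mpolys regular_dx)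
  show "pairing n p (wedge_tuple xs) (\<lambda>J. to_fract f ^ p * dx I J) \<in> regular n" if "xs \<in> tuples M p" for xs
    using wedge_tuple_pole [OF that] by (simp add: pairing_scale_right pairing_dx [OF I])
qed

text \<open>
  Testing against \<open>f\<^sup>p e\<^sub>I\<close> bounds the poles of \<open>\<omega>\<close>. By \<open>wedge_tuple_decomposition\<close> the family
  \<open>s\<^sup>p \<alpha>\<^sub>H e\<^sub>I\<close> lies in the dual lattice, so \<open>\<omega>\<close> has at most a simple pole along \<open>H\<close>; and so does the
  family that computes the coefficients of \<open>s\<^sup>p d\<alpha>\<^sub>H \<and> \<omega>\<close>, because multiplication by \<open>d\<alpha>\<^sub>H\<close>
  kills the polar part. Hence \<open>d\<alpha>\<^sub>H \<and> \<omega>\<close> has no pole along \<open>H\<close>.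
\<close>

lemma log_formI_pairing:
  assumes supp: "\<And>I. I \<notin> index_sets n p \<Longrightarrow> \<omega> I = 0"
    and pair: "\<And>c. c \<in> dual_coeffs p \<Longrightarrow> pairing n p \<omega> c \<in> regular n"
  shows "\<omega> \<in> log_forms n \<A> \<alpha> p"
proof -
  let ?s = "\<lambda>H. to_fract (cofactor H)" and ?v = dlog_coeff
  have s_reg: "?s H ^ k \<in> regular n" for H k
    by (intro regular_power to_fract_in_regular cofactor_in_mpolys)
  have decomposition: "\<exists>\<beta> \<gamma>. (\<forall>J. \<beta> J \<in> regular n) \<and> (\<forall>J. \<gamma> J \<in> regular n) \<and>
      (\<lambda>K. ?s H ^ p * wedge_tuple xs K) = (\<lambda>K. wedge1 (?v H) \<beta> K + \<gamma> K)"
    if "xs \<in> tuples M p" "H \<in> \<A>" for xs H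
    using wedge_tuple_decomposition [of xs H] that unfolding tuples_log_module by blast
  have pole: "to_fract f ^ p * \<omega> I \<in> regular n" for I
  proof (cases "I \<in> index_sets n p")
    case True
    have "(\<lambda>J. to_fract f ^ p * dx I J) \<in> dual_coeffs p"
      using True by (rule scaled_dx_in_dual_coeffs)
    then show ?thesis
      using pair by (fastforce simp: pairing_scale_right pairing_dx [OF True])
  qed (simp add: supp)
  have local_pole: "?s H ^ p * to_fract (lf H) * \<omega> I \<in> regular n" if H: "H \<in> \<A>" for H I
  proof (cases "I \<in> index_sets n p")
    case True
    let ?c = "\<lambda>J. (?s H ^ p * to_fract (lf H)) * dx I J"
    have "?c \<in> dual_coeffs p"
      unfolding dual_coeffs_def
    proof (intro CollectI conjI allI ballI)
      show "?c J \<in> regular n" for J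
        by (intro regular_mult s_reg to_fract_in_regular lf_in_mpolys H regular_dx)
      fix xs assume xs: "xs \<in> tuples M p"
      obtain \<beta> \<gamma> where reg: "\<And>J. \<beta> J \<in> regular n" "\<And>J. \<gamma> J \<in> regular n"
        and eq: "(\<lambda>K. ?s H ^ p * wedge_tuple xs K) = (\<lambda>K. wedge1 (?v H) \<beta> K + \<gamma> K)"
        using decomposition [OF xs H] by blast
      have "pairing n p (wedge_tuple xs) ?c = to_fract (lf H) * (?s H ^ p * wedge_tuple xs I)"
        unfolding pairing_scale_right pairing_dx [OF True] by (simp only: mult_ac)
      also have "\<dots> = to_fract (lf H) * (wedge1 (?v H) \<beta> I + \<gamma> I)"
        using fun_cong [OF eq, of I] by simp
      also have "\<dots> = to_fract (lf H) * 1 * wedge1 (?v H) \<beta> I + to_fract (lf H) * \<gamma> I"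
        by (simp add: distrib_left)
      also have "\<dots> \<in> regular n"
      proof (rule regular_add)
        show "to_fract (lf H) * 1 * wedge1 (?v H) \<beta> I \<in> regular n"
          by (rule regular_wedge1) (simp_all add: lf_dlog_coeff [OF H] reg)
        show "to_fract (lf H) * \<gamma> I \<in> regular n"
          by (intro regular_mult to_fract_in_regular lf_in_mpolys H reg)
      qed
      finally show "pairing n p (wedge_tuple xs) ?c \<in> regular n" .
    qed
    then show ?thesis
      using pair by (fastforce simp: pairing_scale_right pairing_dx [OF True])
  qed (simp add: supp)
  have f\<omega>: "to_fract f * \<omega> I \<in> regular n" for I
  proof (rule regular_local_global)
    show "to_fract f ^ p * (to_fract f * \<omega> I) \<in> regular n"
      using regular_mult [OF to_fract_in_regular [OF f_in_mpolys] pole [of I]] by (simp add: mult.left_commute)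
    fix H assume H: "H \<in> \<A>"
    have "?s H ^ 1 * (?s H ^ p * to_fract (lf H) * \<omega> I) \<in> regular n"
      by (intro regular_mult [OF s_reg] local_pole H)
    moreover have "to_fract f = to_fract (lf H) * ?s H"
      by (simp flip: lf_mult_cofactor [OF H])
    ultimately have "to_fract (cofactor H ^ p) * (to_fract f * \<omega> I) \<in> regular n"
      by (simp add: to_fract_power mult_ac)
    then show "\<exists>t. \<not> lf H dvd t \<and> to_fract t * (to_fract f * \<omega> I) \<in> regular n"
      using lf_not_dvd_power [OF H lf_not_dvd_cofactor [OF H]] by blast
  qed
  have "to_fract f * wedge1 (?v H) \<omega> K \<in> regular n" if H: "H \<in> \<A>" for H K
  proof -
    have wedge_grad: "to_fract (lf H) * wedge1 (?v H) X K = wedge1 (grad H) X K" for X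
      by (simp add: lf_dlog_coeff [OF H] flip: wedge1_scale_left)
    \<comment> \<open>the candidate for a polynomial; its pole along \<open>H\<close> is controlled by \<open>grad_pole\<close>, its poles along the other hyperplanes by \<open>grad_f\<omega>\<close>\<close>
    have x_eq: "to_fract f * wedge1 (?v H) \<omega> K = ?s H * wedge1 (grad H) \<omega> K"
      by (simp add: wedge_grad mult_ac flip: lf_mult_cofactor [OF H] wedge_grad)
    have grad_f\<omega>: "to_fract f * wedge1 (grad H) \<omega> K \<in> regular n"
      using regular_wedge1 [of 1 "grad H" n "to_fract f" \<omega> K] f\<omega> by simp
    have grad_pole: "?s H ^ p * wedge1 (grad H) \<omega> K \<in> regular n"
    proof -
      let ?c = "\<lambda>I. ?s H ^ p * wedge1 (grad H) (dx I) K"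
      have "?c \<in> dual_coeffs p"
        unfolding dual_coeffs_def
      proof (intro CollectI conjI allI ballI)
        show "?c I \<in> regular n" for I
          using regular_wedge1 [of 1 "grad H" n 1 "dx I" K] by (intro regular_mult s_reg) simp
        fix xs assume xs: "xs \<in> tuples M p"
        obtain \<beta> \<gamma> where reg: "\<And>J. \<gamma> J \<in> regular n"
          and eq: "(\<lambda>K. ?s H ^ p * wedge_tuple xs K) = (\<lambda>K. wedge1 (?v H) \<beta> K + \<gamma> K)"
          using decomposition [OF xs H] by blast
        have "pairing n p (wedge_tuple xs) ?c = ?s H ^ p * wedge1 (grad H) (wedge_tuple xs) K"
          unfolding pairing_scale_right
          by (subst pairing_wedge1) (simp_all add: wedge_tuple_support [OF xs])
        also have "\<dots> = wedge1 (grad H) (\<lambda>K. wedge1 (?v H) \<beta> K + \<gamma> K) K"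
          by (simp only: eq flip: wedge1_scale_right)
        also have "\<dots> = wedge1 (grad H) \<gamma> K"
          by (simp only: wedge1_add_right wedge1_self mult_zero_right add_0_left flip: wedge_grad)
        also have "\<dots> \<in> regular n"
          using regular_wedge1 [of 1 "grad H" n 1 \<gamma> K] reg by simp
        finally show "pairing n p (wedge_tuple xs) ?c \<in> regular n" .
      qed
      then have "pairing n p \<omega> ?c \<in> regular n"
        by (rule pair)
      then show ?thesis
        unfolding pairing_scale_right by (subst (asm) pairing_wedge1) (simp_all add: supp)
    qed
    show ?thesis
      unfolding x_eq
    proof (rule regular_local_global)
      show "to_fract f ^ 1 * (?s H * wedge1 (grad H) \<omega> K) \<in> regular n"
        using regular_mult [OF s_reg [of H 1] grad_f\<omega>] by (simp add: mult.left_commute)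
      fix H' assume H': "H' \<in> \<A>"
      show "\<exists>t. \<not> lf H' dvd t \<and> to_fract t * (?s H * wedge1 (grad H) \<omega> K) \<in> regular n"
      proof (cases "H' = H")
        case True
        have "to_fract (cofactor H ^ p) * (?s H * wedge1 (grad H) \<omega> K) \<in> regular n"
          using regular_mult [OF s_reg [of H 1] grad_pole] by (simp add: to_fract_power mult.left_commute)
        then show ?thesis
          using lf_not_dvd_power [OF H lf_not_dvd_cofactor [OF H]] True by blast
      next
        case False
        have "to_fract (lf H) * (?s H * wedge1 (grad H) \<omega> K) \<in> regular n"
          using grad_f\<omega> by (simp add: mult.assoc flip: lf_mult_cofactor [OF H])
        then show ?thesis
          using lf_not_dvd_lf [OF H' H False] by blast
      qed
    qed
  qed
  then show ?thesis
    using supp f\<omega> by (simp add: log_forms_iff)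
qed

end

section \<open>Alternating maps on logarithmic one-forms\<close>

lemma mpoly_ring_simps [simp]:
  "carrier (mpoly_ring n) = mpolys n"
  "p \<otimes>\<^bsub>mpoly_ring n\<^esub> q = p * q" "\<one>\<^bsub>mpoly_ring n\<^esub> = 1"
  "\<zero>\<^bsub>mpoly_ring n\<^esub> = 0" "p \<oplus>\<^bsub>mpoly_ring n\<^esub> q = p + q"
  by (simp_all add: mpoly_ring_def)

lemma cring_mpoly_ring: "cring (mpoly_ring n)"
proof (rule cringI)
  show "abelian_group (mpoly_ring n)"
  proof (rule abelian_groupI)
    fix p assume "p \<in> carrier (mpoly_ring n)"
    then show "\<exists>q\<in>carrier (mpoly_ring n). q \<oplus>\<^bsub>mpoly_ring n\<^esub> p = \<zero>\<^bsub>mpoly_ring n\<^esub>"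
      by (intro bexI [of _ "- p"]) auto
  qed (auto simp: algebra_simps)
  show "Group.comm_monoid (mpoly_ring n)"
    by (rule comm_monoidI) (auto simp: algebra_simps)
qed (simp add: distrib_right)

lemma log_module_simps:
  "carrier (log_module n \<A> \<alpha> p) = log_forms n \<A> \<alpha> p"
  "\<omega> \<oplus>\<^bsub>log_module n \<A> \<alpha> p\<^esub> \<eta> = (\<lambda>I. \<omega> I + \<eta> I)"
  "r \<odot>\<^bsub>log_module n \<A> \<alpha> p\<^esub> \<omega> = (\<lambda>I. to_fract r * \<omega> I)"
  "\<zero>\<^bsub>log_module n \<A> \<alpha> p\<^esub> = (\<lambda>I. 0)"
  by (simp_all add: log_module_def)

text \<open>
  Meaningful on the image of the embedding only.
\<close>

definition poly_of_fract :: "cpoly fract \<Rightarrow> cpoly"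
  where "poly_of_fract = inv_into UNIV to_fract"

lemma poly_of_fract_to_fract [simp]: "poly_of_fract (to_fract p) = p"
  unfolding poly_of_fract_def by (rule inv_f_f) (simp add: inj_on_def)

lemma to_fract_poly_of_fract: "x \<in> regular n \<Longrightarrow> to_fract (poly_of_fract x) = x"
  by (auto simp: regular_def)

lemma poly_of_fract_in_mpolys: "x \<in> regular n \<Longrightarrow> poly_of_fract x \<in> mpolys n"
  by (auto simp: regular_def)

lemma poly_of_fract_add:
  "x \<in> regular n \<Longrightarrow> y \<in> regular n \<Longrightarrow> poly_of_fract (x + y) = poly_of_fract x + poly_of_fract y"
  by (auto simp: regular_def simp flip: to_fract_add)

lemma poly_of_fract_mult:
  "x \<in> regular n \<Longrightarrow> y \<in> regular n \<Longrightarrow> poly_of_fract (x * y) = poly_of_fract x * poly_of_fract y"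
  by (auto simp: regular_def simp flip: to_fract_mult)

lemma coeffs1_add: "coeffs1 (\<lambda>I. \<omega> I + \<eta> I) = (\<lambda>k. coeffs1 \<omega> k + coeffs1 \<eta> k)"
  by (simp add: coeffs1_def)

lemma coeffs1_scale: "coeffs1 (\<lambda>I. a * \<omega> I) = (\<lambda>k. a * coeffs1 \<omega> k)"
  by (simp add: coeffs1_def)

lemma sorted_list_of_set_insert_split:
  fixes i :: nat
  assumes "finite J" and "i \<notin> J"
  shows "sorted_list_of_set J = sorted_list_of_set {j \<in> J. j < i} @ sorted_list_of_set {j \<in> J. i < j}"
    and "sorted_list_of_set (insert i J)
      = sorted_list_of_set {j \<in> J. j < i} @ i # sorted_list_of_set {j \<in> J. i < j}"
proof -
  let ?A = "sorted_list_of_set {j \<in> J. j < i}" and ?B = "sorted_list_of_set {j \<in> J. i < j}"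
  have fin: "finite {j \<in> J. j < i}" "finite {j \<in> J. i < j}"
    using assms(1) by simp_all
  have J: "J = {j \<in> J. j < i} \<union> {j \<in> J. i < j}"
    using assms(2) nat_neq_iff by blast
  have "sorted_wrt (<) (?A @ ?B)" "sorted_wrt (<) (?A @ i # ?B)"
    using fin by (auto simp: sorted_wrt_append)
  moreover have "set (?A @ ?B) = J" "set (?A @ i # ?B) = insert i J"
    using fin J by auto
  moreover have "sorted_list_of_set (set xs) = xs" if "sorted_wrt (<) xs" for xs :: "nat list"
    using that by (simp add: strict_sorted_iff sorted_list_of_set.idem_if_sorted_distinct)
  ultimately show "sorted_list_of_set J = ?A @ ?B" "sorted_list_of_set (insert i J) = ?A @ i # ?B"
    by metis+
qed

context central_essential_arrangement
begin

lemma log_forms_zero: "(\<lambda>I. 0) \<in> log_forms n \<A> \<alpha> p"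
  by (simp add: log_forms_iff wedge1_zero_right)

lemma log_forms_add:
  assumes "\<omega> \<in> log_forms n \<A> \<alpha> p" and "\<eta> \<in> log_forms n \<A> \<alpha> p"
  shows "(\<lambda>I. \<omega> I + \<eta> I) \<in> log_forms n \<A> \<alpha> p"
  using assms unfolding log_forms_iff wedge1_add_right distrib_left by (auto intro: regular_add)

lemma log_forms_scale:
  assumes "\<omega> \<in> log_forms n \<A> \<alpha> p" and r: "r \<in> mpolys n"
  shows "(\<lambda>I. to_fract r * \<omega> I) \<in> log_forms n \<A> \<alpha> p"
  using assms(1) regular_mult [OF to_fract_in_regular [OF r]]
  unfolding log_forms_iff wedge1_scale_right mult.left_commute [of "to_fract f"] by simp

lemma module_log_module: "Module.module (mpoly_ring n) (log_module n \<A> \<alpha> p)"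
proof (rule Module.moduleI)
  let ?M = "log_module n \<A> \<alpha> p"
  show "abelian_group ?M"
  proof (rule abelian_groupI)
    fix \<omega> assume "\<omega> \<in> carrier ?M"
    then have "(\<lambda>I. to_fract (const (- 1)) * \<omega> I) \<in> carrier ?M"
      by (simp add: log_module_simps log_forms_scale)
    moreover have "to_fract (const (- 1)) = - 1"
      by (simp add: const_def single_uminus)
    ultimately show "\<exists>\<eta>\<in>carrier ?M. \<eta> \<oplus>\<^bsub>?M\<^esub> \<omega> = \<zero>\<^bsub>?M\<^esub>"
      by (intro bexI [of _ "\<lambda>I. - \<omega> I"]) (simp_all add: log_module_simps)
  qed (simp_all add: log_module_simps log_forms_zero log_forms_add algebra_simps)
qed (simp_all add: cring_mpoly_ring log_module_simps log_forms_scale distrib_left distrib_right mult.assoc)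

lemma wedge_tuple_add:
  "wedge_tuple (us @ (\<lambda>I. \<omega> I + \<eta> I) # vs) K = wedge_tuple (us @ \<omega> # vs) K + wedge_tuple (us @ \<eta> # vs) K"
  by (simp only: wedge_tuple_def map_append list.map coeffs1_add wedges_add)

lemma wedge_tuple_scale:
  "wedge_tuple (us @ (\<lambda>I. a * \<omega> I) # vs) K = a * wedge_tuple (us @ \<omega> # vs) K"
  by (simp only: wedge_tuple_def map_append list.map coeffs1_scale wedges_scale)

lemma wedge_tuple_repeat: "wedge_tuple (us @ \<omega> # vs @ \<omega> # ws) K = 0"
  by (simp only: wedge_tuple_def map_append list.map wedges_repeat)

text \<open>
  With \<open>exterior_power_universal\<close>, this turns each element of the dual lattice into a functional on
  the exterior power.
\<close>

lemma alternating_map_pairing: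
  assumes c: "c \<in> dual_coeffs p"
  shows "alternating_map (mpoly_ring n) M p (\<lambda>xs. poly_of_fract (pairing n p (wedge_tuple xs) c))"
  unfolding alternating_map_def
proof (intro conjI ballI allI impI Pi_I)
  let ?P = "\<lambda>xs. pairing n p (wedge_tuple xs) c"
  have reg: "?P xs \<in> regular n" if "xs \<in> tuples M p" for xs
    using c that by (rule dual_coeffs_pairing)
  show "poly_of_fract (?P xs) \<in> carrier (mpoly_ring n)" if "xs \<in> tuples M p" for xs
    using reg [OF that] by (simp add: poly_of_fract_in_mpolys)
  fix xs assume xs: "xs \<in> tuples M p"
  have split: "xs[i := x] = take i xs @ x # drop (Suc i) xs" if "i < p" for i x
    using that xs by (simp add: upd_conv_take_nth_drop tuples_log_module)
  fix i assume i: "i < p"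
  show "poly_of_fract (?P (xs[i := x \<oplus>\<^bsub>M\<^esub> y])) =
      poly_of_fract (?P (xs[i := x])) \<oplus>\<^bsub>mpoly_ring n\<^esub> poly_of_fract (?P (xs[i := y]))"
    if "x \<in> carrier M" "y \<in> carrier M" for x y
  proof -
    have "wedge_tuple (xs[i := x \<oplus>\<^bsub>M\<^esub> y])
        = (\<lambda>K. wedge_tuple (xs[i := x]) K + wedge_tuple (xs[i := y]) K)"
      by (rule ext) (simp only: split [OF i] log_module_simps wedge_tuple_add)
    then have "?P (xs[i := x \<oplus>\<^bsub>M\<^esub> y]) = ?P (xs[i := x]) + ?P (xs[i := y])"
      by (simp only: pairing_add_left)
    then show ?thesis
      using poly_of_fract_add [OF reg [OF tuples_update [OF xs that(1)]] reg [OF tuples_update [OF xs that(2)]]]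
      by simp
  qed
  show "poly_of_fract (?P (xs[i := r \<odot>\<^bsub>M\<^esub> x])) = r \<otimes>\<^bsub>mpoly_ring n\<^esub> poly_of_fract (?P (xs[i := x]))"
    if "r \<in> carrier (mpoly_ring n)" "x \<in> carrier M" for r x
  proof -
    have "wedge_tuple (xs[i := r \<odot>\<^bsub>M\<^esub> x]) = (\<lambda>K. to_fract r * wedge_tuple (xs[i := x]) K)"
      by (rule ext) (simp only: split [OF i] log_module_simps wedge_tuple_scale)
    then have "?P (xs[i := r \<odot>\<^bsub>M\<^esub> x]) = to_fract r * ?P (xs[i := x])"
      by (simp only: pairing_scale_left)
    moreover have "poly_of_fract (to_fract r * ?P (xs[i := x])) = poly_of_fract (to_fract r) * poly_of_fract (?P (xs[i := x]))"
      using that by (intro poly_of_fract_mult [of _ n] reg tuples_update xs to_fract_in_regular) simp_all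
    ultimately show ?thesis
      by simp
  qed
next
  fix xs i j assume xs: "xs \<in> tuples M p" and ij: "j < p" "i < j" "xs ! i = xs ! j"
  then have len: "length xs = p"
    by (simp add: tuples_log_module)
  have "xs = take i xs @ xs ! i # drop (Suc i) xs"
    by (rule id_take_nth_drop) (use ij len in simp)
  also have "drop (Suc i) xs = take (j - Suc i) (drop (Suc i) xs) @ xs ! j # drop (Suc j) xs"
    using ij len id_take_nth_drop [of "j - Suc i" "drop (Suc i) xs"] by simp
  finally have "xs = take i xs @ xs ! j # take (j - Suc i) (drop (Suc i) xs) @ xs ! j # drop (Suc j) xs"
    using ij by simp
  then have "wedge_tuple xs = (\<lambda>K. 0)"
    using wedge_tuple_repeat by metis
  then have "pairing n p (wedge_tuple xs) c = to_fract 0"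
    by (simp add: pairing_def)
  then show "poly_of_fract (pairing n p (wedge_tuple xs) c) = \<zero>\<^bsub>mpoly_ring n\<^esub>"
    by (simp only: poly_of_fract_to_fract mpoly_ring_simps)
qed

context
  fixes p :: nat and \<mu> :: "rform list \<Rightarrow> cpoly"
  assumes \<mu>: "alternating_map (mpoly_ring n) M p \<mu>"
begin

lemma alternating_add:
  assumes "us @ \<omega> # vs \<in> tuples M p" and "\<eta> \<in> log_forms n \<A> \<alpha> (Suc 0)"
  shows "\<mu> (us @ (\<lambda>I. \<omega> I + \<eta> I) # vs) = \<mu> (us @ \<omega> # vs) + \<mu> (us @ \<eta> # vs)"
proof -
  have "length us < p" "\<omega> \<in> carrier M" "\<eta> \<in> carrier M"
    using assms by (auto simp: tuples_log_module log_module_simps)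
  then have "\<mu> ((us @ \<omega> # vs)[length us := \<omega> \<oplus>\<^bsub>M\<^esub> \<eta>])
      = \<mu> ((us @ \<omega> # vs)[length us := \<omega>]) \<oplus>\<^bsub>mpoly_ring n\<^esub> \<mu> ((us @ \<omega> # vs)[length us := \<eta>])"
    using \<mu> assms(1) unfolding alternating_map_def by blast
  then show ?thesis
    by (simp add: log_module_simps)
qed

lemma alternating_scale:
  assumes "us @ \<omega> # vs \<in> tuples M p" and "r \<in> mpolys n"
  shows "\<mu> (us @ (\<lambda>I. to_fract r * \<omega> I) # vs) = r * \<mu> (us @ \<omega> # vs)"
proof -
  have "length us < p" "\<omega> \<in> carrier M" "r \<in> carrier (mpoly_ring n)"
    using assms by (auto simp: tuples_log_module log_module_simps)
  then have "\<mu> ((us @ \<omega> # vs)[length us := r \<odot>\<^bsub>M\<^esub> \<omega>])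
      = r \<otimes>\<^bsub>mpoly_ring n\<^esub> \<mu> ((us @ \<omega> # vs)[length us := \<omega>])"
    using \<mu> assms(1) unfolding alternating_map_def by blast
  then show ?thesis
    by (simp add: log_module_simps)
qed

lemma alternating_repeat:
  assumes "us @ \<omega> # vs @ \<omega> # ws \<in> tuples M p"
  shows "\<mu> (us @ \<omega> # vs @ \<omega> # ws) = 0"
proof -
  let ?xs = "us @ \<omega> # vs @ \<omega> # ws" and ?j = "length us + Suc (length vs)"
  have "?j < p"
    using assms by (auto simp: tuples_log_module)
  moreover have "?xs ! length us = ?xs ! ?j" "length us < ?j"
    by (simp_all add: nth_append)
  ultimately have "\<mu> ?xs = \<zero>\<^bsub>mpoly_ring n\<^esub>"
    using \<mu> assms unfolding alternating_map_def by blast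
  then show ?thesis
    by simp
qed

lemma alternating_swap:
  assumes "us @ \<omega> # \<eta> # vs \<in> tuples M p"
  shows "\<mu> (us @ \<omega> # \<eta> # vs) = - \<mu> (us @ \<eta> # \<omega> # vs)"
proof -
  let ?s = "\<lambda>I. \<omega> I + \<eta> I"
  have log: "\<omega> \<in> log_forms n \<A> \<alpha> (Suc 0)" "\<eta> \<in> log_forms n \<A> \<alpha> (Suc 0)"
    and rest: "set us \<subseteq> log_forms n \<A> \<alpha> (Suc 0)" "set vs \<subseteq> log_forms n \<A> \<alpha> (Suc 0)"
    and len: "Suc (Suc (length us + length vs)) = p"
    using assms by (auto simp: tuples_log_module)
  have tuple: "us @ \<theta> # \<zeta> # vs \<in> tuples M p"
    if "\<theta> \<in> log_forms n \<A> \<alpha> (Suc 0)" "\<zeta> \<in> log_forms n \<A> \<alpha> (Suc 0)" for \<theta> \<zeta>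
    using that rest len by (simp add: tuples_log_module)
  have expand_right: "\<mu> (us @ \<theta> # ?s # vs) = \<mu> (us @ \<theta> # \<omega> # vs) + \<mu> (us @ \<theta> # \<eta> # vs)"
    if "\<theta> \<in> log_forms n \<A> \<alpha> (Suc 0)" for \<theta>
    using alternating_add [of "us @ [\<theta>]" \<omega> vs \<eta>] tuple [OF that log(1)] log by simp
  have repeat: "\<mu> (us @ \<theta> # \<theta> # vs) = 0" if "\<theta> \<in> log_forms n \<A> \<alpha> (Suc 0)" for \<theta>
    using alternating_repeat [of us \<theta> "[]" vs] tuple [OF that that] by simp
  have s: "?s \<in> log_forms n \<A> \<alpha> (Suc 0)"
    using log by (rule log_forms_add)
  have "0 = \<mu> (us @ ?s # ?s # vs)"
    by (simp only: repeat [OF s])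
  also have "\<dots> = \<mu> (us @ \<omega> # ?s # vs) + \<mu> (us @ \<eta> # ?s # vs)"
    using tuple [OF log(1) s] log(2) by (rule alternating_add)
  also have "\<dots> = \<mu> (us @ \<omega> # \<eta> # vs) + \<mu> (us @ \<eta> # \<omega> # vs)"
    by (simp only: expand_right log repeat add_0_left add_0_right)
  finally show ?thesis
    by (simp add: eq_neg_iff_add_eq_0)
qed

lemma alternating_move:
  "us @ \<omega> # ws @ vs \<in> tuples M p \<Longrightarrow> \<mu> (us @ \<omega> # ws @ vs) = (- 1) ^ length ws * \<mu> (us @ ws @ \<omega> # vs)"
proof (induction ws arbitrary: us)
  case (Cons \<eta> ws)
  then have "(us @ [\<eta>]) @ \<omega> # ws @ vs \<in> tuples M p"
    by (auto simp: tuples_log_module)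
  then have "\<mu> ((us @ [\<eta>]) @ \<omega> # ws @ vs) = (- 1) ^ length ws * \<mu> ((us @ [\<eta>]) @ ws @ \<omega> # vs)"
    by (rule Cons.IH)
  then show ?case
    using alternating_swap [of us \<omega> \<eta> "ws @ vs"] Cons.prems by simp
qed simp

text \<open>
  Moving \<open>dx\<^sub>i\<close> to its place in increasing order passes exactly the indices of \<open>J\<close> that are less
  than \<open>i\<close>; their number is the exponent of the shuffle sign.
\<close>

lemma alternating_dx_insert:
  assumes "us @ dx {i} # dx_tuple J \<in> tuples M p" and J: "finite J"
  shows "\<mu> (us @ dx {i} # dx_tuple J)
    = (if i \<in> J then 0 else shuffle_sign {i} J * \<mu> (us @ dx_tuple (insert i J)))"
proof (cases "i \<in> J")
  case True
  then obtain as bs where "sorted_list_of_set J = as @ i # bs"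
    using split_list [of i "sorted_list_of_set J"] J by auto
  then have "dx_tuple J = map (\<lambda>i. dx {i}) as @ dx {i} # map (\<lambda>i. dx {i}) bs"
    by (simp add: dx_tuple_def)
  then show ?thesis
    using alternating_repeat [of us "dx {i}" "map (\<lambda>i. dx {i}) as" "map (\<lambda>i. dx {i}) bs"] assms(1) True
    by simp
next
  case False
  define as bs where "as = sorted_list_of_set {j \<in> J. j < i}" and "bs = sorted_list_of_set {j \<in> J. i < j}"
  have J_eq: "dx_tuple J = map (\<lambda>i. dx {i}) as @ map (\<lambda>i. dx {i}) bs"
    and insert_eq: "dx_tuple (insert i J) = map (\<lambda>i. dx {i}) as @ dx {i} # map (\<lambda>i. dx {i}) bs"
    unfolding dx_tuple_def sorted_list_of_set_insert_split [OF J False] as_def bs_def by simp_all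
  have "length (map (\<lambda>i. dx {i} :: rform) as) = card {j \<in> J. j < i}"
    by (simp add: as_def)
  then show ?thesis
    using alternating_move [of us "dx {i}" "map (\<lambda>i. dx {i}) as" "map (\<lambda>i. dx {i}) bs"] assms(1) False
    by (simp only: J_eq insert_eq shuffle_sign_singleton if_False)
qed

lemma alternating_sum:
  assumes "finite S" and "\<And>i. i \<in> S \<Longrightarrow> b i \<in> mpolys n \<and> \<eta> i \<in> log_forms n \<A> \<alpha> (Suc 0)"
    and "us @ \<omega> # vs \<in> tuples M p"
  shows "(\<lambda>I. \<Sum>i\<in>S. to_fract (b i) * \<eta> i I) \<in> log_forms n \<A> \<alpha> (Suc 0) \<and>
    \<mu> (us @ (\<lambda>I. \<Sum>i\<in>S. to_fract (b i) * \<eta> i I) # vs) = (\<Sum>i\<in>S. b i * \<mu> (us @ \<eta> i # vs))"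
  using assms(1,2)
proof (induction S rule: finite_induct)
  have tuple: "us @ \<theta> # vs \<in> tuples M p" if "\<theta> \<in> log_forms n \<A> \<alpha> (Suc 0)" for \<theta>
    using assms(3) that by (simp add: tuples_log_module)
  {
    case empty
    show ?case
      using alternating_scale [OF tuple [OF log_forms_zero], of 0] by (simp add: log_forms_zero)
  next
    case (insert i S)
    let ?r = "\<lambda>I. \<Sum>i\<in>S. to_fract (b i) * \<eta> i I"
    have \<eta>: "b i \<in> mpolys n" "\<eta> i \<in> log_forms n \<A> \<alpha> (Suc 0)"
      using insert.prems by blast+
    then have scaled: "(\<lambda>I. to_fract (b i) * \<eta> i I) \<in> log_forms n \<A> \<alpha> (Suc 0)"
      by (intro log_forms_scale)
    have IH: "?r \<in> log_forms n \<A> \<alpha> (Suc 0)" "\<mu> (us @ ?r # vs) = (\<Sum>i\<in>S. b i * \<mu> (us @ \<eta> i # vs))"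
      using insert.IH insert.prems by blast+
    have eq: "(\<lambda>I. \<Sum>i\<in>insert i S. to_fract (b i) * \<eta> i I) = (\<lambda>I. to_fract (b i) * \<eta> i I + ?r I)"
      using insert.hyps by simp
    show ?case
      unfolding eq
      using log_forms_add [OF scaled IH(1)] alternating_add [OF tuple [OF scaled] IH(1)]
        alternating_scale [OF tuple [OF \<eta>(2)] \<eta>(1)] IH(2) insert.hyps by simp
  }
qed

text \<open>
  The coefficients of \<open>\<omega>\<close> are not polynomials, so linearity is applied to \<open>f \<omega>\<close> and \<open>f\<close> is
  cancelled in the fraction field.
\<close>

lemma alternating_expand:
  assumes tuple: "us @ \<omega> # vs \<in> tuples M p"
  shows "to_fract (\<mu> (us @ \<omega> # vs)) = (\<Sum>i<n. coeffs1 \<omega> i * to_fract (\<mu> (us @ dx {i} # vs)))"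
proof -
  have \<omega>: "\<omega> \<in> log_forms n \<A> \<alpha> (Suc 0)"
    using tuple by (simp add: tuples_log_module)
  define b where "b i = poly_of_fract (to_fract f * coeffs1 \<omega> i)" for i
  have b: "b i \<in> mpolys n" "to_fract (b i) = to_fract f * coeffs1 \<omega> i" for i
    using log_1_form_coeffs_regular [OF \<omega>, of i]
    by (simp_all add: b_def poly_of_fract_in_mpolys to_fract_poly_of_fract)
  have "to_fract f * \<omega> I = (\<Sum>i<n. to_fract (b i) * dx {i} I)" for I
  proof (cases "I \<in> index_sets n (Suc 0)")
    case True
    then obtain k where k: "I = {k}" "k < n"
      by (auto simp: index_sets_def card_1_singleton_iff)
    have "(\<Sum>i<n. to_fract (b i) * dx {i} I) = (\<Sum>i<n. if i = k then to_fract (b k) else 0)"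
      by (intro sum.cong) (auto simp: k dx_def)
    then show ?thesis
      using k by (simp add: b coeffs1_def)
  next
    case False
    then have "(dx {i} :: rform) I = 0" if "i < n" for i
      using that by (auto simp: dx_def index_sets_def)
    then show ?thesis
      using False \<omega> by (simp add: log_forms_iff)
  qed
  then have "f * \<mu> (us @ \<omega> # vs) = \<mu> (us @ (\<lambda>I. \<Sum>i<n. to_fract (b i) * dx {i} I) # vs)"
    using alternating_scale [OF tuple f_in_mpolys] by simp
  also have "\<dots> = (\<Sum>i<n. b i * \<mu> (us @ dx {i} # vs))"
    using alternating_sum [OF _ _ tuple, of "{..<n}" b "\<lambda>i. dx {i}"] b dx_log_form by simp
  finally have "to_fract (f * \<mu> (us @ \<omega> # vs)) = to_fract (\<Sum>i<n. b i * \<mu> (us @ dx {i} # vs))"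
    by (rule arg_cong)
  also have "\<dots> = to_fract f * (\<Sum>i<n. coeffs1 \<omega> i * to_fract (\<mu> (us @ dx {i} # vs)))"
    by (simp add: b sum_distrib_left mult.assoc)
  finally show ?thesis
    using f_nonzero by simp
qed

text \<open>
  Induction on the suffix \<open>vs\<close>, with the prefix \<open>us\<close> arbitrary. The last entry of the prefix is
  expanded in the \<open>dx\<^sub>i\<close> and sorted into the basis form that follows it; the signs that arise are
  those in the definition of the exterior product. This avoids determinants.
\<close>

lemma alternating_suffix:
  assumes "us @ vs \<in> tuples M p"
  shows "to_fract (\<mu> (us @ vs)) = (\<Sum>J\<in>index_sets n (length vs). wedge_tuple vs J * to_fract (\<mu> (us @ dx_tuple J)))"
  using assms
proof (induction vs arbitrary: us)
  case Nil
  have "index_sets n 0 = {{}}"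
    by (auto simp: index_sets_def dest: finite_subset)
  then show ?case
    by (simp add: wedge_tuple_def dx_tuple_def dx_def)
next
  case (Cons \<omega> vs)
  let ?q = "length vs"
  let ?m = "\<lambda>J. to_fract (\<mu> (us @ dx_tuple J))"
  have tuple: "set us \<subseteq> log_forms n \<A> \<alpha> (Suc 0)" "length us + Suc ?q = p"
    and \<omega>: "\<omega> \<in> log_forms n \<A> \<alpha> (Suc 0)" and vs: "vs \<in> tuples M ?q"
    using Cons.prems by (auto simp: tuples_log_module)
  have dx_tuple: "set (dx_tuple J) \<subseteq> log_forms n \<A> \<alpha> (Suc 0)" "length (dx_tuple J) = q" if "J \<in> index_sets n q" for J q
    using dx_tuple_in_tuples [OF that] by (simp_all add: tuples_log_module)
  have inner: "to_fract (\<mu> (us @ \<omega> # dx_tuple J)) = (\<Sum>K\<in>index_sets n (Suc ?q). wedge1 (coeffs1 \<omega>) (dx J) K * ?m K)"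
    if J: "J \<in> index_sets n ?q" for J
  proof -
    have fin: "finite J"
      using J by (rule index_sets_finite)
    have expand: "wedge1 (coeffs1 \<omega>) (dx J) K
        = (\<Sum>i<n. coeffs1 \<omega> i * (if i \<in> J then 0 else shuffle_sign {i} J * dx (insert i J) K))" for K
      using log_1_form_coeffs_support [OF \<omega>] fin by (rule wedge1_eq_sum_insert)
    have "us @ \<omega> # dx_tuple J \<in> tuples M p"
      using tuple \<omega> dx_tuple [OF J] by (simp add: tuples_log_module)
    then have "to_fract (\<mu> (us @ \<omega> # dx_tuple J)) = (\<Sum>i<n. coeffs1 \<omega> i * to_fract (\<mu> (us @ dx {i} # dx_tuple J)))"
      by (rule alternating_expand)
    also have "\<dots> = (\<Sum>i<n. coeffs1 \<omega> i * (\<Sum>K\<in>index_sets n (Suc ?q).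
        (if i \<in> J then 0 else shuffle_sign {i} J * dx (insert i J) K) * ?m K))"
    proof (rule sum.cong)
      fix i assume i: "i \<in> {..<n}"
      then have "us @ dx {i} # dx_tuple J \<in> tuples M p"
        using tuple dx_tuple [OF J] dx_log_form [of i] by (simp add: tuples_log_module)
      then have step: "\<mu> (us @ dx {i} # dx_tuple J)
          = (if i \<in> J then 0 else shuffle_sign {i} J * \<mu> (us @ dx_tuple (insert i J)))"
        using fin by (rule alternating_dx_insert)
      have "to_fract (\<mu> (us @ dx {i} # dx_tuple J))
          = (\<Sum>K\<in>index_sets n (Suc ?q). (if i \<in> J then 0 else shuffle_sign {i} J * dx (insert i J) K) * ?m K)"
      proof (cases "i \<in> J")
        case False
        have "insert i J \<in> index_sets n (Suc ?q)"
          using J i fin False by (simp add: index_sets_def)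
        have "(\<Sum>K\<in>index_sets n (Suc ?q). shuffle_sign {i} J * dx (insert i J) K * ?m K)
            = (\<Sum>K\<in>index_sets n (Suc ?q). if K = insert i J then shuffle_sign {i} J * ?m (insert i J) else 0)"
          by (intro sum.cong) (auto simp: dx_def)
        also have "\<dots> = shuffle_sign {i} J * ?m (insert i J)"
          using \<open>insert i J \<in> index_sets n (Suc ?q)\<close> by simp
        finally show ?thesis
          using False step by (simp add: shuffle_sign_singleton to_fract_power)
      qed (simp add: step)
      then show "coeffs1 \<omega> i * to_fract (\<mu> (us @ dx {i} # dx_tuple J)) = coeffs1 \<omega> i * (\<Sum>K\<in>index_sets n (Suc ?q).
          (if i \<in> J then 0 else shuffle_sign {i} J * dx (insert i J) K) * ?m K)"
        by (rule arg_cong)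
    qed simp
    also have "\<dots> = (\<Sum>K\<in>index_sets n (Suc ?q). wedge1 (coeffs1 \<omega>) (dx J) K * ?m K)"
      unfolding expand sum_distrib_left sum_distrib_right by (subst sum.swap) (simp only: mult.assoc)
    finally show ?thesis .
  qed
  have expand: "wedge1 (coeffs1 \<omega>) (wedge_tuple vs) K
      = (\<Sum>J\<in>index_sets n ?q. wedge_tuple vs J * wedge1 (coeffs1 \<omega>) (dx J) K)" for K
    using wedge_tuple_support [OF vs] by (intro wedge1_eq_sum_dx) simp_all
  have "(us @ [\<omega>]) @ vs \<in> tuples M p"
    using Cons.prems by simp
  from Cons.IH [OF this]
  have "to_fract (\<mu> (us @ \<omega> # vs)) = (\<Sum>J\<in>index_sets n ?q. wedge_tuple vs J * to_fract (\<mu> (us @ \<omega> # dx_tuple J)))"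
    by simp
  also have "\<dots> = (\<Sum>J\<in>index_sets n ?q. \<Sum>K\<in>index_sets n (Suc ?q).
      wedge_tuple vs J * wedge1 (coeffs1 \<omega>) (dx J) K * ?m K)"
    by (intro sum.cong) (simp_all add: inner sum_distrib_left mult.assoc)
  also have "\<dots> = (\<Sum>K\<in>index_sets n (Suc ?q). wedge1 (coeffs1 \<omega>) (wedge_tuple vs) K * ?m K)"
    unfolding expand sum_distrib_right by (rule sum.swap)
  finally show ?case
    by (simp add: wedge_tuple_def)
qed

lemma alternating_map_eq_pairing:
  assumes "xs \<in> tuples M p"
  shows "to_fract (\<mu> xs) = pairing n p (wedge_tuple xs) (\<lambda>I. to_fract (\<mu> (dx_tuple I)))"
  using alternating_suffix [of "[]" xs] assms by (simp add: pairing_def tuples_log_module)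

end

end

section \<open>The double dual of the exterior power\<close>

context central_essential_arrangement
begin

context
  fixes p :: nat
begin

private abbreviation (input) R where "R \<equiv> mpoly_ring n"
private abbreviation (input) E where "E \<equiv> exterior_power R M p"
private abbreviation (input) wc where "wc \<equiv> wedge_class R M p"

text \<open>
  The default value \<open>0\<close> off the index sets makes equality of these families the same as equality
  of the functionals.
\<close>

definition functional_coeffs :: "((rform list \<Rightarrow> cpoly) set \<Rightarrow> cpoly) \<Rightarrow> rform"
  where "functional_coeffs \<phi> = (\<lambda>I. if I \<in> index_sets n p then to_fract (\<phi> (wc (dx_tuple I))) else 0)"

lemma wc_closed: "xs \<in> tuples M p \<Longrightarrow> wc xs \<in> carrier E"
  by (rule module.wedge_class_closed [OF module_log_module])

lemma functional_eq_pairing: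
  assumes \<phi>: "\<phi> \<in> carrier (dual_module R E)" and xs: "xs \<in> tuples M p"
  shows "to_fract (\<phi> (wc xs)) = pairing n p (wedge_tuple xs) (functional_coeffs \<phi>)"
proof -
  have "alternating_map R M p (\<lambda>xs. \<phi> (wc xs))"
    using dual_moduleD(5) [OF \<phi>] by (rule module.alternating_map_wedge_class [OF module_log_module])
  then have "to_fract (\<phi> (wc xs)) = pairing n p (wedge_tuple xs) (\<lambda>I. to_fract (\<phi> (wc (dx_tuple I))))"
    using xs by (rule alternating_map_eq_pairing)
  also have "\<dots> = pairing n p (wedge_tuple xs) (functional_coeffs \<phi>)"
    unfolding pairing_def functional_coeffs_def by (intro sum.cong) simp_all
  finally show ?thesis .
qed

lemma functional_coeffs_in_dual_coeffs:
  assumes \<phi>: "\<phi> \<in> carrier (dual_module R E)"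
  shows "functional_coeffs \<phi> \<in> dual_coeffs p"
proof -
  have reg: "to_fract (\<phi> (wc xs)) \<in> regular n" if "xs \<in> tuples M p" for xs
    using dual_moduleD(1) [OF \<phi> wc_closed [OF that]] by (intro to_fract_in_regular) simp
  show ?thesis
    unfolding dual_coeffs_def
  proof (intro CollectI conjI allI ballI)
    show "functional_coeffs \<phi> I \<in> regular n" for I
      using reg [OF dx_tuple_in_tuples] by (simp add: functional_coeffs_def)
    show "pairing n p (wedge_tuple xs) (functional_coeffs \<phi>) \<in> regular n" if "xs \<in> tuples M p" for xs
      using reg [OF that] by (simp only: functional_eq_pairing [OF \<phi> that])
  qed
qed

lemma functional_coeffs_inject:
  assumes \<phi>: "\<phi> \<in> carrier (dual_module R E)" and \<psi>: "\<psi> \<in> carrier (dual_module R E)"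
    and eq: "functional_coeffs \<phi> = functional_coeffs \<psi>"
  shows "\<phi> = \<psi>"
proof (rule module.exterior_power_functional_eqI [OF module_log_module \<phi> \<psi>])
  fix xs assume xs: "xs \<in> tuples M p"
  have "to_fract (\<phi> (wc xs)) = to_fract (\<psi> (wc xs))"
    unfolding functional_eq_pairing [OF \<phi> xs] functional_eq_pairing [OF \<psi> xs] eq ..
  then show "\<phi> (wc xs) = \<psi> (wc xs)"
    by simp
qed

text \<open>
  The universal property, applied to the pairing with \<open>c\<close>; the \<open>I\<close>-coefficient is recovered from
  the tuple of the \<open>dx\<^sub>i\<close> with \<open>i \<in> I\<close>, whose product is \<open>dx\<^sub>I\<close>.
\<close>

lemma functional_coeffs_surj:
  assumes c: "c \<in> dual_coeffs p"
  shows "\<exists>\<phi>\<in>carrier (dual_module R E). \<forall>I\<in>index_sets n p. functional_coeffs \<phi> I = c I"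
proof -
  obtain \<phi> where \<phi>: "\<phi> \<in> carrier (dual_module R E)"
    and val: "\<And>xs. xs \<in> tuples M p \<Longrightarrow> \<phi> (wc xs) = poly_of_fract (pairing n p (wedge_tuple xs) c)"
    using module.exterior_power_universal [OF module_log_module alternating_map_pairing [OF c]] by blast
  have "functional_coeffs \<phi> I = c I" if I: "I \<in> index_sets n p" for I
  proof -
    have tuple: "dx_tuple I \<in> tuples M p"
      using I by (rule dx_tuple_in_tuples)
    have "pairing n p (wedge_tuple (dx_tuple I)) c = pairing n p c (dx I)"
      using index_sets_finite [OF I] by (simp add: wedge_dx_tuple pairing_def mult.commute)
    also have "\<dots> = c I"
      using I by (rule pairing_dx)
    finally show ?thesis
      using to_fract_poly_of_fract [OF dual_coeffs_regular [OF c]] I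
      by (simp add: functional_coeffs_def val [OF tuple])
  qed
  then show ?thesis
    using \<phi> by blast
qed

lemma functional_coeffs_add:
  assumes "\<phi> \<in> carrier (dual_module R E)" and "\<psi> \<in> carrier (dual_module R E)"
  shows "functional_coeffs (\<phi> \<oplus>\<^bsub>dual_module R E\<^esub> \<psi>) = (\<lambda>I. functional_coeffs \<phi> I + functional_coeffs \<psi> I)"
  using wc_closed [OF dx_tuple_in_tuples] by (auto simp: functional_coeffs_def dual_module_ops)

lemma functional_coeffs_smult:
  assumes "\<phi> \<in> carrier (dual_module R E)"
  shows "functional_coeffs (r \<odot>\<^bsub>dual_module R E\<^esub> \<phi>) = (\<lambda>I. to_fract r * functional_coeffs \<phi> I)"
  using wc_closed [OF dx_tuple_in_tuples] by (auto simp: functional_coeffs_def dual_module_ops)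

text \<open>
  The functional that takes \<open>f\<^sup>p\<close> times the \<open>I\<close>-coefficient of a product of one-forms. The factor
  \<open>f\<^sup>p\<close> clears all denominators.
\<close>

definition coeff_functional :: "nat set \<Rightarrow> (rform list \<Rightarrow> cpoly) set \<Rightarrow> cpoly"
  where "coeff_functional I = (SOME \<phi>. \<phi> \<in> carrier (dual_module R E) \<and>
    functional_coeffs \<phi> = (\<lambda>J. to_fract f ^ p * dx I J))"

lemma coeff_functional_props:
  assumes I: "I \<in> index_sets n p"
  shows "coeff_functional I \<in> carrier (dual_module R E)"
    and "functional_coeffs (coeff_functional I) = (\<lambda>J. to_fract f ^ p * dx I J)"
proof -
  obtain \<phi> where \<phi>: "\<phi> \<in> carrier (dual_module R E)"
      "\<forall>J\<in>index_sets n p. functional_coeffs \<phi> J = to_fract f ^ p * dx I J"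
    using functional_coeffs_surj [OF scaled_dx_in_dual_coeffs [OF I]] by blast
  have "functional_coeffs \<phi> J = to_fract f ^ p * dx I J" for J
    using \<phi>(2) I by (cases "J \<in> index_sets n p") (auto simp: functional_coeffs_def dx_def)
  then have "\<phi> \<in> carrier (dual_module R E) \<and> functional_coeffs \<phi> = (\<lambda>J. to_fract f ^ p * dx I J)"
    using \<phi>(1) by blast
  then have "coeff_functional I \<in> carrier (dual_module R E) \<and>
      functional_coeffs (coeff_functional I) = (\<lambda>J. to_fract f ^ p * dx I J)"
    unfolding coeff_functional_def
    by (rule someI [where P = "\<lambda>\<phi>. \<phi> \<in> carrier (dual_module R E) \<and>
      functional_coeffs \<phi> = (\<lambda>J. to_fract f ^ p * dx I J)"])
  then show "coeff_functional I \<in> carrier (dual_module R E)"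
    and "functional_coeffs (coeff_functional I) = (\<lambda>J. to_fract f ^ p * dx I J)"
    by blast+
qed

text \<open>
  The isomorphism: the \<open>I\<close>-coefficient is the value on the functional that would be dual to \<open>dx\<^sub>I\<close>,
  were it defined over the polynomial ring.
\<close>

definition bidual_form :: "(((rform list \<Rightarrow> cpoly) set \<Rightarrow> cpoly) \<Rightarrow> cpoly) \<Rightarrow> rform"
  where "bidual_form \<Phi> = (\<lambda>I. if I \<in> index_sets n p
    then to_fract (\<Phi> (coeff_functional I)) / to_fract f ^ p else 0)"

text \<open>
  In the dual, \<open>f\<^sup>p \<phi>\<close> is the combination of the coefficient functionals with the coefficients of
  \<open>\<phi>\<close>, and \<open>\<Phi>\<close> is linear.
\<close>

lemma bidual_eq_pairing:
  assumes \<Phi>: "\<Phi> \<in> carrier (dual_module R (dual_module R E))" and \<phi>: "\<phi> \<in> carrier (dual_module R E)"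
  shows "to_fract (\<Phi> \<phi>) = pairing n p (bidual_form \<Phi>) (functional_coeffs \<phi>)"
proof -
  interpret L: Module.module R M
    by (rule module_log_module)
  note add_closed = L.exterior_power_dual_closed(1) and smult_closed = L.exterior_power_dual_closed(2)
  let ?D = "dual_module R E" and ?fp = "to_fract f ^ p"
  have fp: "f ^ p \<in> mpolys n"
    by (rule mpolys_power) (rule f_in_mpolys)
  define r where "r I = \<phi> (wc (dx_tuple I))" for I
  have r: "r I \<in> mpolys n" if "I \<in> index_sets n p" for I
    using dual_moduleD(1) [OF \<phi> wc_closed [OF dx_tuple_in_tuples [OF that]]] by (simp add: r_def)
  have "\<exists>\<chi>\<in>carrier ?D. functional_coeffs \<chi> = (\<lambda>J. \<Sum>I\<in>S. to_fract (r I) * (?fp * dx I J)) \<and>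
      \<Phi> \<chi> = (\<Sum>I\<in>S. r I * \<Phi> (coeff_functional I))" if "finite S" "S \<subseteq> index_sets n p" for S
    using that
  proof (induction S rule: finite_induct)
    case empty
    have "0 \<odot>\<^bsub>?D\<^esub> \<phi> \<in> carrier ?D"
      by (rule smult_closed [OF \<phi>]) simp
    moreover have "functional_coeffs (0 \<odot>\<^bsub>?D\<^esub> \<phi>) = (\<lambda>J. 0)"
      unfolding functional_coeffs_smult [OF \<phi>] by simp
    moreover have "\<Phi> (0 \<odot>\<^bsub>?D\<^esub> \<phi>) = 0"
      using dual_moduleD(3) [OF \<Phi> _ \<phi>, of 0] by simp
    ultimately show ?case
      unfolding sum.empty by blast
  next
    case (insert I S)
    have I: "I \<in> index_sets n p"
      using insert.prems by simp
    obtain \<chi> where \<chi>: "\<chi> \<in> carrier ?D" "functional_coeffs \<chi> = (\<lambda>J. \<Sum>I\<in>S. to_fract (r I) * (?fp * dx I J))"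
        "\<Phi> \<chi> = (\<Sum>I\<in>S. r I * \<Phi> (coeff_functional I))"
      using insert.IH insert.prems by blast
    let ?\<psi> = "r I \<odot>\<^bsub>?D\<^esub> coeff_functional I"
    have rI: "r I \<in> carrier R"
      using r [OF I] by simp
    have \<psi>: "?\<psi> \<in> carrier ?D"
      using coeff_functional_props(1) [OF I] rI by (rule smult_closed)
    have "?\<psi> \<oplus>\<^bsub>?D\<^esub> \<chi> \<in> carrier ?D"
      using \<psi> \<chi>(1) by (rule add_closed)
    moreover have "functional_coeffs (?\<psi> \<oplus>\<^bsub>?D\<^esub> \<chi>) = (\<lambda>J. \<Sum>I\<in>insert I S. to_fract (r I) * (?fp * dx I J))"
      unfolding functional_coeffs_add [OF \<psi> \<chi>(1)] functional_coeffs_smult [OF coeff_functional_props(1) [OF I]]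
        coeff_functional_props(2) [OF I] \<chi>(2)
      using insert.hyps by simp
    moreover have "\<Phi> (?\<psi> \<oplus>\<^bsub>?D\<^esub> \<chi>) = (\<Sum>I\<in>insert I S. r I * \<Phi> (coeff_functional I))"
      unfolding dual_moduleD(2) [OF \<Phi> \<psi> \<chi>(1)] dual_moduleD(3) [OF \<Phi> rI coeff_functional_props(1) [OF I]] \<chi>(3)
      using insert.hyps by simp
    ultimately show ?case
      by blast
  qed
  then obtain \<chi> where \<chi>: "\<chi> \<in> carrier ?D"
      "functional_coeffs \<chi> = (\<lambda>J. \<Sum>I\<in>index_sets n p. to_fract (r I) * (?fp * dx I J))"
      "\<Phi> \<chi> = (\<Sum>I\<in>index_sets n p. r I * \<Phi> (coeff_functional I))"
    using finite_index_sets by blast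
  have fpR: "f ^ p \<in> carrier R"
    using fp by simp
  have supp: "functional_coeffs \<phi> J = 0" if "J \<notin> index_sets n p" for J
    using that by (simp add: functional_coeffs_def)
  have "functional_coeffs \<chi> = functional_coeffs (f ^ p \<odot>\<^bsub>?D\<^esub> \<phi>)"
  proof
    fix J
    have "functional_coeffs \<chi> J = ?fp * (\<Sum>I\<in>index_sets n p. functional_coeffs \<phi> I * dx I J)"
      unfolding \<chi>(2) sum_distrib_left
      by (intro sum.cong) (simp_all add: functional_coeffs_def r_def mult_ac)
    also have "(\<Sum>I\<in>index_sets n p. functional_coeffs \<phi> I * dx I J) = functional_coeffs \<phi> J"
      by (rule fun_cong [OF form_eq_sum_dx [OF finite_index_sets supp], symmetric])
    finally show "functional_coeffs \<chi> J = functional_coeffs (f ^ p \<odot>\<^bsub>?D\<^esub> \<phi>) J"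
      by (simp add: functional_coeffs_smult [OF \<phi>] to_fract_power)
  qed
  then have "\<chi> = f ^ p \<odot>\<^bsub>?D\<^esub> \<phi>"
    by (rule functional_coeffs_inject [OF \<chi>(1) smult_closed [OF \<phi> fpR]])
  then have "f ^ p * \<Phi> \<phi> = \<Phi> \<chi>"
    using dual_moduleD(3) [OF \<Phi> fpR \<phi>] by simp
  then have "?fp * to_fract (\<Phi> \<phi>) = to_fract (\<Phi> \<chi>)"
    by (simp only: flip: to_fract_power to_fract_mult)
  also have "\<dots> = ?fp * pairing n p (bidual_form \<Phi>) (functional_coeffs \<phi>)"
    unfolding \<chi>(3) pairing_def sum_distrib_left to_fract_sum
    using f_nonzero by (intro sum.cong) (simp_all add: bidual_form_def functional_coeffs_def r_def)
  finally show ?thesis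
    using f_nonzero by simp
qed

lemma bidual_form_log_form:
  assumes \<Phi>: "\<Phi> \<in> carrier (dual_module R (dual_module R E))"
  shows "bidual_form \<Phi> \<in> log_forms n \<A> \<alpha> p"
proof (rule log_formI_pairing)
  show "bidual_form \<Phi> I = 0" if "I \<notin> index_sets n p" for I
    using that by (simp add: bidual_form_def)
  fix c assume c: "c \<in> dual_coeffs p"
  obtain \<phi> where \<phi>: "\<phi> \<in> carrier (dual_module R E)"
    and eq: "\<forall>I\<in>index_sets n p. functional_coeffs \<phi> I = c I"
    using functional_coeffs_surj [OF c] by blast
  have "pairing n p (bidual_form \<Phi>) c = pairing n p (bidual_form \<Phi>) (functional_coeffs \<phi>)"
    unfolding pairing_def using eq by simp
  also have "\<dots> = to_fract (\<Phi> \<phi>)"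
    by (rule bidual_eq_pairing [OF \<Phi> \<phi>, symmetric])
  also have "\<dots> \<in> regular n"
    using dual_moduleD(1) [OF \<Phi> \<phi>] by (intro to_fract_in_regular) simp
  finally show "pairing n p (bidual_form \<Phi>) c \<in> regular n" .
qed

text \<open>
  The pairing with a logarithmic form takes polynomial values on the dual lattice, so it is a
  functional on the dual.
\<close>

lemma bidual_form_surj:
  assumes \<omega>: "\<omega> \<in> log_forms n \<A> \<alpha> p"
  shows "\<exists>\<Phi>\<in>carrier (dual_module R (dual_module R E)). bidual_form \<Phi> = \<omega>"
proof -
  interpret L: Module.module R M
    by (rule module_log_module)
  note add_closed = L.exterior_power_dual_closed(1) and smult_closed = L.exterior_power_dual_closed(2)
  let ?D = "dual_module R E"
  define \<Phi> where "\<Phi> = (\<lambda>\<phi>\<in>carrier ?D. poly_of_fract (pairing n p \<omega> (functional_coeffs \<phi>)))"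
  have reg: "pairing n p \<omega> (functional_coeffs \<phi>) \<in> regular n" if "\<phi> \<in> carrier ?D" for \<phi>
    using \<omega> functional_coeffs_in_dual_coeffs [OF that] by (rule log_form_pairing_regular)
  have val: "\<Phi> \<phi> = poly_of_fract (pairing n p \<omega> (functional_coeffs \<phi>))" if "\<phi> \<in> carrier ?D" for \<phi>
    using that by (simp add: \<Phi>_def)
  have "\<Phi> \<in> carrier (dual_module R ?D)"
  proof (rule dual_module_carrierI)
    fix \<phi> assume \<phi>: "\<phi> \<in> carrier ?D"
    show "\<Phi> \<phi> \<in> carrier R"
      using reg [OF \<phi>] by (simp add: val [OF \<phi>] poly_of_fract_in_mpolys)
    show "\<Phi> (\<phi> \<oplus>\<^bsub>?D\<^esub> \<psi>) = \<Phi> \<phi> \<oplus>\<^bsub>R\<^esub> \<Phi> \<psi>" if \<psi>: "\<psi> \<in> carrier ?D" for \<psi>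
      unfolding val [OF \<phi>] val [OF \<psi>] val [OF add_closed [OF \<phi> \<psi>]] functional_coeffs_add [OF \<phi> \<psi>]
        pairing_add_right mpoly_ring_simps
      by (rule poly_of_fract_add [OF reg [OF \<phi>] reg [OF \<psi>]])
    show "\<Phi> (r \<odot>\<^bsub>?D\<^esub> \<phi>) = r \<otimes>\<^bsub>R\<^esub> \<Phi> \<phi>" if r: "r \<in> carrier R" for r
    proof -
      have "to_fract r \<in> regular n"
        using r by (intro to_fract_in_regular) simp
      then have "poly_of_fract (to_fract r * pairing n p \<omega> (functional_coeffs \<phi>))
          = poly_of_fract (to_fract r) * poly_of_fract (pairing n p \<omega> (functional_coeffs \<phi>))"
        by (rule poly_of_fract_mult [OF _ reg [OF \<phi>]])
      then show ?thesis
        unfolding val [OF \<phi>] val [OF smult_closed [OF \<phi> r]] functional_coeffs_smult [OF \<phi>]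
          pairing_scale_right mpoly_ring_simps by simp
    qed
  qed (simp add: \<Phi>_def)
  moreover have "bidual_form \<Phi> I = \<omega> I" for I
  proof (cases "I \<in> index_sets n p")
    case True
    have "to_fract (\<Phi> (coeff_functional I)) = pairing n p \<omega> (functional_coeffs (coeff_functional I))"
      unfolding val [OF coeff_functional_props(1) [OF True]]
      by (rule to_fract_poly_of_fract [OF reg [OF coeff_functional_props(1) [OF True]]])
    also have "\<dots> = to_fract f ^ p * \<omega> I"
      unfolding coeff_functional_props(2) [OF True] pairing_scale_right pairing_dx [OF True] ..
    finally show ?thesis
      using True f_nonzero by (simp add: bidual_form_def)
  next
    case False
    then show ?thesis
      using \<omega> by (simp add: bidual_form_def log_forms_iff)
  qed
  ultimately show ?thesis
    by blast
qed

lemma bidual_exterior_power_isomorphic: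
  "module_isomorphic R (dual_module R (dual_module R E)) (log_module n \<A> \<alpha> p)"
  unfolding module_isomorphic_def
proof (rule bexI [of _ bidual_form])
  let ?D = "dual_module R E"
  let ?DD = "dual_module R ?D"
  have inj: "inj_on bidual_form (carrier ?DD)"
  proof (rule inj_onI)
    fix \<Phi> \<Psi> assume \<Phi>: "\<Phi> \<in> carrier ?DD" and \<Psi>: "\<Psi> \<in> carrier ?DD" and eq: "bidual_form \<Phi> = bidual_form \<Psi>"
    have "\<Phi> \<phi> = \<Psi> \<phi>" if "\<phi> \<in> carrier ?D" for \<phi>
    proof -
      have "to_fract (\<Phi> \<phi>) = to_fract (\<Psi> \<phi>)"
        unfolding bidual_eq_pairing [OF \<Phi> that] bidual_eq_pairing [OF \<Psi> that] eq ..
      then show ?thesis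
        by simp
    qed
    then show "\<Phi> = \<Psi>"
      by (rule extensionalityI [OF dual_moduleD(4) [OF \<Phi>] dual_moduleD(4) [OF \<Psi>]])
  qed
  have "bidual_form ` carrier ?DD = log_forms n \<A> \<alpha> p"
    using bidual_form_log_form bidual_form_surj by blast
  with inj show "bij_betw bidual_form (carrier ?DD) (carrier (log_module n \<A> \<alpha> p))"
    by (simp add: bij_betw_def log_module_simps)
  have "bidual_form (\<Phi> \<oplus>\<^bsub>?DD\<^esub> \<Psi>) = (\<lambda>I. bidual_form \<Phi> I + bidual_form \<Psi> I)" for \<Phi> \<Psi>
    using coeff_functional_props(1) by (auto simp: bidual_form_def dual_module_ops add_divide_distrib)
  moreover have "bidual_form (r \<odot>\<^bsub>?DD\<^esub> \<Phi>) = (\<lambda>I. to_fract r * bidual_form \<Phi> I)" for r \<Phi>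
    using coeff_functional_props(1) by (auto simp: bidual_form_def dual_module_ops)
  ultimately show "bidual_form \<in> LinearCombinations.module_hom R ?DD (log_module n \<A> \<alpha> p)"
    using bidual_form_log_form by (auto simp: LinearCombinations.module_hom_def log_module_simps)
qed

end

end

theorem proposition2p2:
  fixes n p :: nat
    and \<A> :: "complex vec set set"
    and \<alpha> :: "complex vec set \<Rightarrow> complex vec"
  assumes "central_essential_arrangement n \<A> \<alpha>"
    and "p \<le> n"
  shows "module_isomorphic (mpoly_ring n)
    (dual_module (mpoly_ring n) (dual_module (mpoly_ring n)
      (exterior_power (mpoly_ring n) (log_module n \<A> \<alpha> 1) p)))
    (log_module n \<A> \<alpha> p)"
  using central_essential_arrangement.bidual_exterior_power_isomorphic [OF assms(1), of p] by simp

end
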